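(* Let $\Pi$ be an exchangeable random partition of the positive integers with EPPF $p$, and let its asymptotic block frequencies $(P_i)$, with blocks in order of appearance, be represented in the stick-breaking form $$P_i=W_i\prod_{j=1}^{i-1}(1-W_j)$$ for some sequence of random variables $W_1,W_2,\ldots$ with values in $[0,1]$ and $W_1<1$ almost surely. Then $$W_1\text{ is independent of }(W_2,W_3,\ldots)$$ if and only if $$\text{the }W_i\text{ are mutually independent.}$$ If in addition to the independence of $W_1$ and $(W_2,W_3,\ldots)$ the regularity condition $$p(2,2,1)>0\quad\text{and}\quad\lim_{n\to\infty}p(n)=0$$ holds, then $\Pi$ is governed by the extended two-parameter family (that is, $p$ belongs to this family), either with $W_i\stackrel{d}{=}\beta_{1-\alpha,\theta+i\alpha}$ for some $(\alpha,\theta)$ in the parameter range of the family, or with $W_i=1/(M-i+1)$ for $1\le i\le M$, in the coupon-collector case $p=p_M$, for some $M\in\{3,4,\ldots\}$.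
   Context: An exchangeable random partition $\Pi$ of $\mathbb N=\{1,2,\dots\}$ is a random partition whose restriction $\Pi_n$ to $[n]=\{1,\dots,n\}$ satisfies, for every $n$ and every partition $\{B_1,\dots,B_k\}$ of $[n]$, $\mathbb P(\Pi_n=\{B_1,\dots,B_k\})=p(|B_1|,\dots,|B_k|)$ for a symmetric function $p$ of compositions (finite sequences of positive integers); $p$ is its exchangeable partition probability function (EPPF), and $p(n)$ denotes its value at the one-part composition $(n)$. The blocks $\mathcal B_1,\mathcal B_2,\dots$ of $\Pi$ are listed in order of appearance, i.e. by increasing minimal elements, with $\mathcal B_i=\varnothing$ if $i$ exceeds the number of blocks; the frequencies are the almost sure limits $P_i=\lim_n n^{-1}|\mathcal B_i\cap[n]|$. Convention: the sequence $(W_i)$ terminates at the first $k$ (if any) such that $W_k=1$ (terms after termination are regarded as absent, e.g. assigned a fixed cemetery value). Rising factorial: $(x)_n=x(x+1)\cdots(x+n-1)$, $(x)_0=1$. For a composition $\lambda=(\lambda_1,\dots,\lambda_k)$ of $n$, the $(\alpha,\theta)$ EPPF is $$p_{\alpha,\theta}(\lambda)=\frac{\prod_{i=1}^{k-1}(\theta+i\alpha)}{(\theta+1)_{n-1}}\prod_{j=1}^{k}(1-\alpha)_{\lambda_j-1},$$ for parameters either with $0\le\alpha<1$, $\theta>-\alpha$, or with $\alpha<0$ and $\theta=-M\alpha$ for some positive integer $M$; the coupon-collector EPPF is $p_M(\lambda)=M(M-1)\cdots(M-k+1)/M^n$ for a positive integer $M$. The extended two-parameter family consists of all these $p_{\alpha,\theta}$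 and $p_M$. $\beta_{a,b}$ ($a,b>0$) denotes a random variable with the beta$(a,b)$ distribution, of density $\frac{\Gamma(a+b)}{\Gamma(a)\Gamma(b)}u^{a-1}(1-u)^{b-1}$ on $(0,1)$. In the range $\alpha<0$, $\theta=-M\alpha$, the statement $W_i\stackrel{d}{=}\beta_{1-\alpha,\theta+i\alpha}$ is understood for $1\le i\le M$, with the last factor being $W_M=1$. *)

theory Defs
  imports "HOL-Probability.Probability"
begin

definition is_composition :: "nat list \<Rightarrow> bool" where
  "is_composition l \<longleftrightarrow> l \<noteq> [] \<and> (\<forall>m\<in>set l. 1 \<le> m)"

definition eppf_two_param :: "real \<Rightarrow> real \<Rightarrow> nat list \<Rightarrow> real" where
  "eppf_two_param \<alpha> \<theta> l =
     (\<Prod>i\<in>{1..<length l}. \<theta> + real i * \<alpha>) / pochhammer (\<theta> + 1) (sum_list l - 1) *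
     (\<Prod>m\<leftarrow>l. pochhammer (1 - \<alpha>) (m - 1))"

definition eppf_coupon :: "nat \<Rightarrow> nat list \<Rightarrow> real" where
  "eppf_coupon m l = (\<Prod>i<length l. real m - real i) / real m ^ sum_list l"

definition beta_density :: "real \<Rightarrow> real \<Rightarrow> real \<Rightarrow> real" where
  "beta_density a b u =
     (if 0 < u \<and> u < 1
      then Gamma (a + b) / (Gamma a * Gamma b) * u powr (a - 1) * (1 - u) powr (b - 1)
      else 0)"

definition has_beta_law :: "'w measure \<Rightarrow> ('w \<Rightarrow> real) \<Rightarrow> real \<Rightarrow> real \<Rightarrow> bool" where
  "has_beta_law M X a b \<longleftrightarrow>
     0 < a \<and> 0 < b \<and> distributed M lborel X (\<lambda>u. ennreal (beta_density a b u))"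

definition restrict_partition :: "nat \<Rightarrow> nat set set \<Rightarrow> nat set set" where
  "restrict_partition n \<pi> = (\<inter>) {1..n} ` \<pi> - {{}}"

text \<open>
  A random partition is a map into the partitions of \<open>{1..}\<close> all of whose restrictions to
  \<open>{1..n}\<close> are random variables. The \<open>\<sigma>\<close>-algebra these restrictions generate is the usual one.
\<close>

definition random_partition :: "'w measure \<Rightarrow> ('w \<Rightarrow> nat set set) \<Rightarrow> bool" where
  "random_partition M R \<longleftrightarrow>
     (\<forall>\<omega>\<in>space M. partition_on {1..} (R \<omega>)) \<and>
     (\<forall>n. (\<lambda>\<omega>. restrict_partition n (R \<omega>)) \<in>
            measurable M (count_space {\<pi>. partition_on {1..n} \<pi>}))"

text \<open>
  Compositions are lists, so a partition \<open>{B\<^sub>1, \<dots>, B\<^sub>k}\<close> is given by a distinct list of its blocks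
  in an arbitrary order. Values of \<open>p\<close> on lists that are not compositions are irrelevant.
\<close>

definition exchangeable_with_eppf ::
    "'w measure \<Rightarrow> ('w \<Rightarrow> nat set set) \<Rightarrow> (nat list \<Rightarrow> real) \<Rightarrow> bool" where
  "exchangeable_with_eppf M R p \<longleftrightarrow>
     random_partition M R \<and>
     (\<forall>l l'. is_composition l \<and> mset l = mset l' \<longrightarrow> p l = p l') \<and>
     (\<forall>n\<ge>1. \<forall>Bs. distinct Bs \<and> partition_on {1..n} (set Bs) \<longrightarrow>
        measure M {\<omega>\<in>space M. restrict_partition n (R \<omega>) = set Bs} = p (map card Bs))"

text \<open>\<open>Inf B\<close> is the least element of a nonempty set of natural numbers. Ranks start at 1.\<close>

definition appearance_rank :: "nat set set \<Rightarrow> nat set \<Rightarrow> nat" where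
  "appearance_rank \<pi> B = card {C\<in>\<pi>. Inf C \<le> Inf B}"

definition appearance_block :: "nat set set \<Rightarrow> nat \<Rightarrow> nat set" where
  "appearance_block \<pi> i =
     (if \<exists>B\<in>\<pi>. appearance_rank \<pi> B = i
      then THE B. B \<in> \<pi> \<and> appearance_rank \<pi> B = i
      else {})"

definition block_frequencies ::
    "'w measure \<Rightarrow> ('w \<Rightarrow> nat set set) \<Rightarrow> (nat \<Rightarrow> 'w \<Rightarrow> real) \<Rightarrow> bool" where
  "block_frequencies M R P \<longleftrightarrow>
     (\<forall>i\<ge>1. AE \<omega> in M.
        (\<lambda>n. real (card (appearance_block (R \<omega>) i \<inter> {1..n})) / real n) \<longlonglongrightarrow> P i \<omega>)"

text \<open>
  The value of the terms that are absent because the sequence has terminated. It lies outside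
  \<open>{0..1}\<close>, so absence is never confused with a genuine value. It has no influence on the
  stick-breaking product, which contains the factor \<open>1 - 1 = 0\<close> after termination.
\<close>

definition cemetery :: real where
  "cemetery = -1"

definition stick_breaking ::
    "'w measure \<Rightarrow> (nat \<Rightarrow> 'w \<Rightarrow> real) \<Rightarrow> (nat \<Rightarrow> 'w \<Rightarrow> real) \<Rightarrow> bool" where
  "stick_breaking M P W \<longleftrightarrow>
     (\<forall>i\<ge>1. W i \<in> borel_measurable M) \<and>
     (\<forall>i\<ge>1. AE \<omega> in M.
        (if \<exists>j\<in>{1..<i}. W j \<omega> = 1 then W i \<omega> = cemetery else W i \<omega> \<in> {0..1}) \<and>
        P i \<omega> = W i \<omega> * (\<Prod>j\<in>{1..<i}. 1 - W j \<omega>))"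

text \<open>
  The library's \<open>indep_var\<close> requires both variables to have the same value type, hence \<open>W 1\<close>
  is regarded as a family indexed by \<open>{1}\<close>.
\<close>

definition first_indep_of_rest :: "'w measure \<Rightarrow> (nat \<Rightarrow> 'w \<Rightarrow> real) \<Rightarrow> bool" where
  "first_indep_of_rest M W \<longleftrightarrow>
     prob_space.indep_var M
       (PiM {1} (\<lambda>_. borel)) (\<lambda>\<omega>. \<lambda>i\<in>{1}. W i \<omega>)
       (PiM {2..} (\<lambda>_. borel)) (\<lambda>\<omega>. \<lambda>i\<in>{2..}. W i \<omega>)"

end

theory Submission
  imports Defs
begin

text \<open>
  Since the frequencies are limits of averages of exchangeable indicators, the EPPF is
  \<open>p(n\<^sub>1,\<dots>,n\<^sub>k) = E \<Prod>\<^sub>i W\<^sub>i\<^bsup>n\<^sub>i-1\<^esup> (1-W\<^sub>i)\<^bsup>n\<^sub>i\<^sub>+\<^sub>1+\<dots>+n\<^sub>k\<^esup>\<close>. If \<open>W\<^sub>1\<close> is independent of the rest, this factors as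
  \<open>p(n\<^sub>1,\<lambda>) = a(n\<^sub>1,|\<lambda>|) p'(\<lambda>)\<close>, where \<open>p'\<close> is again symmetric. Exchanging \<open>i\<close> and \<open>j\<close> in
  \<open>p(i,j,\<lambda>)\<close> gives \<open>p'(j,\<lambda>) = f(j,|\<lambda>|) p'(1,\<lambda>)\<close>, so the moments of \<open>W\<^sub>2\<close> are uncorrelated with the
  monomials in \<open>W\<^sub>3, W\<^sub>4, \<dots>\<close>. Hence the same factorization holds for \<open>p'\<close>, and by induction all
  \<open>W\<^sub>i\<close> are independent. The cases \<open>p(i,j)\<close> and \<open>p(i,j,1)\<close> of the symmetry determine the laws: with
  \<open>u\<^sub>j = E W\<^sub>2\<^bsup>j-1\<^esup>\<close> the ratios \<open>u\<^sub>j\<^sub>+\<^sub>1 / (u\<^sub>j - u\<^sub>j\<^sub>+\<^sub>1)\<close> form an arithmetic progression, whose common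
  difference is positive in the beta case and zero in the coupon-collector case. In particular
  \<open>W\<^sub>2 = 1\<close> has probability 0 or 1.
\<close>

section \<open>Labels of blocks in order of appearance\<close>

text \<open>The delicate step is the moment formula. Exchangeability moves an element freely only
  among labels that have already appeared, so averaging alone writes \<open>p\<close> as the
  expectation of a frequency monomial over the event that \<open>1..k\<close> lie in distinct
  blocks, with no stick factors. Kingman's representation is avoided by summing over the waiting
  times between first appearances of labels. These sums are geometric series with value
  \<open>1 / (1 - Q_1 - ... - Q_i)\<close>, and their product is a density between the event that
  \<open>k\<close> blocks exist and the event of distinct blocks. Multiplying by the remaining
  masses cancels it.

  The other obstacle is that moments of a stick come only with a weight \<open>(1 - V)^r\<close>,
  where \<open>r\<close> is the size of what follows. Laws on the unit interval are determined by
  moments, and the weight can be divided out if \<open>V < 1\<close> almost surely. So before each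
  step of the induction it must be known whether the process stops; that this is deterministic comes
  from the same two symmetries that determine the laws.\<close>

definition same_block :: "nat set set \<Rightarrow> nat \<Rightarrow> nat \<Rightarrow> bool" where
  "same_block \<pi> l m \<longleftrightarrow> (\<exists>B\<in>\<pi>. l \<in> B \<and> m \<in> B)"

definition block_label :: "nat set set \<Rightarrow> nat \<Rightarrow> nat" where
  "block_label \<pi> m = appearance_rank \<pi> (THE B. B \<in> \<pi> \<and> m \<in> B)"

text \<open>Restricted growth strings: the label sequences of partitions whose blocks are numbered
  by order of appearance. A label is admissible at \<open>m\<close> once all smaller labels have
  occurred before \<open>m\<close>.\<close>

definition restricted_growth :: "nat \<Rightarrow> (nat \<Rightarrow> nat) \<Rightarrow> bool" where
  "restricted_growth n w \<longleftrightarrow>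
    (\<forall>m\<in>{1..n}. 1 \<le> w m \<and> (\<forall>i. 1 \<le> i \<and> i < w m \<longrightarrow> (\<exists>l\<in>{1..<m}. w l = i)))"

lemma partition_on_unique_block:
  assumes "partition_on A \<pi>" "B \<in> \<pi>" "C \<in> \<pi>" "x \<in> B" "x \<in> C"
  shows "B = C"
proof (rule ccontr)
  assume "B \<noteq> C"
  then have "B \<inter> C = {}" by (rule disjointD[OF partition_onD2[OF assms(1)] assms(2,3)])
  with assms(4,5) show False by auto
qed

context
  fixes \<pi> :: "nat set set"
  assumes \<pi>: "partition_on {1..} \<pi>"
begin

lemma block_nonempty: "B \<in> \<pi> \<Longrightarrow> B \<noteq> {}"
  using partition_onD3[OF \<pi>] by auto

lemma Inf_block_mem: "B \<in> \<pi> \<Longrightarrow> Inf B \<in> B"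
  by (rule Inf_nat_def1) (rule block_nonempty)

lemma inj_on_Inf_blocks: "inj_on Inf \<pi>"
proof (rule inj_onI)
  fix B C assume BC: "B \<in> \<pi>" "C \<in> \<pi>" "Inf B = Inf C"
  show "B = C"
    by (rule partition_on_unique_block[OF \<pi> BC(1,2) Inf_block_mem[OF BC(1)]])
      (use Inf_block_mem[OF BC(2)] BC(3) in simp)
qed

lemma finite_blocks_Inf_le: "finite {C\<in>\<pi>. Inf C \<le> n}"
proof (rule finite_imageD)
  show "finite (Inf ` {C\<in>\<pi>. Inf C \<le> n})" by (rule finite_subset[of _ "{..n}"]) auto
  show "inj_on Inf {C\<in>\<pi>. Inf C \<le> n}" by (rule inj_on_subset[OF inj_on_Inf_blocks]) auto
qed

lemma appearance_rank_less:
  assumes "B \<in> \<pi>" "C \<in> \<pi>" "Inf B < Inf C"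
  shows "appearance_rank \<pi> B < appearance_rank \<pi> C"
  unfolding appearance_rank_def
proof (rule psubset_card_mono[OF finite_blocks_Inf_le], rule psubsetI)
  show "{D \<in> \<pi>. Inf D \<le> Inf B} \<subseteq> {D \<in> \<pi>. Inf D \<le> Inf C}"
    using assms(3) by auto
  have "C \<in> {D \<in> \<pi>. Inf D \<le> Inf C}" "C \<notin> {D \<in> \<pi>. Inf D \<le> Inf B}"
    using assms(2,3) by simp_all
  then show "{D \<in> \<pi>. Inf D \<le> Inf B} \<noteq> {D \<in> \<pi>. Inf D \<le> Inf C}" by blast
qed

lemma inj_on_appearance_rank: "inj_on (appearance_rank \<pi>) \<pi>"
proof (rule inj_onI)
  fix B C assume BC: "B \<in> \<pi>" "C \<in> \<pi>" "appearance_rank \<pi> B = appearance_rank \<pi> C"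
  then have "Inf B = Inf C"
    using appearance_rank_less[of B C] appearance_rank_less[of C B]
    by (cases "Inf B" "Inf C" rule: linorder_cases) simp_all
  then show "B = C" using inj_onD[OF inj_on_Inf_blocks _ BC(1,2)] by simp
qed

lemma block_label_eq:
  assumes "B \<in> \<pi>" "m \<in> B"
  shows "block_label \<pi> m = appearance_rank \<pi> B"
proof -
  have "(THE B. B \<in> \<pi> \<and> m \<in> B) = B"
    by (rule the_equality) (use assms partition_on_unique_block[OF \<pi>] in blast)+
  then show ?thesis by (simp add: block_label_def)
qed

lemma block_exists: "1 \<le> m \<Longrightarrow> \<exists>B\<in>\<pi>. m \<in> B"
proof -
  assume "1 \<le> m"
  then have "m \<in> {1..}" by simp
  then show ?thesis unfolding partition_onD1[OF \<pi>] by blast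
qed

lemma block_subset: "B \<in> \<pi> \<Longrightarrow> B \<subseteq> {1..}"
  unfolding partition_onD1[OF \<pi>] by blast

lemma block_label_eq_iff:
  assumes "1 \<le> l" "1 \<le> m"
  shows "block_label \<pi> l = block_label \<pi> m \<longleftrightarrow> same_block \<pi> l m"
proof -
  obtain B C where BC: "B \<in> \<pi>" "l \<in> B" "C \<in> \<pi>" "m \<in> C"
    using block_exists[OF assms(1)] block_exists[OF assms(2)] by blast
  have "block_label \<pi> l = block_label \<pi> m \<longleftrightarrow> B = C"
    using BC inj_on_eq_iff[OF inj_on_appearance_rank BC(1,3)] by (simp add: block_label_eq)
  also have "\<dots> \<longleftrightarrow> same_block \<pi> l m"
    unfolding same_block_def using BC partition_on_unique_block[OF \<pi>] by blast
  finally show ?thesis .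
qed

text \<open>If no block has rank \<open>i\<close>, both sides are empty, so block frequencies are
  label frequencies for every \<open>i\<close>, also beyond the number of blocks.\<close>

lemma appearance_block_eq:
  assumes "1 \<le> i"
  shows "appearance_block \<pi> i = {m. 1 \<le> m \<and> block_label \<pi> m = i}"
proof (cases "\<exists>B\<in>\<pi>. appearance_rank \<pi> B = i")
  case True
  then obtain B where B: "B \<in> \<pi>" "appearance_rank \<pi> B = i" by blast
  have "(THE B. B \<in> \<pi> \<and> appearance_rank \<pi> B = i) = B"
  proof (rule the_equality)
    show "C = B" if C: "C \<in> \<pi> \<and> appearance_rank \<pi> C = i" for C
      by (rule inj_onD[OF inj_on_appearance_rank]) (use C B in simp_all)
  qed (use B in simp)
  then have "appearance_block \<pi> i = B" using True by (simp add: appearance_block_def)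
  also have "B = {m. 1 \<le> m \<and> block_label \<pi> m = i}"
  proof (intro equalityI subsetI)
    fix m assume "m \<in> B"
    then show "m \<in> {m. 1 \<le> m \<and> block_label \<pi> m = i}"
      using B block_subset[of B] block_label_eq[of B m] by auto
  next
    fix m assume m: "m \<in> {m. 1 \<le> m \<and> block_label \<pi> m = i}"
    then obtain C where C: "C \<in> \<pi>" "m \<in> C" using block_exists by auto
    then have "appearance_rank \<pi> C = appearance_rank \<pi> B" using m B block_label_eq[of C m] by simp
    then have "C = B" using inj_onD[OF inj_on_appearance_rank _ C(1) B(1)] by simp
    then show "m \<in> B" using C by simp
  qed
  finally show ?thesis .
next
  case False
  have "block_label \<pi> m \<noteq> i" if m: "1 \<le> m" for m
  proof -
    obtain B where "B \<in> \<pi>" "m \<in> B" using block_exists[OF m] by blast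
    then show ?thesis using False block_label_eq[of B m] by auto
  qed
  then have "{m. 1 \<le> m \<and> block_label \<pi> m = i} = {}" by blast
  then show ?thesis using False by (simp add: appearance_block_def)
qed

text \<open>On the blocks whose minimum is at most that of \<open>B\<close>, the rank is injective
  with values from 1 to their number, hence onto. So every smaller rank belongs to a block with a
  smaller minimum, and that minimum precedes \<open>m\<close>.\<close>

lemma restricted_growth_block_label: "restricted_growth n (block_label \<pi>)"
  unfolding restricted_growth_def
proof (intro ballI conjI allI impI)
  fix m assume m: "m \<in> {1..n}"
  obtain B where B: "B \<in> \<pi>" "m \<in> B" using block_exists m by auto
  note lab = block_label_eq[OF B]
  let ?S = "{C\<in>\<pi>. Inf C \<le> Inf B}"
  have "?S \<noteq> {}" using B by auto
  then show "1 \<le> block_label \<pi> m"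
    unfolding lab appearance_rank_def Suc_le_eq One_nat_def card_gt_0_iff
    using finite_blocks_Inf_le by simp
  fix i assume i: "1 \<le> i \<and> i < block_label \<pi> m"
  have "appearance_rank \<pi> ` ?S \<subseteq> {1..card ?S}"
  proof safe
    fix C assume C: "C \<in> \<pi>" "Inf C \<le> Inf B"
    have "{D\<in>\<pi>. Inf D \<le> Inf C} \<subseteq> ?S" using C by auto
    then have "appearance_rank \<pi> C \<le> card ?S"
      unfolding appearance_rank_def by (rule card_mono[OF finite_blocks_Inf_le])
    moreover have "appearance_rank \<pi> C \<noteq> 0"
      using C finite_blocks_Inf_le[of "Inf C"] by (auto simp: appearance_rank_def card_eq_0_iff)
    ultimately show "appearance_rank \<pi> C \<in> {1..card ?S}" by simp
  qed
  moreover have "card (appearance_rank \<pi> ` ?S) = card ?S"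
    by (rule card_image, rule inj_on_subset[OF inj_on_appearance_rank]) auto
  ultimately have "appearance_rank \<pi> ` ?S = {1..card ?S}"
    by (intro card_subset_eq) auto
  moreover have "i \<in> {1..card ?S}" using i by (simp add: lab appearance_rank_def)
  ultimately have "i \<in> appearance_rank \<pi> ` ?S" by simp
  then obtain C where C: "C \<in> \<pi>" "Inf C \<le> Inf B" "appearance_rank \<pi> C = i" by blast
  have "C \<noteq> B" using C i lab by auto
  then have "Inf C \<noteq> Inf B" using inj_on_eq_iff[OF inj_on_Inf_blocks C(1) B(1)] by simp
  with C have "Inf C < Inf B" by simp
  also have "Inf B \<le> m" by (rule cInf_lower[OF B(2)]) simp
  finally have "Inf C < m" .
  moreover have "1 \<le> Inf C" using block_subset[OF C(1)] Inf_block_mem[OF C(1)] by auto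
  moreover have "block_label \<pi> (Inf C) = i" using block_label_eq[OF C(1) Inf_block_mem[OF C(1)]] C by simp
  ultimately show "\<exists>l\<in>{1..<m}. block_label \<pi> l = i" by (intro bexI[of _ "Inf C"]) auto
qed

lemma partition_on_restrict_partition: "partition_on {1..n} (restrict_partition n \<pi>)"
proof -
  have "partition_on ({1..n} \<inter> {1..}) ((\<inter>) {1..n} ` \<pi> - {{}})"
    by (rule partition_on_restrict[OF \<pi>])
  then show ?thesis by (simp add: restrict_partition_def Int_absorb2 atLeastAtMost_def)
qed

lemma same_block_restrict_partition:
  assumes "l \<in> {1..n}" "m \<in> {1..n}"
  shows "same_block (restrict_partition n \<pi>) l m \<longleftrightarrow> same_block \<pi> l m"
proof
  assume "same_block \<pi> l m"
  then obtain B where "B \<in> \<pi>" "l \<in> B" "m \<in> B" by (auto simp: same_block_def)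
  then show "same_block (restrict_partition n \<pi>) l m"
    unfolding same_block_def restrict_partition_def using assms by (intro bexI[of _ "{1..n} \<inter> B"]) auto
qed (auto simp: same_block_def restrict_partition_def)

end

text \<open>Strong induction. A label that repeats an earlier one is forced by \<open>eq\<close>. A
  new label is the least one not yet used, in both strings: if \<open>w m < w' m\<close>, growth of
  \<open>w'\<close> gives an earlier \<open>l\<close> with \<open>w' l = w m\<close>, and then
  \<open>w l = w m\<close> contradicts newness.\<close>

lemma restricted_growth_unique:
  assumes w: "restricted_growth n w" and w': "restricted_growth n w'"
    and eq: "\<And>l m. l \<in> {1..n} \<Longrightarrow> m \<in> {1..n} \<Longrightarrow> w l = w m \<longleftrightarrow> w' l = w' m"
    and m: "m \<in> {1..n}"
  shows "w m = w' m"
  using m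
proof (induction m rule: less_induct)
  case (less m)
  then have IH: "w l = w' l" if "l \<in> {1..<m}" for l using that by simp
  have 1: "1 \<le> w m" "\<And>i. 1 \<le> i \<Longrightarrow> i < w m \<Longrightarrow> \<exists>l\<in>{1..<m}. w l = i"
    and 2: "1 \<le> w' m" "\<And>i. 1 \<le> i \<Longrightarrow> i < w' m \<Longrightarrow> \<exists>l\<in>{1..<m}. w' l = i"
    using w w' less.prems unfolding restricted_growth_def by blast+
  show ?case
  proof (cases "\<exists>l\<in>{1..<m}. w l = w m")
    case True
    then obtain l where l: "l \<in> {1..<m}" "w l = w m" by blast
    then have "w' l = w' m" using eq[of l m] less.prems by simp
    then show ?thesis using l IH[of l] by simp
  next
    case False
    then have "\<not> (\<exists>l\<in>{1..<m}. w' l = w' m)" using eq[of _ m] less.prems by fastforce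
    moreover have False if "w m < w' m"
      using 2(2)[OF 1(1) that] IH False by auto
    moreover have False if "w' m < w m"
      using 1(2)[OF 2(1) that] IH calculation by auto
    ultimately show ?thesis by (meson linorder_neqE_nat)
  qed
qed

section \<open>Partitions described by the relation of sharing a block\<close>

lemma partition_on_block_eq_same_block:
  assumes "partition_on A \<pi>" "B \<in> \<pi>" "x \<in> B"
  shows "B = {y \<in> A. same_block \<pi> x y}"
proof (intro equalityI subsetI)
  fix y assume "y \<in> B"
  then show "y \<in> {y \<in> A. same_block \<pi> x y}"
    using assms(2,3) unfolding same_block_def partition_onD1[OF assms(1)] by blast
next
  fix y assume "y \<in> {y \<in> A. same_block \<pi> x y}"
  then obtain C where C: "C \<in> \<pi>" "x \<in> C" "y \<in> C" by (auto simp: same_block_def)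
  with partition_on_unique_block[OF assms(1,2) C(1) assms(3) C(2)] show "y \<in> B" by simp
qed

lemma partition_on_eqI_same_block:
  assumes \<pi>: "partition_on A \<pi>" and \<rho>: "partition_on A \<rho>"
    and eq: "\<And>l m. l \<in> A \<Longrightarrow> m \<in> A \<Longrightarrow> same_block \<pi> l m \<longleftrightarrow> same_block \<rho> l m"
  shows "\<pi> = \<rho>"
proof -
  have sub: "\<pi> \<subseteq> \<rho>" if \<pi>: "partition_on A \<pi>" and \<rho>: "partition_on A \<rho>"
    and eq: "\<And>l m. l \<in> A \<Longrightarrow> m \<in> A \<Longrightarrow> same_block \<pi> l m \<longleftrightarrow> same_block \<rho> l m" for \<pi> \<rho>
  proof
    fix B assume B: "B \<in> \<pi>"
    then have "B \<noteq> {}" using partition_onD3[OF \<pi>] by metis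
    then obtain x where x: "x \<in> B" by blast
    have xA: "x \<in> A" using B x unfolding partition_onD1[OF \<pi>] by blast
    then obtain C where C: "C \<in> \<rho>" "x \<in> C" unfolding partition_onD1[OF \<rho>] by blast
    have "B = {y \<in> A. same_block \<pi> x y}" by (rule partition_on_block_eq_same_block[OF \<pi> B x])
    also have "\<dots> = {y \<in> A. same_block \<rho> x y}" by (rule Collect_cong) (use eq[OF xA] in blast)
    also have "\<dots> = C" by (rule partition_on_block_eq_same_block[OF \<rho> C, symmetric])
    finally show "B \<in> \<rho>" using C by simp
  qed
  show ?thesis by (rule equalityI[OF sub[OF \<pi> \<rho> eq] sub[OF \<rho> \<pi> eq[symmetric]]])
qed

lemma same_block_image:
  assumes "inj \<sigma>"
  shows "same_block ((`) \<sigma> ` \<pi>) (\<sigma> l) (\<sigma> m) \<longleftrightarrow> same_block \<pi> l m"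
  using assms by (auto simp: same_block_def inj_image_mem_iff)

lemma partition_on_image_permutes:
  assumes "\<sigma> permutes A" "partition_on A \<pi>"
  shows "partition_on A ((`) \<sigma> ` \<pi>)"
proof -
  have inj: "inj \<sigma>" using permutes_inj[OF assms(1)] .
  show ?thesis
  proof (rule partition_onI)
    show "\<Union> ((`) \<sigma> ` \<pi>) = A"
      using permutes_image[OF assms(1)] unfolding image_Union[symmetric] partition_onD1[OF assms(2), symmetric] .
    show "disjnt p q" if pq: "p \<in> (`) \<sigma> ` \<pi>" "q \<in> (`) \<sigma> ` \<pi>" "p \<noteq> q" for p q
    proof -
      obtain B C where "B \<in> \<pi>" "C \<in> \<pi>" "p = \<sigma> ` B" "q = \<sigma> ` C" using pq by blast
      moreover from this have "B \<inter> C = {}"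
        using pq(3) by (intro disjointD[OF partition_onD2[OF assms(2)]]) auto
      ultimately show ?thesis by (simp add: disjnt_def image_Int[OF inj, symmetric])
    qed
    show "{} \<notin> (`) \<sigma> ` \<pi>" using partition_onD3[OF assms(2)] by auto
  qed
qed

lemma card_image_inj_vimage:
  assumes "inj \<sigma>"
  shows "card {m \<in> \<sigma> ` S. w (inv \<sigma> m) = i} = card {m \<in> S. w m = i}"
proof -
  have "{m \<in> \<sigma> ` S. w (inv \<sigma> m) = i} = \<sigma> ` {m \<in> S. w m = i}" using assms by auto
  then show ?thesis by (simp add: card_image inj_on_subset[OF assms])
qed

text \<open>The EPPF speaks of initial segments only; this moves a set with gaps onto one.\<close>

lemma exists_permutation_onto_initial_segment:
  assumes "S \<subseteq> {1..N::nat}"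
  obtains \<sigma> where "\<sigma> permutes {1..N}" "\<sigma> ` S = {1..card S}"
proof -
  have fin: "finite S" using assms finite_subset by blast
  have le: "card S \<le> N" using card_mono[OF _ assms] by simp
  obtain f where f: "bij_betw f S {1..card S}"
    using finite_same_card_bij[OF fin, of "{1..card S}"] by auto
  have "card ({1..N} - S) = card ({1..N} - {1..card S})"
    using assms le fin by (simp add: card_Diff_subset)
  then obtain g where g: "bij_betw g ({1..N} - S) ({1..N} - {1..card S})"
    using finite_same_card_bij[of "{1..N} - S" "{1..N} - {1..card S}"] by auto
  define \<sigma> where "\<sigma> m = (if m \<in> S then f m else if m \<in> {1..N} then g m else m)" for m
  have bS: "bij_betw \<sigma> S {1..card S}"
    using f by (subst bij_betw_cong[where g = f]) (auto simp: \<sigma>_def)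
  have bC: "bij_betw \<sigma> ({1..N} - S) ({1..N} - {1..card S})"
    using g by (subst bij_betw_cong[where g = g]) (auto simp: \<sigma>_def)
  have "bij_betw \<sigma> (S \<union> ({1..N} - S)) ({1..card S} \<union> ({1..N} - {1..card S}))"
    by (rule bij_betw_combine[OF bS bC]) auto
  moreover have "S \<union> ({1..N} - S) = {1..N}" "{1..card S} \<union> ({1..N} - {1..card S}) = {1..N}"
    using assms le by auto
  ultimately have "bij_betw \<sigma> {1..N} {1..N}" by simp
  then have "\<sigma> permutes {1..N}"
    by (rule bij_imp_permutes) (use assms in \<open>auto simp: \<sigma>_def\<close>)
  moreover have "\<sigma> ` S = {1..card S}" using bS by (simp add: bij_betw_def)
  ultimately show ?thesis using that by blast
qed

text \<open>The fibres of a labelling, listed by label, are the ordered list of blocks that the EPPF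
  takes as argument.\<close>

lemma partition_on_fibres:
  assumes "w ` S = {1..k}"
  defines "Bs \<equiv> map (\<lambda>i. {m \<in> S. w m = i}) [1..<Suc k]"
  shows "distinct Bs" "partition_on S (set Bs)"
    "l \<in> S \<Longrightarrow> m \<in> S \<Longrightarrow> same_block (set Bs) l m \<longleftrightarrow> w l = w m"
proof -
  have set: "set Bs = (\<lambda>i. {m \<in> S. w m = i}) ` {1..k}"
    by (simp add: Bs_def atLeastLessThanSuc_atLeastAtMost del: upt_Suc)
  have ne: "{m \<in> S. w m = i} \<noteq> {}" if "i \<in> {1..k}" for i
  proof -
    have "i \<in> w ` S" using that assms(1) by simp
    then show ?thesis by blast
  qed
  have "inj_on (\<lambda>i. {m \<in> S. w m = i}) {1..k}"
    by (rule inj_onI) (use ne in blast)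
  then show "distinct Bs"
    by (simp add: Bs_def distinct_map atLeastLessThanSuc_atLeastAtMost del: upt_Suc)
  show "partition_on S (set Bs)"
  proof (rule partition_onI)
    have "\<Union> (set Bs) = {m \<in> S. w m \<in> {1..k}}" by (auto simp: set)
    also have "\<dots> = S" using assms(1) by blast
    finally show "\<Union> (set Bs) = S" .
    show "disjnt p q" if "p \<in> set Bs" "q \<in> set Bs" "p \<noteq> q" for p q
      using that by (auto simp: set disjnt_def)
    show "{} \<notin> set Bs" unfolding set using ne by blast
  qed
  show "same_block (set Bs) l m \<longleftrightarrow> w l = w m" if "l \<in> S" "m \<in> S"
    using that assms(1) by (auto simp: same_block_def set)
qed

section \<open>Exchangeability: probabilities of label events\<close>

locale exchangeable_partition = prob_space +
  fixes R :: "'a \<Rightarrow> nat set set" and p :: "nat list \<Rightarrow> real"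
  assumes exch: "exchangeable_with_eppf M R p"
begin

lemma R_partition: "\<omega> \<in> space M \<Longrightarrow> partition_on {1..} (R \<omega>)"
  using exch by (auto simp: exchangeable_with_eppf_def random_partition_def)

lemma R_measurable [measurable]:
  "(\<lambda>\<omega>. restrict_partition n (R \<omega>)) \<in> measurable M (count_space {\<pi>. partition_on {1..n} \<pi>})"
  using exch by (auto simp: exchangeable_with_eppf_def random_partition_def)

lemma prob_restrict_partition:
  "1 \<le> n \<Longrightarrow> distinct Bs \<Longrightarrow> partition_on {1..n} (set Bs) \<Longrightarrow>
    prob {\<omega>\<in>space M. restrict_partition n (R \<omega>) = set Bs} = p (map card Bs)"
  using exch by (auto simp: exchangeable_with_eppf_def)

text \<open>The EPPF sees only block sizes, and a permutation preserves them.\<close>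

lemma prob_restrict_partition_permute:
  assumes "1 \<le> n" and \<sigma>: "\<sigma> permutes {1..n}" and \<pi>: "partition_on {1..n} \<pi>"
  shows "prob {\<omega>\<in>space M. restrict_partition n (R \<omega>) = (`) \<sigma> ` \<pi>} = prob {\<omega>\<in>space M. restrict_partition n (R \<omega>) = \<pi>}"
proof -
  have inj: "inj \<sigma>" using permutes_inj[OF \<sigma>] .
  have "finite \<pi>" using \<pi> by (rule finite_elements[rotated]) simp
  then obtain Bs where Bs: "distinct Bs" "set Bs = \<pi>" using finite_distinct_list by blast
  have "distinct (map ((`) \<sigma>) Bs)"
    using Bs inj by (auto simp: distinct_map inj_on_def inj_image_eq_iff)
  moreover have "partition_on {1..n} (set (map ((`) \<sigma>) Bs))"
    using partition_on_image_permutes[OF \<sigma> \<pi>] Bs by simp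
  ultimately have "prob {\<omega>\<in>space M. restrict_partition n (R \<omega>) = set (map ((`) \<sigma>) Bs)} = p (map card (map ((`) \<sigma>) Bs))"
    by (rule prob_restrict_partition[OF assms(1)])
  also have "map card (map ((`) \<sigma>) Bs) = map card Bs"
    by (simp add: card_image inj_on_subset[OF inj])
  also have "p \<dots> = prob {\<omega>\<in>space M. restrict_partition n (R \<omega>) = set Bs}"
    by (rule prob_restrict_partition[OF assms(1), symmetric]) (use Bs \<pi> in auto)
  finally show ?thesis using Bs by simp
qed

text \<open>The set \<open>S\<close> may have gaps: averaging over late elements needs the labels on
  an initial segment together with a label far beyond it. Such events are decomposed over all
  partitions of a segment that contains \<open>S\<close>.\<close>

definition kernel_event :: "nat set \<Rightarrow> (nat \<Rightarrow> nat) \<Rightarrow> 'a set" where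
  "kernel_event S w = {\<omega>\<in>space M. \<forall>l\<in>S. \<forall>m\<in>S. same_block (R \<omega>) l m \<longleftrightarrow> w l = w m}"

definition kernel_partitions :: "nat \<Rightarrow> nat set \<Rightarrow> (nat \<Rightarrow> nat) \<Rightarrow> nat set set set" where
  "kernel_partitions n S w = {\<pi>. partition_on {1..n} \<pi> \<and> (\<forall>l\<in>S. \<forall>m\<in>S. same_block \<pi> l m \<longleftrightarrow> w l = w m)}"

lemma restrict_partition_event [measurable]:
  "{\<omega>\<in>space M. restrict_partition n (R \<omega>) = \<pi>} \<in> events"
proof (cases "partition_on {1..n} \<pi>")
  case True
  have "(\<lambda>\<omega>. restrict_partition n (R \<omega>)) -` {\<pi>} \<inter> space M \<in> events"
    by (rule measurable_sets[OF R_measurable]) (use True in simp)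
  also have "(\<lambda>\<omega>. restrict_partition n (R \<omega>)) -` {\<pi>} \<inter> space M = {\<omega>\<in>space M. restrict_partition n (R \<omega>) = \<pi>}"
    by auto
  finally show ?thesis .
next
  case False
  then have "{\<omega>\<in>space M. restrict_partition n (R \<omega>) = \<pi>} = {}"
    using partition_on_restrict_partition R_partition by blast
  then show ?thesis by simp
qed

lemma kernel_event_eq:
  assumes "S \<subseteq> {1..n}"
  shows "kernel_event S w = (\<Union>\<pi>\<in>kernel_partitions n S w. {\<omega>\<in>space M. restrict_partition n (R \<omega>) = \<pi>})"
proof -
  have "(\<forall>l\<in>S. \<forall>m\<in>S. same_block (R \<omega>) l m \<longleftrightarrow> w l = w m) \<longleftrightarrow> restrict_partition n (R \<omega>) \<in> kernel_partitions n S w"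
    if "\<omega> \<in> space M" for \<omega>
  proof -
    have "same_block (restrict_partition n (R \<omega>)) l m \<longleftrightarrow> same_block (R \<omega>) l m" if "l \<in> S" "m \<in> S" for l m
      by (rule same_block_restrict_partition[OF R_partition]) (use \<open>\<omega> \<in> space M\<close> that assms in auto)
    then show ?thesis
      using partition_on_restrict_partition[OF R_partition[OF that]] by (auto simp: kernel_partitions_def)
  qed
  then show ?thesis by (auto simp: kernel_event_def)
qed

lemma finite_kernel_partitions: "finite (kernel_partitions n S w)"
  by (rule finite_subset[OF _ finitely_many_partition_on[of "{1..n}"]]) (auto simp: kernel_partitions_def)

lemma kernel_event_measurable:
  assumes "S \<subseteq> {1..n}" shows "kernel_event S w \<in> events"
  unfolding kernel_event_eq[OF assms]
  by (intro sets.finite_UN finite_kernel_partitions restrict_partition_event)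

lemma prob_kernel_event_sum:
  assumes "S \<subseteq> {1..n}"
  shows "prob (kernel_event S w) = (\<Sum>\<pi>\<in>kernel_partitions n S w. prob {\<omega>\<in>space M. restrict_partition n (R \<omega>) = \<pi>})"
  unfolding kernel_event_eq[OF assms]
  by (rule finite_measure_finite_Union[OF finite_kernel_partitions]) (auto simp: disjoint_family_on_def)

lemma kernel_partitions_image:
  assumes \<sigma>: "\<sigma> permutes {1..n}" and S: "S \<subseteq> {1..n}"
  shows "((`) ((`) \<sigma>)) ` kernel_partitions n S w = kernel_partitions n (\<sigma> ` S) (w \<circ> inv \<sigma>)"
proof -
  have sub: "((`) ((`) \<sigma>)) ` kernel_partitions n S w \<subseteq> kernel_partitions n (\<sigma> ` S) (w \<circ> inv \<sigma>)"
    if \<sigma>: "\<sigma> permutes {1..n}" for \<sigma> S w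
    using that partition_on_image_permutes[OF that] permutes_inj[OF that]
    by (auto simp: kernel_partitions_def same_block_image)
  have inj: "inj \<sigma>" using permutes_inj[OF \<sigma>] .
  have comp: "\<sigma> ` inv \<sigma> ` A = A" for A
    using permutes_surj[OF \<sigma>] by (simp add: image_f_inv_f)
  show ?thesis
  proof (rule equalityI[OF sub[OF \<sigma>]])
    \<comment> \<open>The reverse inclusion is the forward one for \<open>inv \<sigma>\<close>,
      transported back by \<open>\<sigma>\<close>.\<close>
    show "kernel_partitions n (\<sigma> ` S) (w \<circ> inv \<sigma>) \<subseteq> ((`) ((`) \<sigma>)) ` kernel_partitions n S w"
    proof
      fix \<pi> assume \<pi>: "\<pi> \<in> kernel_partitions n (\<sigma> ` S) (w \<circ> inv \<sigma>)"
      have "(`) (inv \<sigma>) ` \<pi> \<in> kernel_partitions n (inv \<sigma> ` \<sigma> ` S) (w \<circ> inv \<sigma> \<circ> inv (inv \<sigma>))"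
        using sub[OF permutes_inv[OF \<sigma>]] \<pi> by blast
      also have "inv \<sigma> ` \<sigma> ` S = S" using inj by (simp add: image_inv_f_f)
      also have "w \<circ> inv \<sigma> \<circ> inv (inv \<sigma>) = w"
        using permutes_inv_inv[OF \<sigma>] inj by (simp add: comp_def)
      finally have "(`) (inv \<sigma>) ` \<pi> \<in> kernel_partitions n S w" .
      moreover have "\<pi> = (`) \<sigma> ` (`) (inv \<sigma>) ` \<pi>" by (simp add: image_image comp[unfolded image_image])
      ultimately show "\<pi> \<in> ((`) ((`) \<sigma>)) ` kernel_partitions n S w" by blast
    qed
  qed
qed

text \<open>Written as a finite sum over partitions of \<open>{1..N}\<close>, the probability is
  unchanged when a permutation moves \<open>S\<close> onto \<open>{1..s}\<close>. On a full segment
  the kernel of the labelling determines the partition, and the EPPF applies.\<close>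

lemma prob_kernel_event:
  assumes S: "finite S" "S \<noteq> {}" "S \<subseteq> {1..}" and w: "w ` S = {1..k}"
  shows "prob (kernel_event S w) = p (map (\<lambda>i. card {m \<in> S. w m = i}) [1..<Suc k])"
proof -
  define N where "N = Max S"
  have SN: "S \<subseteq> {1..N}" using S by (auto simp: N_def)
  obtain \<sigma> where \<sigma>: "\<sigma> permutes {1..N}" "\<sigma> ` S = {1..card S}"
    using exists_permutation_onto_initial_segment[OF SN] by blast
  have N1: "1 \<le> N"
  proof -
    obtain x where "x \<in> S" using S(2) by blast
    then have "x \<in> {1..N}" using SN by blast
    then show ?thesis by simp
  qed
  have inj: "inj \<sigma>" using permutes_inj[OF \<sigma>(1)] .
  define s where "s = card S"
  have s: "1 \<le> s" "{1..s} \<subseteq> {1..N}" using S card_mono[OF _ SN] by (auto simp: s_def Suc_le_eq card_gt_0_iff)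
  define w' where "w' = w \<circ> inv \<sigma>"
  have "inj ((`) ((`) \<sigma>))" using inj by (simp add: inj_image_eq_iff inj_def)
  then have injK: "inj_on ((`) ((`) \<sigma>)) (kernel_partitions N S w)" by (rule inj_on_subset) simp
  have "prob (kernel_event {1..s} w') = (\<Sum>\<pi>\<in>kernel_partitions N {1..s} w'. prob {\<omega>\<in>space M. restrict_partition N (R \<omega>) = \<pi>})"
    by (rule prob_kernel_event_sum) (rule s)
  also have "kernel_partitions N {1..s} w' = ((`) ((`) \<sigma>)) ` kernel_partitions N S w"
    using kernel_partitions_image[OF \<sigma>(1) SN, of w] \<sigma>(2) by (simp add: s_def w'_def)
  also have "(\<Sum>\<pi>\<in>\<dots>. prob {\<omega>\<in>space M. restrict_partition N (R \<omega>) = \<pi>})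
    = (\<Sum>\<pi>\<in>kernel_partitions N S w. prob {\<omega>\<in>space M. restrict_partition N (R \<omega>) = \<pi>})"
    by (subst sum.reindex[OF injK])
      (auto intro!: sum.cong prob_restrict_partition_permute[OF N1 \<sigma>(1)] simp: kernel_partitions_def)
  also have "\<dots> = prob (kernel_event S w)"
    by (rule prob_kernel_event_sum[OF SN, symmetric])
  finally have eq: "prob (kernel_event S w) = prob (kernel_event {1..s} w')" by simp
  have "w' ` {1..s} = w ` inv \<sigma> ` \<sigma> ` S"
    unfolding s_def \<sigma>(2)[symmetric] w'_def by (simp add: image_comp)
  then have w': "w' ` {1..s} = {1..k}"
    using w inj by (simp only: image_inv_f_f)
  note fib = partition_on_fibres[OF w']
  let ?Bs = "map (\<lambda>i. {m \<in> {1..s}. w' m = i}) [1..<Suc k]"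
  have "kernel_partitions s {1..s} w' = {set ?Bs}"
  proof (rule equalityI; rule subsetI)
    fix \<pi> assume "\<pi> \<in> kernel_partitions s {1..s} w'"
    then have "partition_on {1..s} \<pi>" "\<And>l m. l \<in> {1..s} \<Longrightarrow> m \<in> {1..s} \<Longrightarrow> same_block \<pi> l m \<longleftrightarrow> same_block (set ?Bs) l m"
      unfolding kernel_partitions_def fib(3) by blast+
    then have "\<pi> = set ?Bs" by (rule partition_on_eqI_same_block[OF _ fib(2)])
    then show "\<pi> \<in> {set ?Bs}" by simp
  next
    fix \<pi> assume "\<pi> \<in> {set ?Bs}"
    then show "\<pi> \<in> kernel_partitions s {1..s} w'"
      using fib(2,3) unfolding kernel_partitions_def by blast
  qed
  then have "prob (kernel_event {1..s} w') = prob {\<omega>\<in>space M. restrict_partition s (R \<omega>) = set ?Bs}"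
    using prob_kernel_event_sum[of "{1..s}" s w'] by (simp del: upt_Suc)
  also have "\<dots> = p (map card ?Bs)"
    by (rule prob_restrict_partition[OF s(1) fib(1,2)])
  also have "map card ?Bs = map (\<lambda>i. card {m \<in> S. w m = i}) [1..<Suc k]"
    unfolding s_def \<sigma>(2)[symmetric] w'_def using card_image_inj_vimage[OF inj, of S w] by (simp del: upt_Suc)
  finally show ?thesis using eq by simp
qed

text \<open>On \<open>{1..n}\<close> the labels are recovered from the kernel by
  \<open>restricted_growth_unique\<close>. Every other element of \<open>S\<close> shares its label
  with an element of \<open>{1..n}\<close>, so its label is determined as well.\<close>

lemma label_event_eq_kernel_event:
  assumes S: "{1..n} \<subseteq> S" "S \<subseteq> {1..}" and w: "restricted_growth n w" "w ` S \<subseteq> w ` {1..n}"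
  shows "{\<omega>\<in>space M. \<forall>m\<in>S. block_label (R \<omega>) m = w m} = kernel_event S w"
proof -
  have "(\<forall>m\<in>S. block_label (R \<omega>) m = w m) \<longleftrightarrow> (\<forall>l\<in>S. \<forall>m\<in>S. same_block (R \<omega>) l m \<longleftrightarrow> w l = w m)"
    if \<omega>: "\<omega> \<in> space M" for \<omega>
  proof -
    note \<pi> = R_partition[OF \<omega>]
    have lab: "block_label (R \<omega>) l = block_label (R \<omega>) m \<longleftrightarrow> same_block (R \<omega>) l m" if "l \<in> S" "m \<in> S" for l m
      by (rule block_label_eq_iff[OF \<pi>]) (use that S in auto)
    show ?thesis
    proof
      assume "\<forall>m\<in>S. block_label (R \<omega>) m = w m"
      then show "\<forall>l\<in>S. \<forall>m\<in>S. same_block (R \<omega>) l m \<longleftrightarrow> w l = w m" using lab by force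
    next
      assume *: "\<forall>l\<in>S. \<forall>m\<in>S. same_block (R \<omega>) l m \<longleftrightarrow> w l = w m"
      have init: "block_label (R \<omega>) m = w m" if "m \<in> {1..n}" for m
        by (rule restricted_growth_unique[OF restricted_growth_block_label[OF \<pi>] w(1) _ that])
          (use * lab S in blast)
      show "\<forall>m\<in>S. block_label (R \<omega>) m = w m"
      proof
        fix m assume m: "m \<in> S"
        then obtain l where l: "l \<in> {1..n}" "w m = w l" using w(2) by blast
        then have "block_label (R \<omega>) m = block_label (R \<omega>) l" using * lab[OF m, of l] m S by auto
        then show "block_label (R \<omega>) m = w m" using init[of l] l by simp
      qed
    qed
  qed
  then show ?thesis by (auto simp: kernel_event_def)
qed

lemma prob_label_event:
  assumes n: "1 \<le> n" and S: "finite S" "{1..n} \<subseteq> S" "S \<subseteq> {1..}"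
    and w: "restricted_growth n w" "w ` {1..n} = {1..k}" "w ` S \<subseteq> {1..k}"
  shows "prob {\<omega>\<in>space M. \<forall>m\<in>S. block_label (R \<omega>) m = w m} = p (map (\<lambda>i. card {m \<in> S. w m = i}) [1..<Suc k])"
proof -
  have wS: "w ` S = {1..k}" using w S by blast
  have "S \<noteq> {}" using n S(2) by auto
  from prob_kernel_event[OF S(1) this S(3) wS] show ?thesis
    by (subst label_event_eq_kernel_event[OF S(2,3) w(1)]) (use w in auto)
qed

text \<open>If \<open>w m > m\<close>, all labels from 1 to \<open>m\<close> would have to occur at
  the \<open>m - 1\<close> earlier positions.\<close>

lemma restricted_growth_le: "restricted_growth n w \<Longrightarrow> m \<in> {1..n} \<Longrightarrow> w m \<le> m"
proof (rule ccontr)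
  assume w: "restricted_growth n w" and m: "m \<in> {1..n}" and "\<not> w m \<le> m"
  then have gt: "m < w m" by simp
  have "i \<in> w ` {1..<m}" if "i \<in> {1..m}" for i
  proof -
    have "\<exists>l\<in>{1..<m}. w l = i" using w m gt that unfolding restricted_growth_def by auto
    then show ?thesis by blast
  qed
  then have "{1..m} \<subseteq> w ` {1..<m}" by blast
  then have "card {1..m} \<le> card (w ` {1..<m})" by (rule card_mono[rotated]) simp
  also have "\<dots> \<le> card {1..<m}" by (rule card_image_le) simp
  finally have "m \<le> m - 1" by simp
  then show False using m by (cases m) auto
qed

text \<open>Only restrictions of the partition are random variables by assumption. The event splits
  into label strings on \<open>{1..m}\<close>, finitely many by \<open>restricted_growth_le\<close>,
  and each of them is a kernel event.\<close>

lemma block_label_measurable: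
  assumes "1 \<le> m" shows "(\<lambda>\<omega>. block_label (R \<omega>) m) \<in> measurable M (count_space UNIV)"
proof (rule measurable_count_space_eq2_countable[THEN iffD2], intro conjI ballI)
  fix i
  let ?W = "{w \<in> {1..m} \<rightarrow>\<^sub>E {1..m}. restricted_growth m w \<and> w m = i}"
  have "(\<lambda>\<omega>. block_label (R \<omega>) m) -` {i} \<inter> space M = (\<Union>w\<in>?W. {\<omega>\<in>space M. \<forall>l\<in>{1..m}. block_label (R \<omega>) l = w l})"
  proof (intro equalityI subsetI)
    fix \<omega> assume \<omega>: "\<omega> \<in> (\<lambda>\<omega>. block_label (R \<omega>) m) -` {i} \<inter> space M"
    let ?L = "block_label (R \<omega>)"
    have rg: "restricted_growth m ?L" using \<omega> by (intro restricted_growth_block_label R_partition) simp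
    have "restrict ?L {1..m} \<in> ?W"
    proof (intro CollectI conjI)
      show "restrict ?L {1..m} \<in> {1..m} \<rightarrow>\<^sub>E {1..m}"
        using rg restricted_growth_le[OF rg] by (fastforce simp: restricted_growth_def)
      show "restricted_growth m (restrict ?L {1..m})"
        unfolding restricted_growth_def
      proof (intro ballI conjI allI impI)
        fix l i assume l: "l \<in> {1..m}"
        show "1 \<le> restrict ?L {1..m} l" using rg l by (auto simp: restricted_growth_def)
        assume "1 \<le> i \<and> i < restrict ?L {1..m} l"
        then obtain l' where "l' \<in> {1..<l}" "?L l' = i" using rg l by (fastforce simp: restricted_growth_def)
        then show "\<exists>l'\<in>{1..<l}. restrict ?L {1..m} l' = i" using l by (intro bexI[of _ l']) auto
      qed
      show "restrict ?L {1..m} m = i" using \<omega> assms by simp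
    qed
    then show "\<omega> \<in> (\<Union>w\<in>?W. {\<omega>\<in>space M. \<forall>l\<in>{1..m}. block_label (R \<omega>) l = w l})"
      using \<omega> by (intro UN_I[of "restrict ?L {1..m}"]) auto
  next
    fix \<omega> assume "\<omega> \<in> (\<Union>w\<in>?W. {\<omega>\<in>space M. \<forall>l\<in>{1..m}. block_label (R \<omega>) l = w l})"
    then show "\<omega> \<in> (\<lambda>\<omega>. block_label (R \<omega>) m) -` {i} \<inter> space M" using assms by auto
  qed
  also have "\<dots> \<in> events"
  proof (rule sets.finite_UN)
    show "finite ?W" by (rule finite_subset[OF _ finite_PiE[of "{1..m}" "\<lambda>_. {1..m}"]]) auto
    show "{\<omega>\<in>space M. \<forall>l\<in>{1..m}. block_label (R \<omega>) l = w l} \<in> events" if "w \<in> ?W" for w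
      using that by (subst label_event_eq_kernel_event[of m]) (auto intro: kernel_event_measurable[of _ m])
  qed
  finally show "(\<lambda>\<omega>. block_label (R \<omega>) m) -` {i} \<inter> space M \<in> events" .
qed auto

end

section \<open>The EPPF as an expectation of frequencies\<close>

lemma restricted_growth_cong:
  assumes "\<And>m. m \<in> {1..n} \<Longrightarrow> w m = w' m"
  shows "restricted_growth n w \<longleftrightarrow> restricted_growth n w'"
proof -
  have "(\<exists>l\<in>{1..<m}. w l = i) \<longleftrightarrow> (\<exists>l\<in>{1..<m}. w' l = i)" if "m \<in> {1..n}" for m i
    by (rule bex_cong) (use assms that in auto)
  then show ?thesis unfolding restricted_growth_def using assms by simp
qed

lemma restricted_growth_Suc:
  "restricted_growth (Suc n) w \<longleftrightarrow>
    restricted_growth n w \<and> 1 \<le> w (Suc n) \<and> (\<forall>i. 1 \<le> i \<and> i < w (Suc n) \<longrightarrow> (\<exists>l\<in>{1..n}. w l = i))"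
  unfolding restricted_growth_def by (auto simp: atLeastAtMostSuc_conv atLeastLessThanSuc_atLeastAtMost)

lemma restricted_growth_upd:
  assumes w: "restricted_growth n w" "w ` {1..n} = {1..j}" and i: "1 \<le> i" "i \<le> Suc j"
  shows "restricted_growth (Suc n) (w(Suc n := i))"
proof -
  have "restricted_growth n (w(Suc n := i))"
    using w(1) by (subst restricted_growth_cong[of n _ w]) auto
  moreover have "\<exists>l\<in>{1..n}. (w(Suc n := i)) l = a" if "1 \<le> a" "a < i" for a
  proof -
    have "a \<in> w ` {1..n}" unfolding w(2) using that i by simp
    then obtain l where "l \<in> {1..n}" "w l = a" by blast
    then show ?thesis by (intro bexI[of _ l]) auto
  qed
  ultimately show ?thesis using i by (simp add: restricted_growth_Suc)
qed

lemma image_upd_Suc: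
  assumes "w ` {1..n} = {1..j}"
  shows "(w(Suc n := i)) ` {1..Suc n} = insert i {1..j}"
proof -
  have "(w(Suc n := i)) ` {1..Suc n} = insert i (w ` {1..n})"
    by (auto simp: atLeastAtMostSuc_conv)
  then show ?thesis using assms by simp
qed

lemma card_fibre_insert:
  assumes "finite S" "m \<notin> S"
  shows "card {l \<in> insert m S. (w(m := i)) l = i'} = card {l \<in> S. w l = i'} + of_bool (i' = i)"
proof -
  have "{l \<in> insert m S. (w(m := i)) l = i'} = (if i' = i then insert m {l \<in> S. w l = i'} else {l \<in> S. w l = i'})"
    using assms(2) by auto
  then show ?thesis using assms by simp
qed

text \<open>Monomials are written as products over lists of labels, because they are built up and
  taken apart one factor at a time. This provides a list for prescribed exponents; the same list has
  to serve for all \<open>f\<close>, since \<open>f\<close> will depend on the outcome.\<close>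

lemma exists_list_with_counts:
  "\<exists>v. set v \<subseteq> {1..k} \<and> (\<forall>i\<in>{1..k}. count_list v i = e i) \<and>
    (\<forall>f :: nat \<Rightarrow> 'b::comm_monoid_mult. (\<Prod>i\<leftarrow>v. f i) = (\<Prod>i\<in>{1..k}. f i ^ e i))"
proof (induction k)
  case (Suc k)
  then obtain v where v: "set v \<subseteq> {1..k}" "\<forall>i\<in>{1..k}. count_list v i = e i"
    "\<And>f :: nat \<Rightarrow> 'b. (\<Prod>i\<leftarrow>v. f i) = (\<Prod>i\<in>{1..k}. f i ^ e i)" by blast
  have rep: "count_list (replicate a x) y = (if x = y then a else 0)" for a and x y :: nat
    by (induction a) auto
  have "count_list v (Suc k) = 0" using v(1) by (intro count_notin) auto
  then have "\<forall>i\<in>{1..Suc k}. count_list (v @ replicate (e (Suc k)) (Suc k)) i = e i"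
    using v(2) by (auto simp: rep atLeastAtMostSuc_conv)
  moreover have "set (v @ replicate (e (Suc k)) (Suc k)) \<subseteq> {1..Suc k}"
    using v(1) by auto
  moreover have "(\<Prod>i\<leftarrow>v @ replicate (e (Suc k)) (Suc k). f i) = (\<Prod>i\<in>{1..Suc k}. f i ^ e i)" for f :: "nat \<Rightarrow> 'b"
    using v(3)[of f] by (simp add: prod_list_replicate mult.commute)
  ultimately show ?case by blast
qed (auto intro: exI[of _ "[]"])

text \<open>The moment formula concerns only the label sequence \<open>L\<close> and the label
  frequencies \<open>Q\<close>. In \<open>prob_labels\<close> every label used on \<open>S\<close>
  already occurs in \<open>{1..n}\<close>; under this restriction the other elements of
  \<open>S\<close> may sit anywhere.\<close>

locale label_process = prob_space M for M :: "'a measure" +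
  fixes L :: "'a \<Rightarrow> nat \<Rightarrow> nat" and p :: "nat list \<Rightarrow> real" and Q :: "nat \<Rightarrow> 'a \<Rightarrow> real"
  assumes L_measurable [measurable]: "\<And>m. (\<lambda>\<omega>. L \<omega> m) \<in> measurable M (count_space UNIV)"
    and L_growth: "\<And>\<omega> n. \<omega> \<in> space M \<Longrightarrow> restricted_growth n (L \<omega>)"
    and prob_labels: "\<And>n S w k. 1 \<le> n \<Longrightarrow> finite S \<Longrightarrow> {1..n} \<subseteq> S \<Longrightarrow> S \<subseteq> {1..} \<Longrightarrow>
      restricted_growth n w \<Longrightarrow> w ` {1..n} = {1..k} \<Longrightarrow> w ` S \<subseteq> {1..k} \<Longrightarrow>
      prob {\<omega>\<in>space M. \<forall>m\<in>S. L \<omega> m = w m} = p (map (\<lambda>i. card {m \<in> S. w m = i}) [1..<Suc k])"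
    and Q_measurable [measurable]: "\<And>i. Q i \<in> borel_measurable M"
    and Q_lim: "\<And>i. 1 \<le> i \<Longrightarrow> AE \<omega> in M. (\<lambda>n. real (card {m\<in>{1..n}. L \<omega> m = i}) / real n) \<longlonglongrightarrow> Q i \<omega>"
begin

definition labelled :: "nat set \<Rightarrow> (nat \<Rightarrow> nat) \<Rightarrow> 'a set" where
  "labelled S w = {\<omega>\<in>space M. \<forall>m\<in>S. L \<omega> m = w m}"

lemma labelled_event [measurable]: "finite S \<Longrightarrow> labelled S w \<in> events"
  unfolding labelled_def by (rule sets.sets_Collect_finite_All) measurable

lemma Q_lim_all: "AE \<omega> in M. \<forall>i\<in>{1..}. (\<lambda>n. real (card {m\<in>{1..n}. L \<omega> m = i}) / real n) \<longlonglongrightarrow> Q i \<omega>"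
  using Q_lim by (subst AE_ball_countable) auto

lemma Q_sum_lim:
  "AE \<omega> in M. \<forall>k. (\<lambda>n. real (card {m\<in>{1..n}. L \<omega> m \<in> {1..k}}) / real n) \<longlonglongrightarrow> (\<Sum>i\<in>{1..k}. Q i \<omega>)"
  using Q_lim_all
proof (rule eventually_mono, intro allI)
  fix \<omega> k
  assume lim: "\<forall>i\<in>{1..}. (\<lambda>n. real (card {m\<in>{1..n}. L \<omega> m = i}) / real n) \<longlonglongrightarrow> Q i \<omega>"
  have "real (card {m\<in>{1..n}. L \<omega> m \<in> {1..k}}) / real n = (\<Sum>i\<in>{1..k}. real (card {m\<in>{1..n}. L \<omega> m = i}) / real n)" for n
  proof -
    have "{m\<in>{1..n}. L \<omega> m \<in> {1..k}} = (\<Union>i\<in>{1..k}. {m\<in>{1..n}. L \<omega> m = i})" by auto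
    also have "card \<dots> = (\<Sum>i\<in>{1..k}. card {m\<in>{1..n}. L \<omega> m = i})"
      by (rule card_UN_disjoint) auto
    finally show ?thesis by (simp add: sum_divide_distrib)
  qed
  then show "(\<lambda>n. real (card {m\<in>{1..n}. L \<omega> m \<in> {1..k}}) / real n) \<longlonglongrightarrow> (\<Sum>i\<in>{1..k}. Q i \<omega>)"
    using lim by (auto intro!: tendsto_sum)
qed

lemma Q_nonneg: "AE \<omega> in M. \<forall>i\<in>{1..}. 0 \<le> Q i \<omega>"
  using Q_lim_all
proof (rule eventually_mono, intro ballI)
  fix \<omega> and i :: nat
  assume lim: "\<forall>i\<in>{1..}. (\<lambda>n. real (card {m\<in>{1..n}. L \<omega> m = i}) / real n) \<longlonglongrightarrow> Q i \<omega>" and i: "i \<in> {1..}"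
  show "0 \<le> Q i \<omega>" by (rule LIMSEQ_le_const[OF lim[rule_format, OF i]]) auto
qed

lemma Q_sum_le_1: "AE \<omega> in M. \<forall>k. (\<Sum>i\<in>{1..k}. Q i \<omega>) \<le> 1"
  using Q_sum_lim
proof (rule eventually_mono, intro allI)
  fix \<omega> k
  assume lim: "\<forall>k. (\<lambda>n. real (card {m\<in>{1..n}. L \<omega> m \<in> {1..k}}) / real n) \<longlonglongrightarrow> (\<Sum>i\<in>{1..k}. Q i \<omega>)"
  have "card {m\<in>{1..n}. L \<omega> m \<in> {1..k}} \<le> n" for n
  proof -
    have "card {m\<in>{1..n}. L \<omega> m \<in> {1..k}} \<le> card {1..n}" by (rule card_mono) auto
    then show ?thesis by simp
  qed
  then show "(\<Sum>i\<in>{1..k}. Q i \<omega>) \<le> 1"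
    by (intro LIMSEQ_le_const2[OF lim[rule_format, of k]]) (auto intro!: exI[of _ 1])
qed

lemma Q_le_1: "AE \<omega> in M. \<forall>i\<in>{1..}. Q i \<omega> \<le> 1"
  using Q_nonneg Q_sum_le_1
proof eventually_elim
  fix \<omega> assume 0: "\<forall>i\<in>{1..}. 0 \<le> Q i \<omega>" and 1: "\<forall>k. (\<Sum>i\<in>{1..k}. Q i \<omega>) \<le> 1"
  show "\<forall>i\<in>{1..}. Q i \<omega> \<le> 1"
  proof
    fix i :: nat assume i: "i \<in> {1..}"
    have "Q i \<omega> \<le> (\<Sum>i\<in>{1..i}. Q i \<omega>)" by (rule member_le_sum) (use i 0 in auto)
    also have "\<dots> \<le> 1" using 1 by simp
    finally show "Q i \<omega> \<le> 1" .
  qed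
qed

lemma Q_monomial_bounds:
  assumes "set v \<subseteq> {1..}"
  shows "AE \<omega> in M. 0 \<le> (\<Prod>i\<leftarrow>v. Q i \<omega>) \<and> (\<Prod>i\<leftarrow>v. Q i \<omega>) \<le> 1"
  using Q_nonneg Q_le_1
proof eventually_elim
  fix \<omega> assume 0: "\<forall>i\<in>{1..}. 0 \<le> Q i \<omega>" and 1: "\<forall>i\<in>{1..}. Q i \<omega> \<le> 1"
  show "0 \<le> (\<Prod>i\<leftarrow>v. Q i \<omega>) \<and> (\<Prod>i\<leftarrow>v. Q i \<omega>) \<le> 1"
    using assms
  proof (induction v)
    case (Cons i v)
    then show ?case using 0 1 by (auto intro!: mult_nonneg_nonneg mult_le_one)
  qed simp
qed

lemma Q_monomial_measurable [measurable]: "(\<lambda>\<omega>. \<Prod>i\<leftarrow>v. Q i \<omega>) \<in> borel_measurable M"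
  by (induction v) auto

text \<open>The first \<open>a\<close> elements contribute at most \<open>a / N\<close> to the
  average. A window that avoids them is needed to average over positions on which no condition has
  been imposed.\<close>

lemma window_frequency_lim:
  assumes "1 \<le> i"
  shows "AE \<omega> in M. (\<lambda>N. (\<Sum>m\<in>{a+1..a+N}. of_bool (L \<omega> m = i)) / real N) \<longlonglongrightarrow> Q i \<omega>"
  using Q_lim[OF assms]
proof (rule eventually_mono)
  fix \<omega>
  assume lim: "(\<lambda>n. real (card {m\<in>{1..n}. L \<omega> m = i}) / real n) \<longlonglongrightarrow> Q i \<omega>"
  define C where "C n = real (card {m\<in>{1..n}. L \<omega> m = i})" for n
  have C: "C n = (\<Sum>m\<in>{1..n}. of_bool (L \<omega> m = i))" for n
    by (simp add: C_def Int_def of_bool_def sum.If_cases conj_commute)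
  have win: "(\<Sum>m\<in>{a+1..a+N}. of_bool (L \<omega> m = i)) = C (N + a) - C a" for N
  proof -
    have "{1..N + a} = {1..a} \<union> {a+1..a+N}" by auto
    then have "C (N + a) = (\<Sum>m\<in>{1..a} \<union> {a+1..a+N}. of_bool (L \<omega> m = i))" by (simp only: C)
    also have "\<dots> = C a + (\<Sum>m\<in>{a+1..a+N}. of_bool (L \<omega> m = i))"
      unfolding C by (rule sum.union_disjoint) auto
    finally show ?thesis by simp
  qed
  have 1: "(\<lambda>N. C (N + a) / real (N + a)) \<longlonglongrightarrow> Q i \<omega>"
    using lim unfolding C_def by (rule LIMSEQ_ignore_initial_segment)
  have 2: "(\<lambda>N. 1 + real a / real N) \<longlonglongrightarrow> 1 + 0"
    by (intro tendsto_intros lim_const_over_n)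
  have 3: "(\<lambda>N. C a / real N) \<longlonglongrightarrow> 0" by (rule lim_const_over_n)
  have "(\<lambda>N. C (N + a) / real (N + a) * (1 + real a / real N) - C a / real N) \<longlonglongrightarrow> Q i \<omega> * (1 + 0) - 0"
    by (intro tendsto_intros 1 2 3)
  then have lim': "(\<lambda>N. C (N + a) / real (N + a) * (1 + real a / real N) - C a / real N) \<longlonglongrightarrow> Q i \<omega>" by simp
  show "(\<lambda>N. (\<Sum>m\<in>{a+1..a+N}. of_bool (L \<omega> m = i)) / real N) \<longlonglongrightarrow> Q i \<omega>"
  proof (rule Lim_transform_eventually[OF lim'])
    show "\<forall>\<^sub>F N in sequentially. C (N + a) / real (N + a) * (1 + real a / real N) - C a / real N = (\<Sum>m\<in>{a+1..a+N}. of_bool (L \<omega> m = i)) / real N"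
      using eventually_gt_at_top[of 0]
    proof eventually_elim
      case (elim N)
      have "C (N + a) / real (N + a) * (1 + real a / real N) = C (N + a) / real N"
      proof -
        have "1 + real a / real N = real (N + a) / real N" using elim by (simp add: field_simps)
        then show ?thesis using elim by simp
      qed
      then show ?case unfolding win by (simp add: diff_divide_distrib)
    qed
  qed
qed

text \<open>Induction on the monomial. One factor \<open>Q i\<close> is the limit of averages of the
  indicators of \<open>L m = i\<close> over positions \<open>m\<close> beyond \<open>S\<close>.
  Fixing one more such label adds \<open>m\<close> to \<open>S\<close> and 1 to the count of
  \<open>i\<close>; the result is the same for every \<open>m\<close>, and dominated convergence
  passes to the limit.\<close>

lemma expectation_label_monomial:
  assumes n: "1 \<le> n" and w: "restricted_growth n w" "w ` {1..n} = {1..k}"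
    and S: "finite S" "{1..n} \<subseteq> S" "S \<subseteq> {1..}" "w ` S \<subseteq> {1..k}" and v: "set v \<subseteq> {1..k}"
  shows "expectation (\<lambda>\<omega>. indicator (labelled S w) \<omega> * (\<Prod>i\<leftarrow>v. Q i \<omega>))
    = p (map (\<lambda>i. card {m \<in> S. w m = i} + count_list v i) [1..<Suc k])"
  using w S v
proof (induction v arbitrary: S w)
  case Nil
  have "expectation (indicator (labelled S w)) = prob (labelled S w)"
    using Nil by simp
  also have "\<dots> = p (map (\<lambda>i. card {m \<in> S. w m = i}) [1..<Suc k])"
    unfolding labelled_def by (rule prob_labels) (use n Nil in auto)
  finally show ?case by simp
next
  case (Cons i v)
  define a where "a = Max S"
  have Sa: "m \<le> a" if "m \<in> S" for m using Cons.prems that by (simp add: a_def)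
  have na: "n \<le> a" using Sa[of n] n Cons.prems by auto
  define g where "g \<omega> = (\<Prod>i\<leftarrow>v. Q i \<omega>)" for \<omega>
  have [measurable]: "g \<in> borel_measurable M" unfolding g_def by measurable
  have [measurable]: "labelled S w \<in> events" using Cons.prems by simp
  have v1: "set v \<subseteq> {1..}" using Cons.prems by auto
  have gb: "AE \<omega> in M. 0 \<le> g \<omega> \<and> g \<omega> \<le> 1" unfolding g_def by (rule Q_monomial_bounds[OF v1])
  have i: "i \<in> {1..k}" using Cons.prems by simp
  define F where "F N \<omega> = (\<Sum>m\<in>{a+1..a+N}. of_bool (L \<omega> m = i)) / real N" for N \<omega>
  have [measurable]: "F N \<in> borel_measurable M" for N unfolding F_def by measurable
  let ?c = "p (map (\<lambda>i'. card {m \<in> S. w m = i'} + count_list (i # v) i') [1..<Suc k])"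
  have summand: "expectation (\<lambda>\<omega>. indicator (labelled S w) \<omega> * g \<omega> * of_bool (L \<omega> m = i)) = ?c" if m: "a < m" for m
  proof -
    have mS: "m \<notin> S" using Sa[of m] m by auto
    have "indicator (labelled S w) \<omega> * g \<omega> * of_bool (L \<omega> m = i) = indicator (labelled (insert m S) (w(m := i))) \<omega> * g \<omega>" for \<omega>
      using mS by (auto simp: labelled_def indicator_def)
    then have "expectation (\<lambda>\<omega>. indicator (labelled S w) \<omega> * g \<omega> * of_bool (L \<omega> m = i))
      = expectation (\<lambda>\<omega>. indicator (labelled (insert m S) (w(m := i))) \<omega> * (\<Prod>i\<leftarrow>v. Q i \<omega>))"
      by (simp only: g_def)
    also have "\<dots> = p (map (\<lambda>i'. card {l \<in> insert m S. (w(m := i)) l = i'} + count_list v i') [1..<Suc k])"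
    proof (rule Cons.IH)
      have eq: "(w(m := i)) l = w l" if "l \<in> {1..n}" for l using that na m by auto
      show "restricted_growth n (w(m := i))"
        using Cons.prems(1) restricted_growth_cong[of n "w(m := i)" w] eq by blast
      have "(w(m := i)) ` {1..n} = w ` {1..n}" by (rule image_cong[OF refl eq])
      then show "(w(m := i)) ` {1..n} = {1..k}" using Cons.prems(2) by simp
      show "(w(m := i)) ` insert m S \<subseteq> {1..k}" using Cons.prems(6) i by auto
    qed (use Cons.prems m in auto)
    also have "\<dots> = ?c"
      by (subst card_fibre_insert[OF Cons.prems(3) mS]) (auto intro!: arg_cong[where f = p] simp del: upt_Suc)
    finally show ?thesis .
  qed
  have int: "integrable M (\<lambda>\<omega>. indicator (labelled S w) \<omega> * g \<omega> * of_bool (L \<omega> m = i))" for m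
  proof (rule integrable_const_bound[where B = 1])
    show "AE \<omega> in M. norm (indicator (labelled S w) \<omega> * g \<omega> * of_bool (L \<omega> m = i)) \<le> 1"
      using gb by eventually_elim (auto simp: indicator_def)
  qed measurable
  \<comment> \<open>All averages over nonempty windows have the same expectation, so the limit is
    that value.\<close>
  have const: "expectation (\<lambda>\<omega>. indicator (labelled S w) \<omega> * g \<omega> * F N \<omega>) = ?c" if "N > 0" for N
  proof -
    have "expectation (\<lambda>\<omega>. indicator (labelled S w) \<omega> * g \<omega> * F N \<omega>)
      = expectation (\<lambda>\<omega>. (\<Sum>m\<in>{a+1..a+N}. indicator (labelled S w) \<omega> * g \<omega> * of_bool (L \<omega> m = i)) / real N)"
      by (simp only: F_def sum_distrib_left times_divide_eq_right)
    also have "\<dots> = (\<Sum>m\<in>{a+1..a+N}. expectation (\<lambda>\<omega>. indicator (labelled S w) \<omega> * g \<omega> * of_bool (L \<omega> m = i))) / real N"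
      by (simp only: integral_divide_zero Bochner_Integration.integral_sum[OF int])
    also have "\<dots> = (\<Sum>m\<in>{a+1..a+N}. ?c) / real N"
      by (intro arg_cong2[where f = "(/)"] sum.cong refl summand) simp
    also have "\<dots> = ?c" using that by simp
    finally show ?thesis .
  qed
  have "(\<lambda>N. expectation (\<lambda>\<omega>. indicator (labelled S w) \<omega> * g \<omega> * F N \<omega>))
    \<longlonglongrightarrow> expectation (\<lambda>\<omega>. indicator (labelled S w) \<omega> * g \<omega> * Q i \<omega>)"
  proof (rule integral_dominated_convergence[where w = "\<lambda>_. 1"])
    have "AE \<omega> in M. (\<lambda>N. F N \<omega>) \<longlonglongrightarrow> Q i \<omega>"
      unfolding F_def by (rule window_frequency_lim) (use i in auto)
    then show "AE \<omega> in M. (\<lambda>N. indicator (labelled S w) \<omega> * g \<omega> * F N \<omega>) \<longlonglongrightarrow> indicator (labelled S w) \<omega> * g \<omega> * Q i \<omega>"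
      by (rule eventually_mono) (intro tendsto_intros)
    fix N
    have F: "0 \<le> F N \<omega> \<and> F N \<omega> \<le> 1" for \<omega>
    proof -
      have "(\<Sum>m\<in>{a+1..a+N}. of_bool (L \<omega> m = i)) \<le> (\<Sum>m\<in>{a+1..a+N}. 1 :: real)"
        by (rule sum_mono) auto
      then show ?thesis by (cases "N = 0") (auto simp: F_def intro!: divide_nonneg_nonneg sum_nonneg)
    qed
    show "AE \<omega> in M. norm (indicator (labelled S w) \<omega> * g \<omega> * F N \<omega>) \<le> 1"
      using gb
    proof eventually_elim
      fix \<omega> assume "0 \<le> g \<omega> \<and> g \<omega> \<le> 1"
      then show "norm (indicator (labelled S w) \<omega> * g \<omega> * F N \<omega>) \<le> 1"
        using F[of \<omega>] by (auto simp: indicator_def abs_mult intro!: mult_le_one)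
    qed
  qed auto
  moreover have "(\<lambda>N. expectation (\<lambda>\<omega>. indicator (labelled S w) \<omega> * g \<omega> * F N \<omega>)) \<longlonglongrightarrow> ?c"
    by (rule Lim_transform_eventually[OF tendsto_const])
      (use eventually_gt_at_top[of 0] in eventually_elim, rule const[symmetric])
  ultimately have "expectation (\<lambda>\<omega>. indicator (labelled S w) \<omega> * g \<omega> * Q i \<omega>) = ?c"
    by (rule LIMSEQ_unique)
  then show ?case by (simp only: g_def list.map prod_list.Cons mult_ac)
qed

text \<open>Extended nonnegative values allow the sums over waiting times to be exchanged with
  integrals before anything is known to be finite.\<close>

definition q :: "nat \<Rightarrow> 'a \<Rightarrow> ennreal" where "q i \<omega> = ennreal (Q i \<omega>)"

lemma q_measurable [measurable]: "q i \<in> borel_measurable M"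
  unfolding q_def by measurable

lemma q_monomial_measurable [measurable]: "(\<lambda>\<omega>. \<Prod>i\<leftarrow>v. q i \<omega>) \<in> borel_measurable M"
  by (induction v) auto

lemma q_monomial_eq:
  assumes "set v \<subseteq> {1..}"
  shows "AE \<omega> in M. (\<Prod>i\<leftarrow>v. q i \<omega>) = ennreal (\<Prod>i\<leftarrow>v. Q i \<omega>)"
  using Q_nonneg
proof (rule eventually_mono)
  fix \<omega> assume 0: "\<forall>i\<in>{1..}. 0 \<le> Q i \<omega>"
  show "(\<Prod>i\<leftarrow>v. q i \<omega>) = ennreal (\<Prod>i\<leftarrow>v. Q i \<omega>)"
    using assms
  proof (induction v)
    case (Cons i v)
    then show ?case using 0 by (simp add: q_def ennreal_mult')
  qed simp
qed

lemma nn_integral_label_monomial: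
  assumes n: "1 \<le> n" and w: "restricted_growth n w" "w ` {1..n} = {1..k}" and v: "set v \<subseteq> {1..k}"
  shows "(\<integral>\<^sup>+\<omega>. indicator (labelled {1..n} w) \<omega> * (\<Prod>i\<leftarrow>v. q i \<omega>) \<partial>M)
    = ennreal (p (map (\<lambda>i. card {m \<in> {1..n}. w m = i} + count_list v i) [1..<Suc k]))"
proof -
  have v1: "set v \<subseteq> {1..}" using v by auto
  note b = Q_monomial_bounds[OF v1]
  have [measurable]: "labelled {1..n} w \<in> events" by simp
  have "(\<integral>\<^sup>+\<omega>. indicator (labelled {1..n} w) \<omega> * (\<Prod>i\<leftarrow>v. q i \<omega>) \<partial>M)
    = (\<integral>\<^sup>+\<omega>. ennreal (indicator (labelled {1..n} w) \<omega> * (\<Prod>i\<leftarrow>v. Q i \<omega>)) \<partial>M)"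
    by (rule nn_integral_cong_AE, rule eventually_mono[OF q_monomial_eq[OF v1]]) (auto simp: indicator_def)
  also have "\<dots> = ennreal (expectation (\<lambda>\<omega>. indicator (labelled {1..n} w) \<omega> * (\<Prod>i\<leftarrow>v. Q i \<omega>)))"
  proof (rule nn_integral_eq_integral)
    show "integrable M (\<lambda>\<omega>. indicator (labelled {1..n} w) \<omega> * (\<Prod>i\<leftarrow>v. Q i \<omega>))"
      by (rule integrable_const_bound[where B = 1], rule eventually_mono[OF b]) (auto simp: indicator_def)
    show "AE \<omega> in M. 0 \<le> indicator (labelled {1..n} w) \<omega> * (\<Prod>i\<leftarrow>v. Q i \<omega>)"
      by (rule eventually_mono[OF b]) auto
  qed
  also have "\<dots> = ennreal (p (map (\<lambda>i. card {m \<in> {1..n}. w m = i} + count_list v i) [1..<Suc k]))"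
    by (subst expectation_label_monomial[OF n w]) (use w v in auto)
  finally show ?thesis .
qed

section \<open>Waiting times for new labels\<close>

lemma restricted_growth_id: "restricted_growth n (\<lambda>i. i)"
  by (auto simp: restricted_growth_def)

text \<open>By restricted growth, the event that \<open>1, ..., k\<close> lie in pairwise different
  blocks.\<close>

definition distinct_event :: "nat \<Rightarrow> 'a set" where
  "distinct_event k = labelled {1..k} (\<lambda>i. i)"

lemma distinct_event_measurable [measurable]: "distinct_event k \<in> events"
  by (simp add: distinct_event_def)

text \<open>By exchangeability the labels of the first \<open>n\<close> elements may be rearranged so that the \<open>k\<close>
  labels appear first; the remaining \<open>n - k\<close> elements then only contribute factors \<open>q i\<close>.\<close>

lemma nn_integral_label_rearrange:
  assumes n: "1 \<le> n" and w: "restricted_growth n w" "w ` {1..n} = {1..k}" and u: "set u \<subseteq> {1..k}"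
  shows "(\<integral>\<^sup>+\<omega>. indicator (labelled {1..n} w) \<omega> * (\<Prod>i\<leftarrow>u. q i \<omega>) \<partial>M)
    = (\<integral>\<^sup>+\<omega>. indicator (distinct_event k) \<omega> * (\<Prod>i\<leftarrow>u. q i \<omega>) *
        (\<Prod>i\<in>{1..k}. q i \<omega> ^ (card {m \<in> {1..n}. w m = i} - 1)) \<partial>M)"
proof -
  let ?c = "\<lambda>i. card {m \<in> {1..n}. w m = i}"
  obtain v where v: "set v \<subseteq> {1..k}" "\<forall>i\<in>{1..k}. count_list v i = ?c i - 1"
    "\<And>f :: nat \<Rightarrow> ennreal. (\<Prod>i\<leftarrow>v. f i) = (\<Prod>i\<in>{1..k}. f i ^ (?c i - 1))"
    using exists_list_with_counts[of k "\<lambda>i. ?c i - 1", where 'b = ennreal] by blast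
  have k: "1 \<le> k"
  proof -
    have "w 1 \<in> {1..k}" using w(2) n by force
    then show ?thesis by simp
  qed
  have c: "1 \<le> ?c i" if "i \<in> {1..k}" for i
  proof -
    have "i \<in> w ` {1..n}" using that w(2) by simp
    then have "{m \<in> {1..n}. w m = i} \<noteq> {}" by blast
    then show ?thesis by (simp add: Suc_le_eq card_gt_0_iff)
  qed
  have one: "card {m \<in> {1..k}. m = i} = 1" if "i \<in> {1..k}" for i
  proof -
    have "{m \<in> {1..k}. m = i} = {i}" using that by auto
    then show ?thesis by simp
  qed
  have "(\<integral>\<^sup>+\<omega>. indicator (distinct_event k) \<omega> * (\<Prod>i\<leftarrow>u. q i \<omega>) *
        (\<Prod>i\<in>{1..k}. q i \<omega> ^ (?c i - 1)) \<partial>M)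
    = (\<integral>\<^sup>+\<omega>. indicator (labelled {1..k} (\<lambda>i. i)) \<omega> * (\<Prod>i\<leftarrow>u @ v. q i \<omega>) \<partial>M)"
    by (simp add: v(3) distinct_event_def mult.assoc)
  also have "\<dots> = ennreal (p (map (\<lambda>i. card {m \<in> {1..k}. m = i} + count_list (u @ v) i) [1..<Suc k]))"
    by (rule nn_integral_label_monomial[OF k restricted_growth_id]) (use u v in auto)
  also have "map (\<lambda>i. card {m \<in> {1..k}. m = i} + count_list (u @ v) i) [1..<Suc k] = map (\<lambda>i. ?c i + count_list u i) [1..<Suc k]"
  proof (rule map_cong[OF refl])
    fix i assume "i \<in> set [1..<Suc k]"
    then have "i \<in> {1..k}" by auto
    then show "card {m \<in> {1..k}. m = i} + count_list (u @ v) i = ?c i + count_list u i"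
      using one[of i] c[of i] v(2) by simp
  qed
  also have "ennreal (p \<dots>) = (\<integral>\<^sup>+\<omega>. indicator (labelled {1..n} w) \<omega> * (\<Prod>i\<leftarrow>u. q i \<omega>) \<partial>M)"
    by (rule nn_integral_label_monomial[OF n w u, symmetric])
  finally show ?thesis by simp
qed

text \<open>For \<open>k \<ge> 1\<close> this is the event that there are at least \<open>k\<close>
  blocks, since all smaller labels then occur as well.\<close>

definition label_occurs :: "nat \<Rightarrow> 'a set" where
  "label_occurs k = {\<omega>\<in>space M. \<exists>m\<in>{1..}. L \<omega> m = k}"

definition first_occurrence :: "nat \<Rightarrow> nat \<Rightarrow> 'a set" where
  "first_occurrence k t = {\<omega>\<in>space M. L \<omega> t = k \<and> (\<forall>l\<in>{1..<t}. L \<omega> l \<noteq> k)}"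

lemma label_occurs_measurable [measurable]: "label_occurs k \<in> events"
  unfolding label_occurs_def by measurable

lemma first_occurrence_measurable [measurable]: "first_occurrence k t \<in> events"
  unfolding first_occurrence_def by measurable

text \<open>The factor with index \<open>i\<close> accounts for the waiting time for label
  \<open>i + 1\<close>: the term of order \<open>m\<close> belongs to \<open>m\<close> intermediate
  elements, each of which has one of the labels \<open>1..i\<close>.\<close>

definition stick_series :: "nat \<Rightarrow> nat \<Rightarrow> 'a \<Rightarrow> ennreal" where
  "stick_series j k \<omega> = (\<Prod>i\<in>{j..<k}. \<Sum>m. (\<Sum>l\<in>{1..i}. q l \<omega>) ^ m)"

lemma stick_series_measurable [measurable]: "stick_series j k \<in> borel_measurable M"
  unfolding stick_series_def by measurable

lemma label_occurs_mono:
  assumes "\<omega> \<in> label_occurs k" "1 \<le> j" "j \<le> k"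
  shows "\<exists>m\<in>{1..}. L \<omega> m = j"
proof (cases "j = k")
  case True
  then show ?thesis using assms by (auto simp: label_occurs_def)
next
  case False
  obtain m where m: "\<omega> \<in> space M" "1 \<le> m" "L \<omega> m = k" using assms by (auto simp: label_occurs_def)
  have "\<exists>l\<in>{1..<m}. L \<omega> l = j"
    using L_growth[OF m(1), of m] m(2,3) assms(2,3) False unfolding restricted_growth_def by auto
  then show ?thesis by auto
qed

lemma labelled_first_occurrence_Suc:
  assumes "w ` {1..n} = {1..j}"
  shows "labelled {1..n} w \<inter> first_occurrence (Suc j) (Suc n) = labelled {1..Suc n} (w(Suc n := Suc j))"
proof -
  have "w l \<noteq> Suc j" if "l \<in> {1..n}" for l
  proof -
    have "w l \<in> {1..j}" using assms that by blast
    then show ?thesis by auto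
  qed
  then show ?thesis
    by (auto simp: labelled_def first_occurrence_def atLeastAtMostSuc_conv atLeastLessThanSuc_atLeastAtMost)
qed

text \<open>While label \<open>Suc j\<close> is still awaited, the next element has a label in
  \<open>{1..j}\<close>, because a larger label cannot precede \<open>Suc j\<close>.\<close>

lemma indicator_labelled_first_occurrence_step:
  assumes w: "restricted_growth n w" "w ` {1..n} = {1..j}"
  shows "indicator (labelled {1..n} w) \<omega> * indicator (first_occurrence (Suc j) (n + Suc (Suc m))) \<omega>
    = (\<Sum>i\<in>{1..j}. indicator (labelled {1..Suc n} (w(Suc n := i))) \<omega> *
         indicator (first_occurrence (Suc j) (Suc n + Suc m)) \<omega> :: ennreal)"
proof -
  have lab: "\<omega> \<in> labelled {1..Suc n} (w(Suc n := i)) \<longleftrightarrow> \<omega> \<in> labelled {1..n} w \<and> L \<omega> (Suc n) = i" for i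
    by (auto simp: labelled_def atLeastAtMostSuc_conv)
  note lab = lab[unfolded One_nat_def]
  show ?thesis
  proof (cases "\<omega> \<in> labelled {1..n} w \<and> \<omega> \<in> first_occurrence (Suc j) (Suc n + Suc m)")
    case True
    then have \<omega>: "\<omega> \<in> space M" and eq: "\<And>l. l \<in> {1..n} \<Longrightarrow> L \<omega> l = w l"
      by (auto simp: labelled_def)
    have nf: "L \<omega> l \<noteq> Suc j" if "l \<in> {1..Suc n}" for l
      using True that by (auto simp: first_occurrence_def)
    have "L \<omega> (Suc n) \<in> {1..j}"
    proof -
      have g: "1 \<le> L \<omega> (Suc n)" "\<And>i. 1 \<le> i \<Longrightarrow> i < L \<omega> (Suc n) \<Longrightarrow> \<exists>l\<in>{1..<Suc n}. L \<omega> l = i"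
        using L_growth[OF \<omega>, of "Suc n"] unfolding restricted_growth_def by auto
      have "\<not> Suc j < L \<omega> (Suc n)"
      proof
        assume "Suc j < L \<omega> (Suc n)"
        then obtain l where "l \<in> {1..<Suc n}" "L \<omega> l = Suc j" using g(2)[of "Suc j"] by auto
        then show False using nf[of l] by simp
      qed
      with g(1) nf[of "Suc n"] show ?thesis by simp
    qed
    then have "(\<Sum>i\<in>{1..j}. indicator (labelled {1..Suc n} (w(Suc n := i))) \<omega> *
         indicator (first_occurrence (Suc j) (Suc n + Suc m)) \<omega> :: ennreal) = 1"
    proof -
      have "(\<Sum>i\<in>{1..j}. indicator (labelled {1..Suc n} (w(Suc n := i))) \<omega> *
         indicator (first_occurrence (Suc j) (Suc n + Suc m)) \<omega> :: ennreal)
        = (\<Sum>i\<in>{1..j}. if L \<omega> (Suc n) = i then 1 else 0)"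
        by (rule sum.cong[OF refl]) (use True in \<open>simp add: indicator_def lab\<close>)
      then show ?thesis using \<open>L \<omega> (Suc n) \<in> {1..j}\<close> by simp
    qed
    moreover have "indicator (labelled {1..n} w) \<omega> * indicator (first_occurrence (Suc j) (n + Suc (Suc m))) \<omega> = (1 :: ennreal)"
      using True by simp
    ultimately show ?thesis by (simp only:)
  next
    case False
    have "(\<Sum>i\<in>{1..j}. indicator (labelled {1..Suc n} (w(Suc n := i))) \<omega> *
         indicator (first_occurrence (Suc j) (Suc n + Suc m)) \<omega> :: ennreal) = 0"
      using False by (intro sum.neutral) (auto simp: lab indicator_def)
    moreover have "indicator (labelled {1..n} w) \<omega> * indicator (first_occurrence (Suc j) (n + Suc (Suc m))) \<omega> = (0 :: ennreal)"
      using False by (auto simp: indicator_def)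
    ultimately show ?thesis by (simp only:)
  qed
qed

text \<open>Decomposition by the first time of label \<open>Suc j\<close>. It exists because labels
  below \<open>k\<close> occur whenever \<open>k\<close> does, and it lies beyond \<open>n\<close>
  because \<open>w\<close> takes only the values \<open>{1..j}\<close> on
  \<open>{1..n}\<close>.\<close>

lemma suminf_first_occurrence:
  assumes w: "w ` {1..n} = {1..j}" and j: "Suc j \<le> k"
  shows "indicator (labelled {1..n} w) \<omega> * indicator (label_occurs k) \<omega>
    = (\<Sum>m. indicator (labelled {1..n} w) \<omega> * indicator (first_occurrence (Suc j) (n + Suc m)) \<omega> * indicator (label_occurs k) \<omega> :: ennreal)"
proof (cases "\<omega> \<in> labelled {1..n} w \<and> \<omega> \<in> label_occurs k")
  case True
  then have \<omega>: "\<omega> \<in> space M" and eq: "\<And>l. l \<in> {1..n} \<Longrightarrow> L \<omega> l = w l"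
    by (auto simp: labelled_def)
  have ex: "\<exists>t. 1 \<le> t \<and> L \<omega> t = Suc j"
    using label_occurs_mono[of \<omega> k "Suc j"] True j by auto
  define t where "t = (LEAST t. 1 \<le> t \<and> L \<omega> t = Suc j)"
  have t: "1 \<le> t" "L \<omega> t = Suc j" using LeastI_ex[OF ex] by (auto simp: t_def)
  have least: "t \<le> l" if "1 \<le> l" "L \<omega> l = Suc j" for l
    unfolding t_def by (rule Least_le) (use that in simp)
  have "n < t"
  proof (rule ccontr)
    assume "\<not> n < t"
    then have tn: "t \<in> {1..n}" using t by simp
    then have "Suc j \<in> w ` {1..n}" using eq t by force
    then show False using w by simp
  qed
  then obtain m where m: "t = n + Suc m" using less_iff_Suc_add by auto
  have fo: "\<omega> \<in> first_occurrence (Suc j) (n + Suc m') \<longleftrightarrow> m' = m" for m'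
  proof
    assume *: "\<omega> \<in> first_occurrence (Suc j) (n + Suc m')"
    then have "t \<le> n + Suc m'" by (intro least) (auto simp: first_occurrence_def)
    moreover have "\<not> t < n + Suc m'" using * t by (auto simp: first_occurrence_def)
    ultimately show "m' = m" using m by simp
  next
    assume "m' = m"
    then show "\<omega> \<in> first_occurrence (Suc j) (n + Suc m')"
      using \<omega> t least m by (auto simp: first_occurrence_def) (metis Suc_le_eq not_le One_nat_def)
  qed
  have "(\<lambda>m'. if m' = m then 1 else 0 :: ennreal) sums 1"
    using sums_single[of m "\<lambda>_. 1 :: ennreal"] by simp
  then have "(\<Sum>m'. if m' = m then 1 else 0 :: ennreal) = 1" by (rule sums_unique[symmetric])
  then show ?thesis using True by (simp add: indicator_def fo[simplified] of_bool_def)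
next
  case False
  then show ?thesis by (auto simp: indicator_def)
qed

text \<open>Induction on the number of labels still to appear. If label \<open>Suc j\<close> is
  awaited for \<open>m\<close> steps, each step contributes a factor \<open>q i\<close> with
  \<open>i \<le> j\<close>, and all choices together give the power \<open>m\<close> of their sum.
  Summing over \<open>m\<close> produces the factor of \<open>stick_series\<close> with index
  \<open>j\<close>. Once all \<open>k\<close> labels are present,
  \<open>nn_integral_label_rearrange\<close> applies.\<close>

lemma nn_integral_labelled_occurs:
  assumes "1 \<le> n" "restricted_growth n w" "w ` {1..n} = {1..j}" "1 \<le> j" "j \<le> k" and u: "set u \<subseteq> {1..k}"
  shows "(\<integral>\<^sup>+\<omega>. indicator (labelled {1..n} w) \<omega> * indicator (label_occurs k) \<omega> * (\<Prod>i\<leftarrow>u. q i \<omega>) \<partial>M)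
    = (\<integral>\<^sup>+\<omega>. indicator (distinct_event k) \<omega> * (\<Prod>i\<leftarrow>u. q i \<omega>) *
        (\<Prod>i\<in>{1..j}. q i \<omega> ^ (card {m \<in> {1..n}. w m = i} - 1)) * stick_series j k \<omega> \<partial>M)"
  using assms(1-5)
proof (induction "k - j" arbitrary: j n w)
  case 0
  then have jk: "j = k" by simp
  have "indicator (labelled {1..n} w) \<omega> * indicator (label_occurs k) \<omega> = (indicator (labelled {1..n} w) \<omega> :: ennreal)" for \<omega>
  proof -
    have "k \<in> w ` {1..n}" using 0 jk by simp
    then obtain l where "l \<in> {1..n}" "w l = k" by blast
    then have "\<omega> \<in> labelled {1..n} w \<Longrightarrow> \<omega> \<in> label_occurs k"
      by (auto simp: labelled_def label_occurs_def intro!: bexI[of _ l])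
    then show ?thesis by (auto simp: indicator_def)
  qed
  then show ?case
    using nn_integral_label_rearrange[of n w k u] 0 jk u by (simp add: stick_series_def)
next
  case (Suc d)
  then have jk: "Suc j \<le> k" and d: "d = k - Suc j" by auto
  let ?c = "\<lambda>(n::nat) w i. card {m \<in> {1..n}. w m = (i::nat)}"
  define X where "X n w \<omega> = indicator (distinct_event k) \<omega> * (\<Prod>i\<leftarrow>u. q i \<omega>) * (\<Prod>i\<in>{1..j}. q i \<omega> ^ (?c n w i - 1))" for n w \<omega>
  have [measurable]: "X n w \<in> borel_measurable M" for n w unfolding X_def by measurable
  define s where "s \<omega> = (\<Sum>l\<in>{1..j}. q l \<omega>)" for \<omega>
  have [measurable]: "s \<in> borel_measurable M" unfolding s_def by measurable
  have lab [measurable]: "labelled {1..n} w \<in> events" for n w by simp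
  have cpos: "1 \<le> ?c n w i" if "w ` {1..n} = {1..j}" "i \<in> {1..j}" for i n w
  proof -
    have "i \<in> w ` {1..n}" using that by simp
    then have "{m \<in> {1..n}. w m = i} \<noteq> {}" by blast
    then show ?thesis by (simp add: Suc_le_eq card_gt_0_iff)
  qed
  have csuc: "?c (Suc n) (w(Suc n := i)) i' = ?c n w i' + of_bool (i' = i)" for n w i i'
    using card_fibre_insert[of "{1..n}" "Suc n" w i i'] by (simp add: atLeastAtMostSuc_conv)
  \<comment> \<open>Induction on the waiting time. For \<open>m = 0\<close> element
    \<open>Suc n\<close> carries the new label and the outer hypothesis takes over; otherwise the
    label of \<open>Suc n\<close> is split over \<open>{1..j}\<close>.\<close>
  have inner: "(\<integral>\<^sup>+\<omega>. indicator (labelled {1..n} w) \<omega> * indicator (first_occurrence (Suc j) (n + Suc m)) \<omega> *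
        indicator (label_occurs k) \<omega> * (\<Prod>i\<leftarrow>u. q i \<omega>) \<partial>M)
      = (\<integral>\<^sup>+\<omega>. X n w \<omega> * s \<omega> ^ m * stick_series (Suc j) k \<omega> \<partial>M)"
    if "1 \<le> n" "restricted_growth n w" "w ` {1..n} = {1..j}" for m n w
    using that
  proof (induction m arbitrary: n w)
    case 0
    note prems = 0
    let ?w = "w(Suc n := Suc j)"
    have "indicator (labelled {1..n} w) \<omega> * indicator (first_occurrence (Suc j) (n + Suc 0)) \<omega>
      = (indicator (labelled {1..Suc n} ?w) \<omega> :: ennreal)" for \<omega>
      unfolding labelled_first_occurrence_Suc[OF prems(3), symmetric] by (simp add: indicator_inter_arith)
    then have "(\<integral>\<^sup>+\<omega>. indicator (labelled {1..n} w) \<omega> * indicator (first_occurrence (Suc j) (n + Suc 0)) \<omega> *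
        indicator (label_occurs k) \<omega> * (\<Prod>i\<leftarrow>u. q i \<omega>) \<partial>M)
      = (\<integral>\<^sup>+\<omega>. indicator (labelled {1..Suc n} ?w) \<omega> * indicator (label_occurs k) \<omega> * (\<Prod>i\<leftarrow>u. q i \<omega>) \<partial>M)"
      by (simp only:)
    also have "\<dots> = (\<integral>\<^sup>+\<omega>. indicator (distinct_event k) \<omega> * (\<Prod>i\<leftarrow>u. q i \<omega>) *
        (\<Prod>i\<in>{1..Suc j}. q i \<omega> ^ (?c (Suc n) ?w i - 1)) * stick_series (Suc j) k \<omega> \<partial>M)"
    proof (rule Suc.hyps(1)[OF d])
      show "restricted_growth (Suc n) ?w" by (rule restricted_growth_upd[OF prems(2,3)]) auto
      show "?w ` {1..Suc n} = {1..Suc j}" using image_upd_Suc[OF prems(3), of "Suc j"] by (simp add: atLeastAtMostSuc_conv)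
    qed (use jk in auto)
    also have "\<dots> = (\<integral>\<^sup>+\<omega>. X n w \<omega> * s \<omega> ^ 0 * stick_series (Suc j) k \<omega> \<partial>M)"
    proof (rule nn_integral_cong)
      fix \<omega>
      have "{m \<in> {1..n}. w m = Suc j} = {}"
      proof -
        have "w m \<noteq> Suc j" if "m \<in> {1..n}" for m
          using imageI[OF that, of w] unfolding prems(3) by auto
        then show ?thesis by blast
      qed
      then have c0: "?c n w (Suc j) = 0" by simp
      have ivl: "{1..Suc j} = insert (Suc j) {1..j}" by auto
      \<comment> \<open>The new block has a single element, so its exponent is
        \<open>1 - 1\<close>.\<close>
      have last: "q (Suc j) \<omega> ^ (?c (Suc n) ?w (Suc j) - 1) = 1"
        unfolding csuc c0 by simp
      have "(\<Prod>i\<in>{1..Suc j}. q i \<omega> ^ (?c (Suc n) ?w i - 1))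
        = q (Suc j) \<omega> ^ (?c (Suc n) ?w (Suc j) - 1) * (\<Prod>i\<in>{1..j}. q i \<omega> ^ (?c (Suc n) ?w i - 1))"
        by (simp only: ivl, rule prod.insert) auto
      also have "\<dots> = (\<Prod>i\<in>{1..j}. q i \<omega> ^ (?c (Suc n) ?w i - 1))"
        by (simp only: last mult_1_left)
      also have "\<dots> = (\<Prod>i\<in>{1..j}. q i \<omega> ^ (?c n w i - 1))"
        by (rule prod.cong[OF refl]) (simp only: csuc, simp)
      finally show "indicator (distinct_event k) \<omega> * (\<Prod>i\<leftarrow>u. q i \<omega>) *
        (\<Prod>i\<in>{1..Suc j}. q i \<omega> ^ (?c (Suc n) ?w i - 1)) * stick_series (Suc j) k \<omega>
        = X n w \<omega> * s \<omega> ^ 0 * stick_series (Suc j) k \<omega>" by (simp only: X_def power_0 mult_1_right)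
    qed
    finally show ?case .
  next
    case (Suc m)
    note prems = Suc.prems
    have Xi: "X (Suc n) (w(Suc n := i)) \<omega> = X n w \<omega> * q i \<omega>" if i: "i \<in> {1..j}" for i \<omega>
    proof -
      have "(\<Prod>i'\<in>{1..j}. q i' \<omega> ^ (?c (Suc n) (w(Suc n := i)) i' - 1))
        = (\<Prod>i'\<in>{1..j}. q i' \<omega> ^ (?c n w i' - 1) * (if i' = i then q i \<omega> else 1))"
      proof (rule prod.cong[OF refl])
        fix i' assume "i' \<in> {1..j}"
        \<comment> \<open>Subtraction on naturals is truncated: raising the count raises the
          exponent \<open>?c - 1\<close> only because the count is already positive.\<close>
        then have "?c n w i' \<noteq> 0" using cpos[OF prems(3)] by (metis not_one_le_zero)
        then obtain r where "?c n w i' = Suc r" using not0_implies_Suc by blast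
        then show "q i' \<omega> ^ (?c (Suc n) (w(Suc n := i)) i' - 1) = q i' \<omega> ^ (?c n w i' - 1) * (if i' = i then q i \<omega> else 1)"
          unfolding csuc by (simp add: mult.commute)
      qed
      also have "\<dots> = (\<Prod>i'\<in>{1..j}. q i' \<omega> ^ (?c n w i' - 1)) * q i \<omega>"
        using i by (simp add: prod.distrib prod.delta)
      finally show ?thesis by (simp only: X_def mult_ac)
    qed
    have "(\<integral>\<^sup>+\<omega>. indicator (labelled {1..n} w) \<omega> * indicator (first_occurrence (Suc j) (n + Suc (Suc m))) \<omega> *
        indicator (label_occurs k) \<omega> * (\<Prod>i\<leftarrow>u. q i \<omega>) \<partial>M)
      = (\<integral>\<^sup>+\<omega>. (\<Sum>i\<in>{1..j}. indicator (labelled {1..Suc n} (w(Suc n := i))) \<omega> *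
         indicator (first_occurrence (Suc j) (Suc n + Suc m)) \<omega> * indicator (label_occurs k) \<omega> * (\<Prod>i\<leftarrow>u. q i \<omega>)) \<partial>M)"
      by (simp only: indicator_labelled_first_occurrence_step[OF prems(2,3)] sum_distrib_right)
    also have "\<dots> = (\<Sum>i\<in>{1..j}. \<integral>\<^sup>+\<omega>. indicator (labelled {1..Suc n} (w(Suc n := i))) \<omega> *
         indicator (first_occurrence (Suc j) (Suc n + Suc m)) \<omega> * indicator (label_occurs k) \<omega> * (\<Prod>i\<leftarrow>u. q i \<omega>) \<partial>M)"
      by (rule nn_integral_sum) measurable
    also have "\<dots> = (\<Sum>i\<in>{1..j}. \<integral>\<^sup>+\<omega>. X n w \<omega> * q i \<omega> * s \<omega> ^ m * stick_series (Suc j) k \<omega> \<partial>M)"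
    proof (rule sum.cong[OF refl])
      fix i assume i: "i \<in> {1..j}"
      show "(\<integral>\<^sup>+\<omega>. indicator (labelled {1..Suc n} (w(Suc n := i))) \<omega> *
         indicator (first_occurrence (Suc j) (Suc n + Suc m)) \<omega> * indicator (label_occurs k) \<omega> * (\<Prod>i\<leftarrow>u. q i \<omega>) \<partial>M)
        = (\<integral>\<^sup>+\<omega>. X n w \<omega> * q i \<omega> * s \<omega> ^ m * stick_series (Suc j) k \<omega> \<partial>M)"
        unfolding Xi[OF i, symmetric]
      proof (rule Suc.IH)
        show "restricted_growth (Suc n) (w(Suc n := i))" by (rule restricted_growth_upd[OF prems(2,3)]) (use i in auto)
        show "(w(Suc n := i)) ` {1..Suc n} = {1..j}" using image_upd_Suc[OF prems(3), of i] i by (simp add: insert_absorb)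
      qed simp
    qed
    also have "\<dots> = (\<integral>\<^sup>+\<omega>. (\<Sum>i\<in>{1..j}. X n w \<omega> * q i \<omega> * s \<omega> ^ m * stick_series (Suc j) k \<omega>) \<partial>M)"
      by (rule nn_integral_sum[symmetric]) measurable
    also have "\<dots> = (\<integral>\<^sup>+\<omega>. X n w \<omega> * s \<omega> ^ Suc m * stick_series (Suc j) k \<omega> \<partial>M)"
      by (simp only: s_def sum_distrib_right[symmetric] sum_distrib_left[symmetric] power_Suc mult.assoc)
    finally show ?case .
  qed
  have "(\<integral>\<^sup>+\<omega>. indicator (labelled {1..n} w) \<omega> * indicator (label_occurs k) \<omega> * (\<Prod>i\<leftarrow>u. q i \<omega>) \<partial>M)
    = (\<integral>\<^sup>+\<omega>. (\<Sum>m. indicator (labelled {1..n} w) \<omega> * indicator (first_occurrence (Suc j) (n + Suc m)) \<omega> *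
        indicator (label_occurs k) \<omega> * (\<Prod>i\<leftarrow>u. q i \<omega>)) \<partial>M)"
    by (simp only: suminf_first_occurrence[OF Suc.prems(3) jk] ennreal_suminf_multc)
  also have "\<dots> = (\<Sum>m. \<integral>\<^sup>+\<omega>. indicator (labelled {1..n} w) \<omega> * indicator (first_occurrence (Suc j) (n + Suc m)) \<omega> *
        indicator (label_occurs k) \<omega> * (\<Prod>i\<leftarrow>u. q i \<omega>) \<partial>M)"
    by (rule nn_integral_suminf) measurable
  also have "\<dots> = (\<Sum>m. \<integral>\<^sup>+\<omega>. X n w \<omega> * s \<omega> ^ m * stick_series (Suc j) k \<omega> \<partial>M)"
    by (simp only: inner[OF Suc.prems(1-3)])
  also have "\<dots> = (\<integral>\<^sup>+\<omega>. (\<Sum>m. X n w \<omega> * s \<omega> ^ m * stick_series (Suc j) k \<omega>) \<partial>M)"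
    by (rule nn_integral_suminf[symmetric]) measurable
  also have "\<dots> = (\<integral>\<^sup>+\<omega>. X n w \<omega> * ((\<Sum>m. s \<omega> ^ m) * stick_series (Suc j) k \<omega>) \<partial>M)"
    by (simp only: ennreal_suminf_multc ennreal_suminf_cmult mult.assoc)
  also have "\<dots> = (\<integral>\<^sup>+\<omega>. X n w \<omega> * stick_series j k \<omega> \<partial>M)"
  proof -
    have "{j..<k} = insert j {Suc j..<k}" using jk by auto
    then have "stick_series j k \<omega> = (\<Sum>m. s \<omega> ^ m) * stick_series (Suc j) k \<omega>" for \<omega>
      by (simp add: stick_series_def s_def)
    then show ?thesis by simp
  qed
  finally show ?case by (simp only: X_def)
qed

end

section \<open>Remaining masses and the moment formula for the EPPF\<close>

context label_process
begin

definition remaining :: "nat \<Rightarrow> 'a \<Rightarrow> real" where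
  "remaining i \<omega> = 1 - (\<Sum>l\<in>{1..i}. Q l \<omega>)"

lemma remaining_measurable [measurable]: "remaining i \<in> borel_measurable M"
  unfolding remaining_def by measurable

lemma remaining_bounds: "AE \<omega> in M. \<forall>i. 0 \<le> remaining i \<omega> \<and> remaining i \<omega> \<le> 1"
  using Q_nonneg Q_sum_le_1
  by eventually_elim (auto simp: remaining_def intro!: sum_nonneg)

text \<open>The value of \<open>stick_series 1 k\<close> where the remaining masses are positive.
  Where one of them vanishes, division by zero makes it 0 while the series diverges;
  \<open>stick_series_AE\<close> excludes this on \<open>distinct_event k\<close>.\<close>

definition stick_weight :: "nat \<Rightarrow> 'a \<Rightarrow> real" where
  "stick_weight k \<omega> = (\<Prod>i\<in>{1..<k}. 1 / remaining i \<omega>)"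

lemma stick_weight_measurable [measurable]: "stick_weight k \<in> borel_measurable M"
  unfolding stick_weight_def by measurable

text \<open>The instance \<open>n = 1\<close> of \<open>nn_integral_labelled_occurs\<close>: the
  first element always has label 1, so the condition on the initial labels is void.\<close>

lemma nn_integral_occurs_eq:
  assumes "1 \<le> k" and u: "set u \<subseteq> {1..k}"
  shows "(\<integral>\<^sup>+\<omega>. indicator (label_occurs k) \<omega> * (\<Prod>i\<leftarrow>u. q i \<omega>) \<partial>M)
    = (\<integral>\<^sup>+\<omega>. indicator (distinct_event k) \<omega> * (\<Prod>i\<leftarrow>u. q i \<omega>) * stick_series 1 k \<omega> \<partial>M)"
proof -
  let ?w = "\<lambda>_::nat. 1::nat"
  have rg: "restricted_growth 1 ?w" by (auto simp: restricted_growth_def)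
  have im: "?w ` {1..1} = {1..1}" by auto
  have "L \<omega> 1 = 1" if "\<omega> \<in> space M" for \<omega>
  proof -
    have g: "1 \<le> L \<omega> 1" "\<And>i. 1 \<le> i \<Longrightarrow> i < L \<omega> 1 \<Longrightarrow> \<exists>l\<in>{1..<1}. L \<omega> l = i"
      using L_growth[OF that, of 1] unfolding restricted_growth_def by auto
    then show ?thesis using g(2)[of 1] by (cases "1 < L \<omega> 1") auto
  qed
  then have lab: "labelled {1..1} ?w = space M" by (auto simp: labelled_def)
  have "(\<integral>\<^sup>+\<omega>. indicator (labelled {1..1} ?w) \<omega> * indicator (label_occurs k) \<omega> * (\<Prod>i\<leftarrow>u. q i \<omega>) \<partial>M)
    = (\<integral>\<^sup>+\<omega>. indicator (label_occurs k) \<omega> * (\<Prod>i\<leftarrow>u. q i \<omega>) \<partial>M)"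
    unfolding lab by (rule nn_integral_cong) simp
  moreover have "card {m \<in> {1..1}. ?w m = i} - 1 = 0" if "i \<in> {1..1}" for i :: nat
    using that by simp
  ultimately show ?thesis
    using nn_integral_labelled_occurs[OF order.refl rg im order.refl assms] by simp
qed

text \<open>Integrated over \<open>distinct_event k\<close>, the series gives the probability of
  \<open>label_occurs k\<close>, so it is finite almost surely there. A vanishing remaining mass
  would turn one geometric series into a divergent sum of ones.\<close>

lemma stick_series_AE:
  assumes k: "1 \<le> k"
  shows "AE \<omega> in M. \<omega> \<in> distinct_event k \<longrightarrow>
    (\<forall>i\<in>{1..<k}. 0 < remaining i \<omega>) \<and> stick_series 1 k \<omega> = ennreal (stick_weight k \<omega>)"
proof -
  have "(\<integral>\<^sup>+\<omega>. indicator (distinct_event k) \<omega> * stick_series 1 k \<omega> \<partial>M) = (\<integral>\<^sup>+\<omega>. indicator (label_occurs k) \<omega> \<partial>M)"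
    using nn_integral_occurs_eq[OF k, of "[]"] by simp
  also have "\<dots> < \<top>"
    using emeasure_space_1 emeasure_space[of M "label_occurs k"] by (simp add: less_top[symmetric])
  finally have "AE \<omega> in M. indicator (distinct_event k) \<omega> * stick_series 1 k \<omega> \<noteq> \<infinity>"
    by (intro nn_integral_PInf_AE) auto
  with Q_nonneg remaining_bounds show ?thesis
  proof eventually_elim
    fix \<omega> assume Q0: "\<forall>i\<in>{1..}. 0 \<le> Q i \<omega>" and rb: "\<forall>i. 0 \<le> remaining i \<omega> \<and> remaining i \<omega> \<le> 1"
      and fin: "indicator (distinct_event k) \<omega> * stick_series 1 k \<omega> \<noteq> \<infinity>"
    show "\<omega> \<in> distinct_event k \<longrightarrow> (\<forall>i\<in>{1..<k}. 0 < remaining i \<omega>) \<and> stick_series 1 k \<omega> = ennreal (stick_weight k \<omega>)"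
    proof
      assume D: "\<omega> \<in> distinct_event k"
      define g where "g i = (\<Sum>m. (\<Sum>l\<in>{1..i}. q l \<omega>) ^ m)" for i
      have G: "stick_series 1 k \<omega> = (\<Prod>i\<in>{1..<k}. g i)" by (simp add: stick_series_def g_def)
      have qs: "(\<Sum>l\<in>{1..i}. q l \<omega>) = ennreal (1 - remaining i \<omega>)" for i
        unfolding q_def using Q0 by (subst sum_ennreal) (auto simp: remaining_def)
      have g_pow: "g i = (\<Sum>m. ennreal ((1 - remaining i \<omega>) ^ m))" for i
        unfolding g_def
      proof (rule suminf_cong)
        show "(\<Sum>l\<in>{1..i}. q l \<omega>) ^ m = ennreal ((1 - remaining i \<omega>) ^ m)" for m
          unfolding qs using rb by (simp add: ennreal_power)
      qed
      have g1: "1 \<le> g i" for i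
        using sum_le_suminf[of "\<lambda>m. (\<Sum>l\<in>{1..i}. q l \<omega>) ^ m" "{0}"] by (simp add: g_def)
      have fin': "(\<Prod>i\<in>{1..<k}. g i) \<noteq> \<top>" unfolding G[symmetric] using fin D by simp
      have pos: "0 < remaining i \<omega>" if i: "i \<in> {1..<k}" for i
      proof (rule ccontr)
        assume "\<not> 0 < remaining i \<omega>"
        then have "remaining i \<omega> = 0" using rb by (meson dual_order.antisym not_less)
        then have "g i = (\<Sum>m. 1)" by (simp add: g_pow)
        also have "\<dots> = (\<top> :: ennreal)"
        proof (rule ccontr)
          assume "(\<Sum>m::nat. 1) \<noteq> (\<top> :: ennreal)"
          then have "summable (\<lambda>_::nat. 1 :: real)" by (intro summable_suminf_not_top) simp_all
          then show False by (simp add: summable_const_iff)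
        qed
        finally have "g i = \<top>" .
        \<comment> \<open>The other factors are at least 1; this excludes the product of 0 and
          infinity, which is 0.\<close>
        moreover have "1 \<le> (\<Prod>i\<in>I. g i)" if "finite I" for I
          using that
        proof induction
          case (insert i I)
          have "1 * 1 \<le> g i * (\<Prod>i\<in>I. g i)" by (rule mult_mono[OF g1 insert.IH]) auto
          then show ?case using insert.hyps by simp
        qed simp
        from this[of "{1..<k} - {i}"] have "(\<Prod>i\<in>{1..<k} - {i}. g i) \<noteq> 0"
          by (metis not_one_le_zero finite_Diff finite_atLeastLessThan)
        ultimately have "(\<Prod>i\<in>{1..<k}. g i) = \<top>"
          using i by (subst prod.remove[of _ i]) (auto simp: ennreal_mult_eq_top_iff)
        with fin' show False by simp
      qed
      have "g i = ennreal (1 / remaining i \<omega>)" if i: "i \<in> {1..<k}" for i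
      proof -
        have "(\<lambda>m. (1 - remaining i \<omega>) ^ m) sums (1 / (1 - (1 - remaining i \<omega>)))"
          by (rule geometric_sums) (use pos[OF i] rb[rule_format, of i] in \<open>auto simp: abs_if\<close>)
        then have "(\<Sum>m. ennreal ((1 - remaining i \<omega>) ^ m)) = ennreal (1 / remaining i \<omega>)"
          by (intro suminf_ennreal_eq) (use rb in \<open>auto intro!: zero_le_power\<close>)
        then show ?thesis by (simp only: g_pow)
      qed
      then have "(\<Prod>i\<in>{1..<k}. g i) = (\<Prod>i\<in>{1..<k}. ennreal (1 / remaining i \<omega>))" by simp
      also have "\<dots> = ennreal (stick_weight k \<omega>)"
        unfolding stick_weight_def by (rule prod_ennreal) (use pos in \<open>auto intro: less_imp_le\<close>)
      finally show "(\<forall>i\<in>{1..<k}. 0 < remaining i \<omega>) \<and> stick_series 1 k \<omega> = ennreal (stick_weight k \<omega>)"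
        using pos G by simp
    qed
  qed
qed

lemma stick_weight_nonneg: "AE \<omega> in M. 0 \<le> stick_weight k \<omega>"
  using remaining_bounds by eventually_elim (auto simp: stick_weight_def intro!: prod_nonneg)

lemma integrable_stick_weight:
  assumes k: "1 \<le> k"
  shows "integrable M (\<lambda>\<omega>. indicator (distinct_event k) \<omega> * stick_weight k \<omega>)"
proof (rule integrableI_nonneg)
  show "AE \<omega> in M. 0 \<le> indicator (distinct_event k) \<omega> * stick_weight k \<omega>"
    using stick_weight_nonneg[of k] by eventually_elim auto
  have "(\<integral>\<^sup>+\<omega>. ennreal (indicator (distinct_event k) \<omega> * stick_weight k \<omega>) \<partial>M)
    = (\<integral>\<^sup>+\<omega>. indicator (distinct_event k) \<omega> * stick_series 1 k \<omega> \<partial>M)"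
    using stick_series_AE[OF k] by (intro nn_integral_cong_AE, eventually_elim) (auto simp: indicator_def)
  also have "\<dots> = (\<integral>\<^sup>+\<omega>. indicator (label_occurs k) \<omega> \<partial>M)"
    using nn_integral_occurs_eq[OF k, of "[]"] by simp
  also have "\<dots> < \<top>"
    using emeasure_space_1 emeasure_space[of M "label_occurs k"] by (simp add: less_top[symmetric])
  finally show "(\<integral>\<^sup>+\<omega>. ennreal (indicator (distinct_event k) \<omega> * stick_weight k \<omega>) \<partial>M) < \<infinity>" by simp
qed simp

text \<open>For integrals of frequency monomials, restricting to \<open>label_occurs k\<close>
  amounts to restricting to \<open>distinct_event k\<close> with density
  \<open>stick_weight k\<close>.\<close>

lemma expectation_occurs_monomial:
  assumes k: "1 \<le> k" and u: "set u \<subseteq> {1..k}"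
  shows "expectation (\<lambda>\<omega>. indicator (label_occurs k) \<omega> * (\<Prod>i\<leftarrow>u. Q i \<omega>))
    = expectation (\<lambda>\<omega>. indicator (distinct_event k) \<omega> * (\<Prod>i\<leftarrow>u. Q i \<omega>) * stick_weight k \<omega>)"
proof -
  have u1: "set u \<subseteq> {1..}" using u by auto
  note b = Q_monomial_bounds[OF u1] and qe = q_monomial_eq[OF u1]
  have "expectation (\<lambda>\<omega>. indicator (label_occurs k) \<omega> * (\<Prod>i\<leftarrow>u. Q i \<omega>))
    = enn2real (\<integral>\<^sup>+\<omega>. ennreal (indicator (label_occurs k) \<omega> * (\<Prod>i\<leftarrow>u. Q i \<omega>)) \<partial>M)"
    by (rule integral_eq_nn_integral, simp, rule eventually_mono[OF b]) auto
  also have "(\<integral>\<^sup>+\<omega>. ennreal (indicator (label_occurs k) \<omega> * (\<Prod>i\<leftarrow>u. Q i \<omega>)) \<partial>M)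
    = (\<integral>\<^sup>+\<omega>. indicator (label_occurs k) \<omega> * (\<Prod>i\<leftarrow>u. q i \<omega>) \<partial>M)"
    using qe by (intro nn_integral_cong_AE, eventually_elim) (auto simp: indicator_def)
  also have "\<dots> = (\<integral>\<^sup>+\<omega>. indicator (distinct_event k) \<omega> * (\<Prod>i\<leftarrow>u. q i \<omega>) * stick_series 1 k \<omega> \<partial>M)"
    by (rule nn_integral_occurs_eq[OF k u])
  also have "\<dots> = (\<integral>\<^sup>+\<omega>. ennreal (indicator (distinct_event k) \<omega> * (\<Prod>i\<leftarrow>u. Q i \<omega>) * stick_weight k \<omega>) \<partial>M)"
    using qe b stick_series_AE[OF k] stick_weight_nonneg[of k]
    by (intro nn_integral_cong_AE, eventually_elim) (auto simp: indicator_def ennreal_mult)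
  also have "enn2real \<dots> = expectation (\<lambda>\<omega>. indicator (distinct_event k) \<omega> * (\<Prod>i\<leftarrow>u. Q i \<omega>) * stick_weight k \<omega>)"
    using b stick_weight_nonneg[of k]
    by (intro integral_eq_nn_integral[symmetric], simp, eventually_elim, auto)
  finally show ?thesis .
qed

lemma remaining_prod_bounds: "AE \<omega> in M. 0 \<le> (\<Prod>i\<in>I. remaining i \<omega>) \<and> (\<Prod>i\<in>I. remaining i \<omega>) \<le> 1"
  using remaining_bounds by eventually_elim (auto intro!: prod_nonneg prod_le_1)

text \<open>For \<open>i < k\<close>, \<open>remaining i\<close> is a polynomial in the frequencies
  of labels below \<open>k\<close>, so linearity extends the monomial identity one factor at a
  time.\<close>

lemma expectation_occurs_polynomial:
  assumes k: "1 \<le> k" and I: "finite I" "I \<subseteq> {1..<k}" and u: "set u \<subseteq> {1..k}"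
  shows "expectation (\<lambda>\<omega>. indicator (label_occurs k) \<omega> * (\<Prod>i\<leftarrow>u. Q i \<omega>) * (\<Prod>i\<in>I. remaining i \<omega>))
    = expectation (\<lambda>\<omega>. indicator (distinct_event k) \<omega> * (\<Prod>i\<leftarrow>u. Q i \<omega>) * (\<Prod>i\<in>I. remaining i \<omega>) * stick_weight k \<omega>)"
  using I u
proof (induction I arbitrary: u)
  case empty
  then show ?case using expectation_occurs_monomial[OF k] by simp
next
  case (insert i I)
  define f where "f u \<omega> = indicator (label_occurs k) \<omega> * (\<Prod>i\<leftarrow>u. Q i \<omega>) * (\<Prod>i\<in>I. remaining i \<omega>)" for u \<omega>
  define g where "g u \<omega> = indicator (distinct_event k) \<omega> * (\<Prod>i\<leftarrow>u. Q i \<omega>) * (\<Prod>i\<in>I. remaining i \<omega>) * stick_weight k \<omega>" for u \<omega>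
  have intf: "integrable M (f u)" if u: "set u \<subseteq> {1..k}" for u
  proof (rule integrable_const_bound[where B = 1])
    have u1: "set u \<subseteq> {1..}" using u by auto
    show "AE \<omega> in M. norm (f u \<omega>) \<le> 1"
      using Q_monomial_bounds[OF u1] remaining_prod_bounds[of I]
      by eventually_elim (auto simp: f_def indicator_def abs_mult intro!: mult_le_one)
    show "f u \<in> borel_measurable M" unfolding f_def by measurable
  qed
  have intg: "integrable M (g u)" if u: "set u \<subseteq> {1..k}" for u
  proof (rule Bochner_Integration.integrable_bound[OF integrable_stick_weight[OF k]])
    have u1: "set u \<subseteq> {1..}" using u by auto
    show "AE \<omega> in M. norm (g u \<omega>) \<le> norm (indicator (distinct_event k) \<omega> * stick_weight k \<omega>)"
      using Q_monomial_bounds[OF u1] remaining_prod_bounds[of I]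
    proof eventually_elim
      fix \<omega> assume "0 \<le> (\<Prod>i\<leftarrow>u. Q i \<omega>) \<and> (\<Prod>i\<leftarrow>u. Q i \<omega>) \<le> 1" "0 \<le> (\<Prod>i\<in>I. remaining i \<omega>) \<and> (\<Prod>i\<in>I. remaining i \<omega>) \<le> 1"
      then have "\<bar>(\<Prod>i\<leftarrow>u. Q i \<omega>) * (\<Prod>i\<in>I. remaining i \<omega>)\<bar> \<le> 1" by (auto simp: abs_mult intro!: mult_le_one)
      then have "\<bar>(\<Prod>i\<leftarrow>u. Q i \<omega>) * (\<Prod>i\<in>I. remaining i \<omega>)\<bar> * \<bar>indicator (distinct_event k) \<omega> * stick_weight k \<omega>\<bar> \<le> 1 * \<bar>indicator (distinct_event k) \<omega> * stick_weight k \<omega>\<bar>"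
        by (intro mult_right_mono) auto
      then show "norm (g u \<omega>) \<le> norm (indicator (distinct_event k) \<omega> * stick_weight k \<omega>)"
        by (simp add: g_def abs_mult mult_ac)
    qed
    show "g u \<in> borel_measurable M" unfolding g_def by measurable
  qed
  have eq: "expectation (f u) = expectation (g u)" if "set u \<subseteq> {1..k}" for u
    unfolding f_def g_def using insert.IH[OF _ that] insert.prems by simp
  have exp: "expectation (\<lambda>\<omega>. h u \<omega> - (\<Sum>l\<in>{1..i}. h (l # u) \<omega>)) = expectation (h u) - (\<Sum>l\<in>{1..i}. expectation (h (l # u)))"
    if "\<And>u. set u \<subseteq> {1..k} \<Longrightarrow> integrable M (h u)" for h :: "nat list \<Rightarrow> 'a \<Rightarrow> real"
  proof -
    have "integrable M (h (l # u))" if "l \<in> {1..i}" for l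
      using insert.prems \<open>\<And>u. set u \<subseteq> {1..k} \<Longrightarrow> integrable M (h u)\<close> that by auto
    moreover have "integrable M (h u)" using that insert.prems by blast
    ultimately show ?thesis
      by (subst Bochner_Integration.integral_diff) (auto intro!: Bochner_Integration.integral_sum)
  qed
  have poly_split: "x * (\<Prod>i\<leftarrow>u. Q i \<omega>) * (\<Prod>i\<in>insert i I. remaining i \<omega>) * y
    = x * (\<Prod>i\<leftarrow>u. Q i \<omega>) * (\<Prod>i\<in>I. remaining i \<omega>) * y -
      (\<Sum>l\<in>{1..i}. x * (\<Prod>i\<leftarrow>l # u. Q i \<omega>) * (\<Prod>i\<in>I. remaining i \<omega>) * y)" for x y \<omega>
  proof -
    have "(\<Sum>l\<in>{1..i}. x * (\<Prod>i\<leftarrow>l # u. Q i \<omega>) * (\<Prod>i\<in>I. remaining i \<omega>) * y)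
      = (\<Sum>l\<in>{1..i}. Q l \<omega>) * (x * (\<Prod>i\<leftarrow>u. Q i \<omega>) * (\<Prod>i\<in>I. remaining i \<omega>) * y)"
      unfolding sum_distrib_right by (rule sum.cong[OF refl]) (simp add: mult_ac)
    moreover have "(\<Prod>i\<in>insert i I. remaining i \<omega>) = (1 - (\<Sum>l\<in>{1..i}. Q l \<omega>)) * (\<Prod>i\<in>I. remaining i \<omega>)"
      using insert.hyps by (simp add: remaining_def)
    ultimately show ?thesis by (simp only:) (simp add: left_diff_distrib right_diff_distrib mult_ac)
  qed
  have lsub: "set (l # u) \<subseteq> {1..k}" if "l \<in> {1..i}" for l
    using insert.prems that by auto
  have "expectation (\<lambda>\<omega>. indicator (label_occurs k) \<omega> * (\<Prod>i\<leftarrow>u. Q i \<omega>) * (\<Prod>i\<in>insert i I. remaining i \<omega>))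
    = expectation (\<lambda>\<omega>. f u \<omega> - (\<Sum>l\<in>{1..i}. f (l # u) \<omega>))"
  proof (rule Bochner_Integration.integral_cong[OF refl])
    fix \<omega>
    show "indicator (label_occurs k) \<omega> * (\<Prod>i\<leftarrow>u. Q i \<omega>) * (\<Prod>i\<in>insert i I. remaining i \<omega>)
      = f u \<omega> - (\<Sum>l\<in>{1..i}. f (l # u) \<omega>)"
      using poly_split[of "indicator (label_occurs k) \<omega>" \<omega> 1] unfolding f_def mult_1_right .
  qed
  also have "\<dots> = expectation (g u) - (\<Sum>l\<in>{1..i}. expectation (g (l # u)))"
    by (subst exp[OF intf]) (use eq[OF insert.prems(2)] eq[OF lsub] in simp_all)
  also have "\<dots> = expectation (\<lambda>\<omega>. g u \<omega> - (\<Sum>l\<in>{1..i}. g (l # u) \<omega>))"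
    by (rule exp[OF intg, symmetric])
  also have "\<dots> = expectation (\<lambda>\<omega>. indicator (distinct_event k) \<omega> * (\<Prod>i\<leftarrow>u. Q i \<omega>) * (\<Prod>i\<in>insert i I. remaining i \<omega>) * stick_weight k \<omega>)"
    by (rule Bochner_Integration.integral_cong[OF refl]) (simp only: g_def poly_split)
  finally show ?case .
qed

text \<open>If label \<open>k\<close> never occurs, no larger one does, so all labels lie in
  \<open>{1..k - 1}\<close> and their frequencies add up to 1.\<close>

lemma remaining_zero_if_not_occurs:
  assumes k: "1 \<le> k"
  shows "AE \<omega> in M. \<omega> \<notin> label_occurs k \<longrightarrow> (\<Prod>i\<in>{1..<k}. remaining i \<omega>) = 0"
  using Q_sum_lim AE_space
proof eventually_elim
  fix \<omega>
  assume lim: "\<forall>k. (\<lambda>n. real (card {m\<in>{1..n}. L \<omega> m \<in> {1..k}}) / real n) \<longlonglongrightarrow> (\<Sum>i\<in>{1..k}. Q i \<omega>)" and \<omega>: "\<omega> \<in> space M"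
  show "\<omega> \<notin> label_occurs k \<longrightarrow> (\<Prod>i\<in>{1..<k}. remaining i \<omega>) = 0"
  proof
    assume no: "\<omega> \<notin> label_occurs k"
    have lab: "L \<omega> m \<in> {1..k - 1}" if "1 \<le> m" for m
    proof -
      have g: "1 \<le> L \<omega> m" "\<And>i. 1 \<le> i \<Longrightarrow> i < L \<omega> m \<Longrightarrow> \<exists>l\<in>{1..<m}. L \<omega> l = i"
        using L_growth[OF \<omega>, of m] that unfolding restricted_growth_def by auto
      have ne: "L \<omega> l \<noteq> k" if "1 \<le> l" for l using no \<omega> that by (auto simp: label_occurs_def)
      have "\<not> k < L \<omega> m"
      proof
        assume "k < L \<omega> m"
        then obtain l where "l \<in> {1..<m}" "L \<omega> l = k" using g(2)[OF k] by blast
        then show False using ne[of l] by simp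
      qed
      then show ?thesis using g(1) ne[OF that] by simp
    qed
    \<comment> \<open>The label of the first element lies in \<open>{1..k - 1}\<close>, so this
      range is nonempty and \<open>k - 1\<close> is an index of the product.\<close>
    have k2: "2 \<le> k" using lab[of 1] unfolding atLeastAtMost_iff by linarith
    have "card {m\<in>{1..n}. L \<omega> m \<in> {1..k - 1}} = n" for n
    proof -
      have "{m\<in>{1..n}. L \<omega> m \<in> {1..k - 1}} = {1..n}" 
      proof (rule set_eqI)
        fix m
        show "m \<in> {m\<in>{1..n}. L \<omega> m \<in> {1..k - 1}} \<longleftrightarrow> m \<in> {1..n}"
          using lab[of m] by (cases "m \<in> {1..n}") auto
      qed
      then have "card {m\<in>{1..n}. L \<omega> m \<in> {1..k - 1}} = card {1..n}" by (rule arg_cong)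
      then show ?thesis by simp
    qed
    then have "(\<lambda>n. real n / real n) \<longlonglongrightarrow> (\<Sum>i\<in>{1..k - 1}. Q i \<omega>)" using lim[rule_format, of "k - 1"] by (simp only:)
    moreover have "(\<lambda>n. real n / real n) \<longlonglongrightarrow> 1"
      by (rule Lim_transform_eventually[OF tendsto_const]) (use eventually_gt_at_top[of 0] in eventually_elim, simp)
    ultimately have "(\<Sum>i\<in>{1..k - 1}. Q i \<omega>) = 1" by (rule LIMSEQ_unique)
    then have "remaining (k - 1) \<omega> = 0" by (simp add: remaining_def)
    then show "(\<Prod>i\<in>{1..<k}. remaining i \<omega>) = 0" using k2 by (intro prod_zero) auto
  qed
qed

text \<open>The product of remaining masses vanishes outside \<open>label_occurs k\<close>, so the
  indicator of that event may be inserted. After the change to \<open>distinct_event k\<close> the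
  product cancels \<open>stick_weight k\<close>, and what is left is a label probability with a
  frequency monomial.\<close>

lemma eppf_list_formula:
  assumes k: "1 \<le> k" and u: "set u \<subseteq> {1..k}"
  shows "expectation (\<lambda>\<omega>. (\<Prod>i\<leftarrow>u. Q i \<omega>) * (\<Prod>i\<in>{1..<k}. remaining i \<omega>))
    = p (map (\<lambda>i. 1 + count_list u i) [1..<Suc k])"
proof -
  have "expectation (\<lambda>\<omega>. (\<Prod>i\<leftarrow>u. Q i \<omega>) * (\<Prod>i\<in>{1..<k}. remaining i \<omega>))
    = expectation (\<lambda>\<omega>. indicator (label_occurs k) \<omega> * (\<Prod>i\<leftarrow>u. Q i \<omega>) * (\<Prod>i\<in>{1..<k}. remaining i \<omega>))"
    using remaining_zero_if_not_occurs[OF k]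
    by (intro integral_cong_AE, simp, simp, eventually_elim, auto simp: indicator_def)
  also have "\<dots> = expectation (\<lambda>\<omega>. indicator (distinct_event k) \<omega> * (\<Prod>i\<leftarrow>u. Q i \<omega>) * (\<Prod>i\<in>{1..<k}. remaining i \<omega>) * stick_weight k \<omega>)"
    by (rule expectation_occurs_polynomial[OF k _ _ u]) auto
  also have "\<dots> = expectation (\<lambda>\<omega>. indicator (distinct_event k) \<omega> * (\<Prod>i\<leftarrow>u. Q i \<omega>))"
  proof (rule integral_cong_AE)
    show "AE \<omega> in M. indicator (distinct_event k) \<omega> * (\<Prod>i\<leftarrow>u. Q i \<omega>) * (\<Prod>i\<in>{1..<k}. remaining i \<omega>) * stick_weight k \<omega>
      = indicator (distinct_event k) \<omega> * (\<Prod>i\<leftarrow>u. Q i \<omega>)"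
      using stick_series_AE[OF k]
    proof eventually_elim
      fix \<omega> assume *: "\<omega> \<in> distinct_event k \<longrightarrow> (\<forall>i\<in>{1..<k}. 0 < remaining i \<omega>) \<and> stick_series 1 k \<omega> = ennreal (stick_weight k \<omega>)"
      have "(\<Prod>i\<in>{1..<k}. remaining i \<omega>) * stick_weight k \<omega> = 1" if "\<omega> \<in> distinct_event k"
        unfolding stick_weight_def prod.distrib[symmetric] by (rule prod.neutral) (use * that in force)
      then show "indicator (distinct_event k) \<omega> * (\<Prod>i\<leftarrow>u. Q i \<omega>) * (\<Prod>i\<in>{1..<k}. remaining i \<omega>) * stick_weight k \<omega>
        = indicator (distinct_event k) \<omega> * (\<Prod>i\<leftarrow>u. Q i \<omega>)"
        by (cases "\<omega> \<in> distinct_event k") (simp_all add: mult.assoc)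
    qed
  qed measurable
  also have "\<dots> = p (map (\<lambda>i. card {m \<in> {1..k}. m = i} + count_list u i) [1..<Suc k])"
    unfolding distinct_event_def
    by (rule expectation_label_monomial[OF k restricted_growth_id]) (use u in auto)
  also have "map (\<lambda>i. card {m \<in> {1..k}. m = i} + count_list u i) [1..<Suc k] = map (\<lambda>i. 1 + count_list u i) [1..<Suc k]"
  proof (rule map_cong[OF refl])
    fix i assume "i \<in> set [1..<Suc k]"
    then have "{m \<in> {1..k}. m = i} = {i}" by auto
    then show "card {m \<in> {1..k}. m = i} + count_list u i = 1 + count_list u i" by simp
  qed
  finally show ?thesis .
qed

end

section \<open>Moments and beta laws\<close>

text \<open>All absolute moments are at most 1, so the Taylor remainder of the characteristic
  function is at most \<open>2 * \<bar>t\<bar> ^ n / fact n\<close>.\<close>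

lemma char_moments_LIMSEQ:
  assumes "real_distribution \<mu>" and AE: "AE x in \<mu>. x \<in> {0..1}"
  shows "(\<lambda>n. \<Sum>k\<le>n. ((\<i> * t)^k / fact k) * complex_of_real (\<integral>x. x ^ k \<partial>\<mu>)) \<longlonglongrightarrow> char \<mu> t"
proof -
  interpret real_distribution \<mu> by fact
  have int: "integrable \<mu> (\<lambda>x. x ^ k)" for k
    by (rule integrable_const_bound[where B = 1], use AE in eventually_elim) (auto simp: power_le_one)
  have le1: "expectation (\<lambda>x. \<bar>x\<bar> ^ n) \<le> 1" for n
  proof -
    have "expectation (\<lambda>x. \<bar>x\<bar> ^ n) \<le> expectation (\<lambda>x. 1)"
      by (rule integral_mono_AE, use int[of n] in \<open>simp add: power_abs[symmetric]\<close>, simp,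
        rule eventually_mono[OF AE]) (auto intro!: power_le_one)
    then show ?thesis using prob_space by simp
  qed
  have "(\<lambda>n. \<bar>t\<bar> ^ n / fact n) \<longlonglongrightarrow> 0"
    using summable_LIMSEQ_zero[OF summable_exp[of "\<bar>t\<bar>"]] by (simp add: field_simps)
  then have "(\<lambda>n. 2 * (\<bar>t\<bar> ^ n / fact n)) \<longlonglongrightarrow> 2 * 0"
    by (intro tendsto_intros)
  then have lim: "(\<lambda>n. 2 * \<bar>t\<bar> ^ n / fact n) \<longlonglongrightarrow> 0"
    by simp
  show ?thesis
  proof (rule Lim_transform2[OF tendsto_const], rule Lim_null_comparison[OF _ lim], intro always_eventually allI)
    fix n
    have "cmod (char \<mu> t - (\<Sum>k\<le>n. ((\<i> * t)^k / fact k) * expectation (\<lambda>x. x^k)))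
      \<le> (2*\<bar>t\<bar>^n / fact n) * expectation (\<lambda>x. \<bar>x\<bar>^n)"
      by (rule char_approx1) (rule int)
    also have "\<dots> \<le> (2*\<bar>t\<bar>^n / fact n) * 1"
      by (intro mult_left_mono le1) auto
    finally show "cmod ((char \<mu> t) - (\<Sum>k\<le>n. ((\<i> * t)^k / fact k) * complex_of_real (\<integral>x. x ^ k \<partial>\<mu>))) \<le> 2 * \<bar>t\<bar> ^ n / fact n"
      by simp
  qed
qed

lemma real_distribution_eqI_moments:
  assumes \<mu>: "real_distribution \<mu>" "AE x in \<mu>. x \<in> {0..1}"
    and \<nu>: "real_distribution \<nu>" "AE x in \<nu>. x \<in> {0..1}"
    and eq: "\<And>n. (\<integral>x. x ^ n \<partial>\<mu>) = (\<integral>x. x ^ n \<partial>\<nu>)"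
  shows "\<mu> = \<nu>"
proof (rule Levy_uniqueness[OF \<mu>(1) \<nu>(1)], rule ext)
  fix t
  show "char \<mu> t = char \<nu> t"
    using char_moments_LIMSEQ[OF \<mu>, of t] char_moments_LIMSEQ[OF \<nu>, of t] unfolding eq
    by (rule LIMSEQ_unique)
qed

context prob_space
begin

lemma integrable_bounded_AE:
  fixes f :: "'a \<Rightarrow> real"
  assumes "f \<in> borel_measurable M" "AE x in M. \<bar>f x\<bar> \<le> B"
  shows "integrable M f"
  by (rule integrable_const_bound[where B = B]) (use assms in auto)

text \<open>Moment determinacy for the laws of \<open>X\<close> under two bounded weights. The
  weights are normalised by their mass, which is common to both by the moment of order 0.\<close>

lemma distr_eqI_moments_weighted:
  fixes X f g :: "'a \<Rightarrow> real"
  assumes [measurable]: "X \<in> borel_measurable M" "f \<in> borel_measurable M" "g \<in> borel_measurable M"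
    and X: "AE x in M. X x \<in> {0..1}"
    and f0: "AE x in M. 0 \<le> f x" and f: "AE x in M. f x \<le> B"
    and g0: "AE x in M. 0 \<le> g x" and g: "AE x in M. g x \<le> B"
    and pos: "0 < expectation g"
    and eq: "\<And>n. expectation (\<lambda>x. X x ^ n * f x) = expectation (\<lambda>x. X x ^ n * g x)"
  shows "distr (density M f) borel X = distr (density M g) borel X"
proof -
  define t where "t = expectation g"
  have t: "0 < t" "expectation f = t" "expectation g = t"
    using eq[of 0] pos by (auto simp: t_def)
  define D where "D h = distr (density M (\<lambda>x. h x / t)) borel X" for h :: "'a \<Rightarrow> real"
  have D: "real_distribution (D h)" "AE x in D h. x \<in> {0..1}"
      "(\<integral>x. x ^ n \<partial>D h) = expectation (\<lambda>x. X x ^ n * h x) / t"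
    if h [measurable]: "h \<in> borel_measurable M" and h0: "AE x in M. 0 \<le> h x" and hB: "AE x in M. h x \<le> B"
      and ht: "expectation h = t" for h n
  proof -
    have int: "integrable M h"
      by (rule integrable_bounded_AE[where B = B]) (use h0 hB in auto)
    have "emeasure (density M (\<lambda>x. h x / t)) (space M) = (\<integral>\<^sup>+x. ennreal (h x / t) \<partial>M)"
      by (subst emeasure_density) (auto intro!: nn_integral_cong)
    also have "\<dots> = ennreal (\<integral>x. h x / t \<partial>M)"
      by (rule nn_integral_eq_integral) (use int h0 t in auto)
    also have "\<dots> = 1"
      using ht t by simp
    finally have "prob_space (density M (\<lambda>x. h x / t))"
      by (intro prob_spaceI) simp
    then have "prob_space (D h)"
      unfolding D_def by (rule prob_space.prob_space_distr) simp
    then show "real_distribution (D h)"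
      by (simp add: real_distribution_def real_distribution_axioms_def D_def)
    have "AE x in density M (\<lambda>x. ennreal (h x / t)). X x \<in> {0..1}"
      by (subst AE_density, simp, rule eventually_mono[OF X]) auto
    then show "AE x in D h. x \<in> {0..1}"
      unfolding D_def by (subst AE_distr_iff) auto
    have "(\<integral>x. x ^ n \<partial>D h) = (\<integral>x. X x ^ n \<partial>density M (\<lambda>x. h x / t))"
      unfolding D_def by (rule integral_distr) auto
    also have "\<dots> = (\<integral>x. (h x / t) *\<^sub>R X x ^ n \<partial>M)"
      by (rule integral_density) (use h0 t in auto)
    also have "\<dots> = (\<integral>x. (X x ^ n * h x) / t \<partial>M)"
      by (intro Bochner_Integration.integral_cong) auto
    finally show "(\<integral>x. x ^ n \<partial>D h) = expectation (\<lambda>x. X x ^ n * h x) / t"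
      by simp
  qed
  have scale: "distr (density M h) borel X = density (D h) (\<lambda>_. t)"
    if h [measurable]: "h \<in> borel_measurable M" and h0: "AE x in M. 0 \<le> h x" for h
  proof -
    have "density M h = density M (\<lambda>x. ennreal (h x / t) * ennreal t)"
      by (rule density_cong) (use t h0 in \<open>auto simp: ennreal_mult''[symmetric] elim!: eventually_mono\<close>)
    also have "\<dots> = density (density M (\<lambda>x. h x / t)) (\<lambda>_. t)"
      by (subst density_density_eq) auto
    also have "distr \<dots> borel X = density (D h) (\<lambda>_. t)"
      unfolding D_def by (subst density_distr) auto
    finally show ?thesis .
  qed
  have "D f = D g"
    using D(1)[of f] D(1)[of g] D(2)[of f] D(2)[of g] D(3)[of f] D(3)[of g] f f0 g g0 t eq
    by (intro real_distribution_eqI_moments) auto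
  then show ?thesis
    using f0 g0 by (simp add: scale)
qed

text \<open>Turns weighted moment identities into the statement that \<open>H\<close> has
  conditional expectation 0 given \<open>X\<close>. The weights \<open>(1 - X) ^ r * (H + c)\<close>
  and \<open>(1 - X) ^ r * c\<close> give \<open>X\<close> the same moments, hence the same law, and
  the common factor can be divided out.\<close>

lemma expectation_indicator_eq_0I_moments:
  fixes X H :: "'a \<Rightarrow> real"
  assumes [measurable]: "X \<in> borel_measurable M" "H \<in> borel_measurable M"
    and X: "AE x in M. X x \<in> {0..1}" "AE x in M. X x < 1"
    and H: "AE x in M. \<bar>H x\<bar> \<le> B"
    and eq: "\<And>n. expectation (\<lambda>x. X x ^ n * (1 - X x) ^ r * H x) = 0"
    and A [measurable]: "A \<in> sets borel"
  shows "expectation (\<lambda>x. indicator A (X x) * H x) = 0"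
proof -
  \<comment> \<open>A shift that makes the signed \<open>H\<close> nonnegative, so that it can serve
    as a density.\<close>
  define c where "c = \<bar>B\<bar> + 1"
  have c: "c > 0" "AE x in M. 0 \<le> H x + c" "AE x in M. H x + c \<le> 2 * c"
    using H by (auto simp: c_def)
  define f where "f x = (1 - X x) ^ r * (H x + c)" for x
  define g where "g x = (1 - X x) ^ r * c" for x
  have [measurable]: "f \<in> borel_measurable M" "g \<in> borel_measurable M"
    unfolding f_def g_def by measurable
  have pw: "AE x in M. 0 < (1 - X x) ^ r \<and> (1 - X x) ^ r \<le> 1"
    using X by eventually_elim (auto intro!: power_le_one)
  have f: "AE x in M. 0 \<le> f x" "AE x in M. f x \<le> 2 * c"
    using pw c(2,3) by (eventually_elim, auto simp: f_def intro: mult_le_one order.trans[OF mult_mono[of _ 1 _ "2*c"]])+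
  have g: "AE x in M. 0 < g x" "AE x in M. g x \<le> 2 * c"
    using pw by (eventually_elim, use c in \<open>auto simp: g_def intro: order.trans[OF mult_mono[of _ 1 _ "2*c"]]\<close>)+
  have g': "AE x in M. 0 \<le> g x"
    using g(1) by eventually_elim auto
  have intg: "integrable M g"
    by (rule integrable_bounded_AE[where B = "2*c"]) (use g g' in auto)
  have Xn: "AE x in M. \<bar>X x ^ n * (1 - X x) ^ r\<bar> \<le> 1" for n
    using X by eventually_elim (auto simp: abs_mult intro!: mult_le_one power_le_one)
  have distr: "distr (density M f) borel X = distr (density M g) borel X"
  proof (rule distr_eqI_moments_weighted[OF _ _ _ X(1) f g' g(2)])
    have "expectation g \<noteq> 0"
    proof
      assume "expectation g = 0"
      then have "AE x in M. g x = 0"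
        by (subst (asm) integral_nonneg_eq_0_iff_AE[OF intg g'])
      with g(1) have "AE x in M. False"
        by eventually_elim auto
      then show False by simp
    qed
    moreover have "expectation g \<ge> 0"
      by (rule integral_nonneg_AE[OF g'])
    ultimately show "0 < expectation g" by simp
  next
    fix n
    have i1: "integrable M (\<lambda>x. X x ^ n * (1 - X x) ^ r * H x)"
      by (rule integrable_bounded_AE[where B = "1 * B"], simp)
        (use Xn[of n] H in eventually_elim, subst abs_mult, rule mult_mono, auto)
    have i2: "integrable M (\<lambda>x. X x ^ n * (1 - X x) ^ r * c)"
      by (intro integrable_mult_left, rule integrable_bounded_AE[OF _ Xn]) simp
    have "expectation (\<lambda>x. X x ^ n * f x) = expectation (\<lambda>x. X x ^ n * (1 - X x) ^ r * H x + X x ^ n * (1 - X x) ^ r * c)"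
      by (intro Bochner_Integration.integral_cong) (auto simp: f_def algebra_simps)
    also have "\<dots> = expectation (\<lambda>x. X x ^ n * (1 - X x) ^ r * c)"
      using i1 i2 eq by (subst Bochner_Integration.integral_add) auto
    finally show "expectation (\<lambda>x. X x ^ n * f x) = expectation (\<lambda>x. X x ^ n * g x)"
      by (simp add: g_def algebra_simps)
  qed auto
  \<comment> \<open>\<open>\<phi>\<close> cancels the weight, which is positive almost surely
    because \<open>X < 1\<close>.\<close>
  define \<phi> where "\<phi> x = ennreal (indicator A x * inverse ((1 - x) ^ r))" for x :: real
  have [measurable]: "\<phi> \<in> borel_measurable borel"
    unfolding \<phi>_def by measurable
  have tr: "(\<integral>\<^sup>+x. \<phi> x \<partial>distr (density M h) borel X) = (\<integral>\<^sup>+x. ennreal (indicator A (X x) * k x) \<partial>M)"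
    if [measurable]: "h \<in> borel_measurable M" and k: "\<And>x. h x = (1 - X x) ^ r * k x" "AE x in M. 0 \<le> k x" for h k
  proof -
    have "(\<integral>\<^sup>+x. \<phi> x \<partial>distr (density M h) borel X) = (\<integral>\<^sup>+x. ennreal (h x) * \<phi> (X x) \<partial>M)"
      by (simp add: nn_integral_distr nn_integral_density)
    also have "\<dots> = (\<integral>\<^sup>+x. ennreal (indicator A (X x) * k x) \<partial>M)"
      using X(2) X(1) k(2)
      by (intro nn_integral_cong_AE, eventually_elim)
        (auto simp: \<phi>_def k ennreal_mult[symmetric] field_simps split: split_indicator)
    finally show ?thesis .
  qed
  have eq2: "(\<integral>\<^sup>+x. ennreal (indicator A (X x) * (H x + c)) \<partial>M) = (\<integral>\<^sup>+x. ennreal (indicator A (X x) * c) \<partial>M)"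
    using tr[of f "\<lambda>x. H x + c"] tr[of g "\<lambda>x. c"] c distr by (simp add: f_def g_def)
  have i1: "integrable M (\<lambda>x. indicator A (X x) * (H x + c))"
    by (rule integrable_bounded_AE[where B = "2*c"]) (use c in \<open>auto simp: abs_mult split: split_indicator\<close>)
  have i2: "integrable M (\<lambda>x. indicator A (X x) * c)"
    by (rule integrable_bounded_AE[where B = "2*c"]) (use c in \<open>auto simp: abs_mult split: split_indicator\<close>)
  have "(\<integral>\<^sup>+x. ennreal (indicator A (X x) * (H x + c)) \<partial>M) = ennreal (expectation (\<lambda>x. indicator A (X x) * (H x + c)))"
    by (rule nn_integral_eq_integral[OF i1]) (use c(2) in \<open>auto elim!: eventually_mono\<close>)
  moreover have "(\<integral>\<^sup>+x. ennreal (indicator A (X x) * c) \<partial>M) = ennreal (expectation (\<lambda>x. indicator A (X x) * c))"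
    by (rule nn_integral_eq_integral[OF i2]) (use c in auto)
  moreover have "expectation (\<lambda>x. indicator A (X x) * (H x + c)) \<ge> 0"
    by (rule integral_nonneg_AE) (use c(2) in \<open>auto elim!: eventually_mono\<close>)
  moreover have "expectation (\<lambda>x. indicator A (X x) * c) \<ge> 0"
    by (rule integral_nonneg_AE) (use c in auto)
  ultimately have e: "expectation (\<lambda>x. indicator A (X x) * (H x + c)) = expectation (\<lambda>x. indicator A (X x) * c)"
    using eq2 by simp
  have "expectation (\<lambda>x. indicator A (X x) * H x) = expectation (\<lambda>x. indicator A (X x) * (H x + c) - indicator A (X x) * c)"
    by (intro Bochner_Integration.integral_cong) (auto simp: algebra_simps)
  also have "\<dots> = 0"
    using i1 i2 e by (subst Bochner_Integration.integral_diff) auto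
  finally show ?thesis .
qed

end

section \<open>Beta laws and their moments\<close>

lemma beta_density_nonneg: "0 < a \<Longrightarrow> 0 < b \<Longrightarrow> 0 \<le> beta_density a b u"
  by (auto simp: beta_density_def intro!: mult_nonneg_nonneg divide_nonneg_nonneg less_imp_le[OF Gamma_real_pos])

lemma borel_measurable_beta_density [measurable]: "beta_density a b \<in> borel_measurable borel"
  unfolding beta_density_def by measurable

lemma nn_integral_beta_density:
  assumes a: "0 < a" and b: "0 < b"
  shows "(\<integral>\<^sup>+u. ennreal (u ^ n * beta_density a b u) \<partial>lborel)
    = ennreal (pochhammer a n / pochhammer (a + b) n)"
proof -
  define C where "C = Gamma (a + b) / (Gamma a * Gamma b)"
  have C: "C > 0" using a b by (simp add: C_def Gamma_real_pos)
  have "((\<lambda>t. t powr (a + n - 1) * (1 - t) powr (b - 1)) has_integral Beta (a + n) b) {0..1}"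
    by (rule has_integral_Beta_real) (use a b in auto)
  then have "((\<lambda>t. C * (t powr (a + n - 1) * (1 - t) powr (b - 1))) has_integral C * Beta (a + n) b) {0<..<1}"
    by (intro has_integral_mult_right) (simp add: has_integral_Icc_iff_Ioo)
  then have "((\<lambda>t. t ^ n * beta_density a b t) has_integral C * Beta (a + n) b) {0<..<1}"
  proof (rule has_integral_eq[rotated])
    fix t :: real assume t: "t \<in> {0<..<1}"
    have "t powr (a + n - 1) = t ^ n * t powr (a - 1)"
      using t by (simp add: powr_realpow[symmetric] powr_add[symmetric] algebra_simps)
    then show "C * (t powr (a + n - 1) * (1 - t) powr (b - 1)) = t ^ n * beta_density a b t"
      using t by (simp add: beta_density_def C_def)
  qed
  then have "((\<lambda>t. t ^ n * beta_density a b t) has_integral C * Beta (a + n) b) UNIV"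
    by (subst (asm) has_integral_restrict_UNIV[symmetric])
      (erule has_integral_eq[rotated], auto simp: beta_density_def)
  then have "(\<integral>\<^sup>+u. ennreal (u ^ n * beta_density a b u) \<partial>lborel) = ennreal (C * Beta (a + n) b)"
  proof (intro nn_integral_has_integral_lborel)
    show "0 \<le> x ^ n * beta_density a b x" for x
      using beta_density_nonneg[OF a b, of x] by (cases "0 < x") (auto simp: beta_density_def intro!: mult_nonneg_nonneg simp del: times_divide_eq_left times_divide_eq_right)
  qed auto
  also have "C * Beta (a + n) b = (Gamma (a + n) / Gamma a) / (Gamma (a + b + n) / Gamma (a + b))"
    using Gamma_real_pos[OF b] by (simp add: C_def Beta_def field_simps)
  also have "\<dots> = pochhammer a n / pochhammer (a + b) n"
    using a b by (subst (1 2) pochhammer_Gamma) (auto simp: nonpos_Ints_def)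
  finally show ?thesis .
qed

lemma beta_distribution:
  assumes a: "0 < a" and b: "0 < b"
  defines "\<beta> \<equiv> density lborel (beta_density a b)"
  shows "real_distribution \<beta>" "AE u in \<beta>. u \<in> {0<..<1}"
    "(\<integral>u. u ^ n \<partial>\<beta>) = pochhammer a n / pochhammer (a + b) n"
proof -
  note nonneg = beta_density_nonneg[OF a b]
  have "emeasure \<beta> (space \<beta>) = 1"
    using nn_integral_beta_density[OF a b, of 0] by (simp add: \<beta>_def emeasure_density)
  then have "prob_space \<beta>" by (intro prob_spaceI)
  then show "real_distribution \<beta>"
    by (simp add: real_distribution_def real_distribution_axioms_def \<beta>_def)
  show "AE u in \<beta>. u \<in> {0<..<1}"
    unfolding \<beta>_def by (subst AE_density) (auto simp: beta_density_def split: if_splits)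
  have nn: "0 \<le> u ^ n * beta_density a b u" for u
    using nonneg[of u] by (cases "0 < u") (auto simp: beta_density_def intro!: mult_nonneg_nonneg simp del: times_divide_eq_left times_divide_eq_right)
  have "(\<integral>u. u ^ n \<partial>\<beta>) = (\<integral>u. u ^ n * beta_density a b u \<partial>lborel)"
    unfolding \<beta>_def by (subst integral_density) (use nonneg in \<open>auto simp: mult.commute\<close>)
  also have "\<dots> = enn2real (\<integral>\<^sup>+u. ennreal (u ^ n * beta_density a b u) \<partial>lborel)"
    by (rule integral_eq_nn_integral) (use nn in auto)
  also have "\<dots> = pochhammer a n / pochhammer (a + b) n"
    using nn_integral_beta_density[OF a b, of n] a b
    by (simp add: pochhammer_nonneg)
  finally show "(\<integral>u. u ^ n \<partial>\<beta>) = pochhammer a n / pochhammer (a + b) n" .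
qed

lemma power_expectation_tendsto_0:
  fixes X :: "'a \<Rightarrow> real"
  assumes "prob_space M" and [measurable]: "X \<in> borel_measurable M" and X: "AE x in M. 0 \<le> X x \<and> X x < 1"
  shows "(\<lambda>n. \<integral>x. X x ^ n \<partial>M) \<longlonglongrightarrow> 0"
proof -
  interpret prob_space M by fact
  have "(\<lambda>n. \<integral>x. X x ^ n \<partial>M) \<longlonglongrightarrow> (\<integral>x. 0 \<partial>M)"
  proof (rule integral_dominated_convergence[where w = "\<lambda>_. 1"])
    show "AE x in M. (\<lambda>n. X x ^ n) \<longlonglongrightarrow> 0"
      using X by eventually_elim (auto intro!: LIMSEQ_realpow_zero)
    show "AE x in M. norm (X x ^ n) \<le> 1" for n
      using X by eventually_elim (auto simp: power_le_one)
  qed auto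
  then show ?thesis by simp
qed

text \<open>The quotients are the moments of a beta law, which gives no mass to the point 1.\<close>

lemma pochhammer_ratio_tendsto_0:
  assumes "0 < (a::real)" "0 < b"
  shows "(\<lambda>n. pochhammer a n / pochhammer (a + b) n) \<longlonglongrightarrow> 0"
proof -
  note \<beta> = beta_distribution[OF assms]
  interpret real_distribution "density lborel (beta_density a b)" by (rule \<beta>)
  show ?thesis
    using power_expectation_tendsto_0[OF prob_space_axioms, of "\<lambda>x. x", OF _ eventually_mono[OF \<beta>(2)]]
    unfolding \<beta>(3) by auto
qed

lemma has_beta_law_moments:
  assumes "prob_space M" and X [measurable]: "X \<in> borel_measurable M" and X01: "AE x in M. X x \<in> {0..1}"
    and ab: "0 < a" "0 < b"
    and mom: "\<And>n. (\<integral>x. X x ^ n \<partial>M) = pochhammer a n / pochhammer (a + b) n"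
  shows "has_beta_law M X a b"
proof -
  interpret prob_space M by fact
  note \<beta> = beta_distribution[OF ab]
  have "distr M borel X = density lborel (beta_density a b)"
  proof (rule real_distribution_eqI_moments)
    show "real_distribution (distr M borel X)" by simp
    show "AE x in distr M borel X. x \<in> {0..1}"
      using X01 by (subst AE_distr_iff) auto
    show "AE u in density lborel (beta_density a b). u \<in> {0..1}"
      using \<beta>(2) by eventually_elim auto
    show "(\<integral>x. x ^ n \<partial>distr M borel X) = (\<integral>u. u ^ n \<partial>density lborel (beta_density a b))" for n
      using mom[of n] by (simp add: \<beta>(3) integral_distr)
  qed (rule \<beta>)
  moreover have "distr M lborel X = distr M borel X"
    by (rule distr_cong) auto
  ultimately show ?thesis
    using ab by (simp add: has_beta_law_def distributed_def)
qed

lemma has_beta_law_moment: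
  assumes "has_beta_law M X a b"
  shows "(\<integral>x. X x ^ n \<partial>M) = pochhammer a n / pochhammer (a + b) n"
proof -
  have ab: "0 < a" "0 < b" and X: "distributed M lborel X (\<lambda>u. ennreal (beta_density a b u))"
    using assms by (auto simp: has_beta_law_def)
  have [measurable]: "X \<in> borel_measurable M"
    using distributed_measurable[OF X] by simp
  have "density lborel (beta_density a b) = distr M borel X"
    using distributed_distr_eq_density[OF X] by (subst distr_cong[of M M borel lborel X X]) auto
  then show ?thesis
    using beta_distribution(3)[OF ab, of n] by (simp add: integral_distr)
qed

text \<open>\<open>a i j\<close> stands for the expectation of \<open>X^i (1-X)^j\<close> and
  \<open>u j\<close> for that of \<open>Y^j\<close>. By the symmetries, \<open>a i (Suc j)\<close>
  splits between \<open>a (Suc i) (Suc j)\<close> and \<open>a i (j + 2)\<close> in the proportion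
  \<open>k i\<close> to \<open>1 + k j\<close>. Consistency of these splittings forces
  \<open>k\<close> to be an arithmetic progression.\<close>

lemma moment_recursion_arithmetic:
  fixes a :: "nat \<Rightarrow> nat \<Rightarrow> real" and u :: "nat \<Rightarrow> real"
  assumes a: "\<And>i j. 0 < a i j" "\<And>i j. a i j = a (Suc i) j + a i (Suc j)"
    and u: "\<And>j. 0 < u j" "\<And>j. u (Suc j) < u j"
    and sym1: "\<And>i j. a i (Suc j) * u j = a j (Suc i) * u i"
    and sym2: "\<And>i j. a i (j + 2) * (u j - u (Suc j)) = a j (i + 2) * (u i - u (Suc i))"
  obtains c y where "0 < c" "0 \<le> y"
    "\<And>i. u (Suc i) = u i * ((c + real i * y) / (1 + (c + real i * y)))"
    "\<And>i. a (Suc i) 1 = a i 1 * ((c + real i * y) / (1 + (c + real i * y) + c))"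
proof -
  define d where "d j = u j - u (Suc j)" for j
  define k where "k i = u (Suc i) / d i" for i
  have d: "d i > 0" for i using u(2)[of i] by (simp add: d_def)
  have k: "k i > 0" for i using d u(1) by (simp add: k_def)
  have ud: "u i = (1 + k i) * d i" "u (Suc i) = k i * d i" for i
  proof -
    show "u (Suc i) = k i * d i" using d[of i] by (simp add: k_def)
    then show "u i = (1 + k i) * d i" by (simp add: d_def algebra_simps)
  qed
  \<comment> \<open>Eliminates \<open>a j (i + 2)\<close> between \<open>sym1\<close> at
    \<open>(Suc i, j)\<close> and \<open>sym2\<close> at \<open>(i, j)\<close>.\<close>
  have ratio: "a (Suc i) (Suc j) * (1 + k j) = a i (j + 2) * k i" for i j
  proof -
    have "a (Suc i) (Suc j) * (1 + k j) * (d j * d i) = a (Suc i) (Suc j) * u j * d i"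
      by (simp add: ud(1)[of j])
    also have "\<dots> = a j (i + 2) * d i * u (Suc i)"
      using sym1[of "Suc i" j] by simp
    also have "\<dots> = a i (j + 2) * d j * u (Suc i)"
      using sym2[of i j] by (simp add: d_def)
    also have "\<dots> = a i (j + 2) * k i * (d j * d i)"
      by (simp add: ud(2)[of i])
    finally show ?thesis using d[of i] d[of j] by simp
  qed
  have sumk: "1 + k i + k j > 0" for i j using k[of i] k[of j] by simp
  have step1: "a (Suc i) (Suc j) = a i (Suc j) * (k i / (1 + k i + k j))" for i j
  proof -
    have "a i (Suc j) * k i = a (Suc i) (Suc j) * k i + a i (j + 2) * k i"
      using a(2)[of i "Suc j"] by (simp add: algebra_simps)
    also have "\<dots> = a (Suc i) (Suc j) * (1 + k i + k j)"
      using ratio[of i j] by (simp add: algebra_simps)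
    finally show ?thesis using sumk[of i j] by (simp add: field_simps)
  qed
  have step2: "a i (j + 2) = a i (Suc j) * ((1 + k j) / (1 + k i + k j))" for i j
  proof -
    have "a i (j + 2) = a i (Suc j) - a (Suc i) (Suc j)"
      using a(2)[of i "Suc j"] by simp
    then show ?thesis using sumk[of i j] by (simp add: step1 field_simps)
  qed
  \<comment> \<open>The exponents \<open>(i + 1, j + 2)\<close> are reached from
    \<open>(i, j + 1)\<close> by raising either exponent first; the two results must agree.\<close>
  have arith: "k (Suc i) + k j = k i + k (Suc j)" for i j
  proof -
    have "a (Suc i) (Suc (Suc j)) = a i (Suc j) * ((k i / (1 + k i + k j)) * ((1 + k j) / (1 + k (Suc i) + k j)))"
      using step2[of "Suc i" j] step1[of i j] by simp
    moreover have "a (Suc i) (Suc (Suc j)) = a i (Suc j) * (((1 + k j) / (1 + k i + k j)) * (k i / (1 + k i + k (Suc j))))"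
      using step1[of i "Suc j"] step2[of i j] by simp
    ultimately have "(k i / (1 + k i + k j)) * ((1 + k j) / (1 + k (Suc i) + k j)) =
      ((1 + k j) / (1 + k i + k j)) * (k i / (1 + k i + k (Suc j)))"
      using a(1)[of i "Suc j"] by (metis less_irrefl mult_left_cancel)
    then have "(k i * (1 + k j) / (1 + k i + k j)) / (1 + k (Suc i) + k j) = (k i * (1 + k j) / (1 + k i + k j)) / (1 + k i + k (Suc j))"
      by (simp add: field_simps)
    moreover have "k i * (1 + k j) / (1 + k i + k j) \<noteq> 0"
      using k[of i] k[of j] sumk[of i j] by simp
    ultimately have "1 + k (Suc i) + k j = 1 + k i + k (Suc j)"
      by (metis divide_cancel_left)
    then show ?thesis by simp
  qed
  define y where "y = k 1 - k 0"
  have ki: "k i = k 0 + real i * y" for i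
  proof (induction i)
    case (Suc i)
    then show ?case using arith[of i 0] by (simp add: y_def algebra_simps)
  qed simp
  \<comment> \<open>A negative difference would make \<open>k n\<close> negative for large
    \<open>n\<close>.\<close>
  have "y \<ge> 0"
  proof (rule ccontr)
    assume "\<not> 0 \<le> y"
    then obtain n where "real n * (- y) > k 0"
      using reals_Archimedean3[of "- y"] by auto
    with k[of n] show False by (simp add: ki[of n])
  qed
  then show ?thesis
  proof (rule that[OF k])
    show "u (Suc i) = u i * ((k 0 + real i * y) / (1 + (k 0 + real i * y)))" for i
      unfolding ki[symmetric] ud(1)[of i] ud(2)[of i] using k[of i] by simp
    show "a (Suc i) 1 = a i 1 * ((k 0 + real i * y) / (1 + (k 0 + real i * y) + k 0))" for i
      using step1[of i 0] unfolding ki[symmetric] by simp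
  qed
qed

lemma not_bounded_above_harmonic:
  assumes "0 < C" "0 < (A::real)"
  shows "\<exists>n. K < (\<Sum>i<n. C / (A + real i))"
proof (rule ccontr)
  assume *: "\<not> ?thesis"
  have "summable (\<lambda>i. C / (A + real i))"
    by (rule bounded_imp_summable[where B = K]) (use assms * in \<open>auto simp: not_less lessThan_Suc_atMost[symmetric] simp del: sum.lessThan_Suc\<close>)
  then have s: "summable (\<lambda>i. (1 / C) * (C / (A + real i)))"
    by (rule summable_mult)
  obtain m where m: "real m \<ge> A" using real_arch_simple by blast
  have "summable (\<lambda>i. inverse (of_nat (i + Suc m) :: real))"
  proof (rule summable_comparison_test'[OF s, of 0])
    fix i :: nat
    show "norm (inverse (real (i + Suc m))) \<le> 1 / C * (C / (A + real i))"
      using assms m by (simp add: field_simps)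
  qed
  then have "summable (\<lambda>i. inverse (of_nat i :: real))"
    by (subst (asm) summable_iff_shift)
  then show False using not_summable_harmonic[where 'a = real] by (simp add: inverse_eq_divide)
qed

text \<open>Here \<open>m i\<close> is a moment of \<open>X\<close> and \<open>b i\<close> the
  moment weighted by \<open>1 - X\<close>. The recursion fixes \<open>b\<close> up to the factor
  \<open>b 0\<close>, and the limit of \<open>m\<close> supplies the normalisation: the
  \<open>b i\<close> sum to 1. The solution is a beta law with first parameter \<open>A\<close> and
  parameter sum \<open>2 * A + B - 1\<close>, which requires \<open>1 < A + B\<close>.\<close>

lemma beta_moments_from_weighted:
  fixes m b :: "nat \<Rightarrow> real"
  assumes m: "m 0 = 1" "\<And>i. m i - m (Suc i) = b i" "m \<longlonglongrightarrow> 0" and b0: "0 < b 0" and AB: "0 < A" "0 < B"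
    and b: "\<And>i. b (Suc i) = b i * ((A + real i) / (2 * A + B + real i))"
  shows "1 < A + B" "m n = pochhammer A n / pochhammer (A + (A + B - 1)) n"
proof -
  have bpos: "b i > 0" for i
    by (induction i) (use b0 AB in \<open>auto simp: b intro!: mult_pos_pos divide_pos_pos\<close>)
  have msum: "(\<Sum>i<n. b i) = 1 - m n" for n
    using m(1) by (induction n) (simp_all add: m(2)[symmetric])
  have mpos: "m n \<ge> 0" for n
  proof (rule decseq_ge[OF _ m(3)], rule decseq_SucI)
    show "m (Suc n) \<le> m n" for n using m(2)[of n] bpos[of n] by simp
  qed
  show gt: "1 < A + B"
  proof (rule ccontr)
    assume "\<not> 1 < A + B"
    then have le: "A + B \<le> 1" by simp
    \<comment> \<open>If \<open>A + B \<le> 1\<close>, each ratio is at least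
      \<open>(A + i) / (A + 1 + i)\<close>, which telescopes. The \<open>b i\<close> then dominate a
      harmonic series although their sums are at most 1.\<close>
    have lb: "b 0 * A / (A + real i) \<le> b i" for i
    proof (induction i)
      case (Suc i)
      have "b 0 * A / (A + real (Suc i)) = b 0 * A / (A + real i) * ((A + real i) / (A + 1 + real i))"
      proof -
        have "A + real i > 0" "A + 1 + real i > 0" using AB by auto
        then show ?thesis by (simp add: add_ac)
      qed
      also have "\<dots> \<le> b i * ((A + real i) / (2 * A + B + real i))"
        using AB le bpos[of i] b0 by (intro mult_mono Suc divide_left_mono) auto
      finally show ?case by (simp add: b)
    qed (use AB in simp)
    obtain n where "1 < (\<Sum>i<n. b 0 * A / (A + real i))"
      using not_bounded_above_harmonic[of "b 0 * A" A 1] b0 AB by auto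
    also have "\<dots> \<le> (\<Sum>i<n. b i)" by (intro sum_mono lb)
    also have "\<dots> \<le> 1" using msum mpos[of n] by simp
    finally show False by simp
  qed
  define D where "D = 2 * A + B - 1"
  define v where "v n = pochhammer A n / pochhammer D n" for n
  have D: "D > A" "D > 0" using gt AB by (auto simp: D_def)
  have v: "v (Suc n) = v n * ((A + real n) / (D + real n))" "v 0 = 1" "v n > 0" for n
    using D AB by (auto simp: v_def pochhammer_Suc pochhammer_pos)
  have vdiff: "v n - v (Suc n) = v n * ((D - A) / (D + real n))" for n
    using D by (simp add: v(1) field_simps)
  \<comment> \<open>Forced by the case \<open>n = 0\<close> of \<open>bv\<close>; the limit in
    \<open>mK\<close> then gives \<open>K = 1\<close>.\<close>
  define K where "K = b 0 * D / (D - A)"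
  have bv: "b n = K * (v n - v (Suc n))" for n
  proof (induction n)
    case 0
    show ?case unfolding vdiff unfolding v(2) using D by (simp add: K_def)
  next
    case (Suc n)
    have "b (Suc n) = K * (v n * ((D - A) / (D + real n)) * ((A + real n) / (D + real (Suc n))))"
    proof -
      have "2 * A + B + real n = D + real (Suc n)" by (simp add: D_def)
      then show ?thesis by (simp only: b Suc vdiff mult_ac)
    qed
    also have "v n * ((D - A) / (D + real n)) * ((A + real n) / (D + real (Suc n))) = v (Suc n) * ((D - A) / (D + real (Suc n)))"
      by (simp add: v(1))
    finally show ?case by (simp only: vdiff)
  qed
  have mK: "1 - m n = K * (1 - v n)" for n
  proof -
    have "1 - m n = (\<Sum>i<n. K * (v i - v (Suc i)))" by (simp only: msum[symmetric] bv)
    also have "\<dots> = K * (1 - v n)"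
      by (simp only: sum_distrib_left[symmetric] sum_lessThan_telescope' v(2))
    finally show ?thesis .
  qed
  have "v \<longlonglongrightarrow> 0"
    using pochhammer_ratio_tendsto_0[of A "D - A"] D AB by (simp add: v_def[abs_def])
  then have "(\<lambda>n. K * (1 - v n)) \<longlonglongrightarrow> K * (1 - 0)" by (intro tendsto_intros)
  moreover have "(\<lambda>n. 1 - m n) \<longlonglongrightarrow> 1 - 0" by (intro tendsto_intros m)
  ultimately have "K = 1" unfolding mK using LIMSEQ_unique by fastforce
  with mK[of n] show "m n = pochhammer A n / pochhammer (A + (A + B - 1)) n"
    by (simp add: v_def D_def algebra_simps)
qed

section \<open>Possible laws of two consecutive sticks\<close>

context prob_space
begin

lemma integrable_beta_monomial:
  fixes X :: "'a \<Rightarrow> real"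
  assumes [measurable]: "X \<in> borel_measurable M" and X: "AE x in M. X x \<in> {0..1}"
  shows "integrable M (\<lambda>x. X x ^ i * (1 - X x) ^ j)"
  by (rule integrable_bounded_AE[where B = 1], simp, rule eventually_mono[OF X])
    (auto simp: abs_mult intro!: mult_le_one power_le_one)

lemma expectation_beta_monomial_pos:
  fixes X :: "'a \<Rightarrow> real"
  assumes [measurable]: "X \<in> borel_measurable M" and X: "AE x in M. X x \<in> {0..1}"
    and nz: "\<not> (AE x in M. X x = 0 \<or> X x = 1)"
  shows "0 < expectation (\<lambda>x. X x ^ i * (1 - X x) ^ j)"
proof -
  have nn: "AE x in M. 0 \<le> X x ^ i * (1 - X x) ^ j"
    by (rule eventually_mono[OF X]) auto
  have "expectation (\<lambda>x. X x ^ i * (1 - X x) ^ j) \<noteq> 0"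
  proof
    assume "expectation (\<lambda>x. X x ^ i * (1 - X x) ^ j) = 0"
    then have "AE x in M. X x ^ i * (1 - X x) ^ j = 0"
      by (subst (asm) integral_nonneg_eq_0_iff_AE[OF integrable_beta_monomial nn]) (use X in auto)
    then have "AE x in M. X x = 0 \<or> X x = 1"
      by (rule eventually_mono) auto
    with nz show False by simp
  qed
  with integral_nonneg_AE[OF nn] show ?thesis by simp
qed

text \<open>With geometric moments, the weighted expectation of \<open>(X - q)^2\<close> is
  \<open>K * q^2 - 2 * K * q^2 + K * q^2 = 0\<close>. For \<open>r = 1\<close> the weight is
  positive since \<open>X < 1\<close>.\<close>

lemma AE_const_moments:
  fixes X :: "'a \<Rightarrow> real"
  assumes [measurable]: "X \<in> borel_measurable M" and X: "AE x in M. X x \<in> {0..1}" "AE x in M. r = 1 \<longrightarrow> X x < 1"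
    and r: "r = 0 \<or> r = (1::nat)"
    and mom: "\<And>n. expectation (\<lambda>x. X x ^ n * (1 - X x) ^ r) = K * q ^ n"
  shows "AE x in M. X x = q"
proof -
  have i: "integrable M (\<lambda>x. X x ^ i * (1 - X x) ^ j)" for i j
    by (rule integrable_beta_monomial) (use X in auto)
  have sq: "(X x - q)^2 * (1 - X x) ^ r = X x ^ 2 * (1 - X x) ^ r - 2 * q * (X x ^ 1 * (1 - X x) ^ r) + q ^ 2 * (X x ^ 0 * (1 - X x) ^ r)" for x
    by (simp add: power2_eq_square algebra_simps)
  have int: "integrable M (\<lambda>x. (X x - q)^2 * (1 - X x) ^ r)"
    unfolding sq by (intro Bochner_Integration.integrable_add Bochner_Integration.integrable_diff integrable_mult_right i)
  have nn: "AE x in M. 0 \<le> (X x - q)^2 * (1 - X x) ^ r"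
    by (rule eventually_mono[OF X(1)]) auto
  have "expectation (\<lambda>x. (X x - q)^2 * (1 - X x) ^ r) = K * q^2 - 2 * q * (K * q ^ 1) + q ^ 2 * (K * q ^ 0)"
    unfolding sq
    by (subst Bochner_Integration.integral_add Bochner_Integration.integral_diff integral_mult_right_zero mom;
        (intro Bochner_Integration.integrable_add Bochner_Integration.integrable_diff integrable_mult_right i)?)+ simp
  also have "\<dots> = 0" by (simp add: power2_eq_square)
  finally have "AE x in M. (X x - q)^2 * (1 - X x) ^ r = 0"
    by (subst (asm) integral_nonneg_eq_0_iff_AE[OF int nn])
  with X(2) show ?thesis
    using r by (auto elim!: eventually_elim2 split: if_splits)
qed

text \<open>The moment recursion needs strict positivity, so the degenerate cases come first: if
  \<open>X\<close> vanishes, so does \<open>Y\<close>; otherwise a \<open>Y\<close> with values 0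
  and 1 must be 1 almost surely.\<close>

lemma deletion_pair_cases:
  fixes X Y :: "'a \<Rightarrow> real"
  assumes [measurable]: "X \<in> borel_measurable M" "Y \<in> borel_measurable M"
    and X01: "AE x in M. X x \<in> {0..1}" and X1: "AE x in M. X x < 1" and Y01: "AE x in M. Y x \<in> {0..1}"
    and sym1: "\<And>i j. expectation (\<lambda>x. X x ^ i * (1 - X x) ^ Suc j) * expectation (\<lambda>x. Y x ^ j)
      = expectation (\<lambda>x. X x ^ j * (1 - X x) ^ Suc i) * expectation (\<lambda>x. Y x ^ i)"
    and sym2: "\<And>i j. expectation (\<lambda>x. X x ^ i * (1 - X x) ^ (j + 2)) * expectation (\<lambda>x. Y x ^ j * (1 - Y x))
      = expectation (\<lambda>x. X x ^ j * (1 - X x) ^ (i + 2)) * expectation (\<lambda>x. Y x ^ i * (1 - Y x))"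
  obtains (zero) "AE x in M. X x = 0" "AE x in M. Y x = 0"
  | (one) "\<not> (AE x in M. X x = 0)" "AE x in M. Y x = 1"
  | (const) c where "2 < c" "AE x in M. X x = 1 / c" "AE x in M. Y x = 1 / (c - 1)"
  | (beta) A B where "0 < A" "0 < B" "1 < A + B" "has_beta_law M X A (A + B - 1)" "has_beta_law M Y A B"
proof -
  define a where "a i j = expectation (\<lambda>x. X x ^ i * (1 - X x) ^ j)" for i j
  define u where "u j = expectation (\<lambda>x. Y x ^ j)" for j
  have iX: "integrable M (\<lambda>x. X x ^ i * (1 - X x) ^ j)" for i j
    by (rule integrable_beta_monomial[OF _ X01]) simp
  have iY: "integrable M (\<lambda>x. Y x ^ i * (1 - Y x) ^ j)" for i j
    by (rule integrable_beta_monomial[OF _ Y01]) simp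
  have iY0: "integrable M (\<lambda>x. Y x ^ i)" for i
    using iY[of i 0] by simp
  have arec: "a i j = a (Suc i) j + a i (Suc j)" for i j
    unfolding a_def by (subst Bochner_Integration.integral_add[symmetric, OF iX iX])
      (auto intro!: Bochner_Integration.integral_cong simp: algebra_simps)
  have d: "expectation (\<lambda>x. Y x ^ j * (1 - Y x)) = u j - u (Suc j)" for j
    unfolding u_def by (subst Bochner_Integration.integral_diff[symmetric, OF iY0 iY0])
      (auto intro!: Bochner_Integration.integral_cong simp: algebra_simps)
  note sym1' = sym1[folded a_def u_def] and sym2' = sym2[folded a_def, unfolded d]
  have AE_eq0: "(AE x in M. Z x = 0)" if "expectation Z = 0" "integrable M Z" "AE x in M. 0 \<le> Z x" for Z :: "'a \<Rightarrow> real"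
    using that by (subst (asm) integral_nonneg_eq_0_iff_AE) auto
  show ?thesis
  proof (cases "AE x in M. X x = 0")
    case True
    \<comment> \<open>With \<open>X = 0\<close>, \<open>sym1\<close> at \<open>(0, 1)\<close> reads
      \<open>1 * u 1 = 0 * u 0\<close>.\<close>
    have "a 1 (Suc 0) = 0"
      unfolding a_def by (rule integral_eq_zero_AE, rule eventually_mono[OF True]) simp
    moreover have "a 0 2 = 1"
    proof -
      have "a 0 2 = expectation (\<lambda>_. 1)"
        unfolding a_def by (rule integral_cong_AE, simp, simp, rule eventually_mono[OF True]) simp
      then show ?thesis using prob_space by simp
    qed
    ultimately have "u 1 = 0" using sym1'[of 0 1] by (simp add: numeral_2_eq_2)
    then have "AE x in M. Y x ^ 1 = 0"
      unfolding u_def by (rule AE_eq0[OF _ iY0]) (rule eventually_mono[OF Y01], simp)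
    then show ?thesis using zero True by simp
  next
    case False
    have nX: "\<not> (AE x in M. X x = 0 \<or> X x = 1)"
    proof
      assume "AE x in M. X x = 0 \<or> X x = 1"
      with X1 have "AE x in M. X x = 0" by eventually_elim auto
      with False show False by simp
    qed
    have apos: "0 < a i j" for i j
      unfolding a_def by (rule expectation_beta_monomial_pos[OF _ X01 nX]) simp
    show ?thesis
    proof (cases "AE x in M. Y x = 0 \<or> Y x = 1")
      case True
      \<comment> \<open>Here \<open>Y * (1 - Y) = 0\<close>, so \<open>sym2\<close> at
        \<open>(1, 0)\<close> makes the expectation of \<open>1 - Y\<close> vanish. This excludes a
        proper mixture of 0 and 1.\<close>
      have "u 1 - u 2 = 0"
        unfolding numeral_2_eq_2 One_nat_def d[symmetric]
        by (rule integral_eq_zero_AE, rule eventually_mono[OF True]) auto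
      with sym2'[of 1 0] apos[of 1 2] have "u 0 - u (Suc 0) = 0" by (simp add: numeral_2_eq_2)
      then have "AE x in M. Y x ^ 0 * (1 - Y x) ^ 1 = 0"
        using d[of 0] by (intro AE_eq0[OF _ iY]) (auto intro!: eventually_mono[OF Y01])
      then show ?thesis using one False by (auto elim!: eventually_mono)
    next
      case nY: False
      have upos: "0 < u j" for j
        using expectation_beta_monomial_pos[OF _ Y01 nY, of j 0] by (simp add: u_def)
      have udec: "u (Suc j) < u j" for j
        using expectation_beta_monomial_pos[OF _ Y01 nY, of j 1] by (simp add: d)
      have u0: "u 0 = 1" by (simp add: u_def prob_space)
      obtain c y where cy: "0 < c" "0 \<le> y"
        and us: "\<And>i. u (Suc i) = u i * ((c + real i * y) / (1 + (c + real i * y)))"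
        and as: "\<And>i. a (Suc i) 1 = a i 1 * ((c + real i * y) / (1 + (c + real i * y) + c))"
        by (rule moment_recursion_arithmetic[OF apos arec upos udec sym1' sym2']) blast
      show ?thesis
      proof (cases "y = 0")
        case True
        have un: "u n = 1 * (c / (1 + c)) ^ n" for n
          by (induction n) (simp_all add: u0 us True)
        have an: "a n 1 = a 0 1 * (c / (1 + 2 * c)) ^ n" for n
          by (induction n) (simp_all add: as[simplified] True algebra_simps)
        have "AE x in M. Y x = c / (1 + c)"
          by (rule AE_const_moments[where r = 0 and K = 1]) (use Y01 un in \<open>auto simp: u_def\<close>)
        moreover have "AE x in M. X x = c / (1 + 2 * c)"
          by (rule AE_const_moments[where r = 1 and K = "a 0 1"]) (use X01 X1 an in \<open>auto simp: a_def\<close>)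
        \<comment> \<open>\<open>2 + 1 / c\<close> is the reciprocal of the value of
          \<open>X\<close>; it exceeds 2 because \<open>c\<close> is positive.\<close>
        moreover have "c / (1 + 2 * c) = 1 / (2 + 1 / c)" "c / (1 + c) = 1 / ((2 + 1 / c) - 1)"
          using cy by (auto simp: field_simps)
        ultimately show ?thesis using const[of "2 + 1 / c"] cy by simp
      next
        case False
        with cy have y: "y > 0" by simp
        \<comment> \<open>Dividing numerator and denominator of the recursions by \<open>y\<close>
          turns them into those of Pochhammer quotients.\<close>
        define A where "A = c / y"
        define B where "B = 1 / y"
        have AB: "A > 0" "B > 0" using y cy by (auto simp: A_def B_def)
        have un: "u n = pochhammer A n / pochhammer (A + B) n" for n
        proof (induction n)
          case (Suc n)
          have "(c + real n * y) / (1 + (c + real n * y)) = (A + real n) / (A + B + real n)"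
          proof -
            have "c + real n * y = y * (A + real n)" "1 + (c + real n * y) = y * (A + B + real n)"
              using y by (auto simp: A_def B_def field_simps)
            then show ?thesis using y by simp
          qed
          then show ?case by (simp add: us Suc pochhammer_Suc)
        qed (simp add: u0)
        have an: "a (Suc n) 1 = a n 1 * ((A + real n) / (2 * A + B + real n))" for n
        proof -
          have "c + real n * y = y * (A + real n)" "1 + (c + real n * y) + c = y * (2 * A + B + real n)"
            using y by (auto simp: A_def B_def field_simps)
          then have "(c + real n * y) / (1 + (c + real n * y) + c) = (A + real n) / (2 * A + B + real n)"
            using y by (simp only: mult_divide_mult_cancel_left[of y])
          then show ?thesis by (simp only: as)
        qed
        have lim: "(\<lambda>n. a n 0) \<longlonglongrightarrow> 0"
        proof -
          have "AE x in M. 0 \<le> X x \<and> X x < 1" using X01 X1 by eventually_elim auto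
          from power_expectation_tendsto_0[OF prob_space_axioms _ this] show ?thesis by (simp add: a_def)
        qed
        have a00: "a 0 0 = 1" by (simp add: a_def prob_space)
        have diff: "a i 0 - a (Suc i) 0 = a i 1" for i using arec[of i 0] by simp
        note bm = beta_moments_from_weighted[where m = "\<lambda>n. a n 0" and b = "\<lambda>n. a n 1", OF a00 diff lim apos AB an]
        have "has_beta_law M X A (A + B - 1)"
          by (rule has_beta_law_moments) (use bm AB X01 prob_space_axioms in \<open>auto simp: a_def\<close>)
        moreover have "has_beta_law M Y A B"
          by (rule has_beta_law_moments) (use un AB Y01 prob_space_axioms in \<open>auto simp: u_def\<close>)
        ultimately show ?thesis using beta AB bm(1) by blast
      qed
    qed
  qed
qed

end

section \<open>The deletion property\<close>

text \<open>The integrand of the moment formula for the EPPF, read along the sticks from index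
  \<open>s\<close> on.\<close>

fun stick_monomial :: "(nat \<Rightarrow> real) \<Rightarrow> nat \<Rightarrow> nat list \<Rightarrow> real" where
  "stick_monomial x s [] = 1"
| "stick_monomial x s (n # l) = x s ^ (n - 1) * (1 - x s) ^ sum_list l * stick_monomial x (Suc s) l"

lemma stick_monomial_cong:
  "(\<And>i. s \<le> i \<Longrightarrow> x i = y i) \<Longrightarrow> stick_monomial x s l = stick_monomial y s l"
  by (induction l arbitrary: s) auto

lemma stick_monomial_measurable [measurable]:
  assumes [measurable]: "\<And>i. (\<lambda>\<omega>. x \<omega> i) \<in> borel_measurable N"
  shows "(\<lambda>\<omega>. stick_monomial (x \<omega>) s l) \<in> borel_measurable N"
  by (induction l arbitrary: s) auto

lemma sum_list_add_one:
  assumes "i < length l"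
  shows "sum_list (l[i := Suc (l ! i)]) = Suc (sum_list l)"
  using assms by (subst sum_list_update) (auto simp: member_le_sum_list)

text \<open>The addition rule: a new element either forms a block of its own or joins an existing one.\<close>

lemma stick_monomial_addition_rule:
  assumes "\<forall>n\<in>set l. 1 \<le> n"
  shows "stick_monomial x s l =
    stick_monomial x s (l @ [1]) + (\<Sum>i<length l. stick_monomial x s (l[i := Suc (l ! i)]))"
  using assms
proof (induction l arbitrary: s)
  case (Cons n l)
  let ?A = "x s ^ (n - 1) * (1 - x s) ^ sum_list l"
  have pow: "x s ^ n = x s ^ (n - 1) * x s" using Cons.prems by (cases n) (auto simp: mult.commute)
  have "(\<Sum>i<length (n # l). stick_monomial x s ((n # l)[i := Suc ((n # l) ! i)]))
    = stick_monomial x s (Suc n # l) + (\<Sum>i<length l. stick_monomial x s (n # l[i := Suc (l ! i)]))"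
    by (simp add: sum.lessThan_Suc_shift del: sum.lessThan_Suc)
  also have "stick_monomial x s (Suc n # l) = ?A * x s * stick_monomial x (Suc s) l"
    by (simp add: pow)
  also have "(\<Sum>i<length l. stick_monomial x s (n # l[i := Suc (l ! i)]))
    = (\<Sum>i<length l. ?A * (1 - x s) * stick_monomial x (Suc s) (l[i := Suc (l ! i)]))"
    by (rule sum.cong[OF refl]) (simp add: sum_list_add_one)
  also have "\<dots> = ?A * (1 - x s) * (\<Sum>i<length l. stick_monomial x (Suc s) (l[i := Suc (l ! i)]))"
    by (simp only: sum_distrib_left)
  also have "\<dots> = ?A * (1 - x s) * (stick_monomial x (Suc s) l - stick_monomial x (Suc s) (l @ [1]))"
    using Cons.IH[of "Suc s"] Cons.prems by simp
  also have "?A * x s * stick_monomial x (Suc s) l + \<dots>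
    = ?A * stick_monomial x (Suc s) l - ?A * (1 - x s) * stick_monomial x (Suc s) (l @ [1])"
    by (simp add: algebra_simps)
  also have "\<dots> = stick_monomial x s (n # l) - stick_monomial x s ((n # l) @ [1])"
    by simp
  finally show ?case by simp
qed simp

definition stick_range :: "(nat \<Rightarrow> real) \<Rightarrow> bool" where
  "stick_range x \<longleftrightarrow> (\<forall>i. if \<exists>j<i. x j = 1 then x i = cemetery else x i \<in> {0..1})"

text \<open>After termination the entries are \<open>cemetery\<close>, so powers of -1 and 2 occur
  and the tail alone obeys no such bound. But if \<open>x s = 1\<close>, either the composition ends
  there, or \<open>1 - x s\<close> has a positive exponent and annihilates the tail.\<close>

lemma stick_monomial_bounds:
  assumes "stick_range x" "\<forall>j<s. x j \<noteq> 1" "\<forall>n\<in>set l. 1 \<le> n"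
  shows "0 \<le> stick_monomial x s l \<and> stick_monomial x s l \<le> 1"
  using assms(2-)
proof (induction l arbitrary: s)
  case (Cons n l)
  have xs: "0 \<le> x s" "x s \<le> 1" using assms(1) Cons.prems unfolding stick_range_def by (metis atLeastAtMost_iff)+
  show ?case
  proof (cases "x s = 1")
    case True
    show ?thesis
    proof (cases l)
      case (Cons n' l')
      then have "sum_list l \<noteq> 0" using \<open>\<forall>n\<in>set (n # l). 1 \<le> n\<close> by auto
      then obtain k where "sum_list l = Suc k" using not0_implies_Suc by blast
      then show ?thesis by (simp add: True)
    qed (use True in simp)
  next
    case False
    then have "0 \<le> stick_monomial x (Suc s) l \<and> stick_monomial x (Suc s) l \<le> 1"
      using Cons.prems by (intro Cons.IH) (auto simp: less_Suc_eq)
    then show ?thesis using xs by (auto intro!: mult_nonneg_nonneg mult_le_one power_le_one)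
  qed
qed simp

section \<open>Beta laws: uniqueness of parameters and mixed moments\<close>

lemma has_beta_law_AE:
  assumes "has_beta_law M X a b"
  shows "AE \<omega> in M. X \<omega> \<in> {0<..<1}"
proof -
  have ab: "0 < a" "0 < b" and X: "distributed M lborel X (\<lambda>u. ennreal (beta_density a b u))"
    using assms by (auto simp: has_beta_law_def)
  have [measurable]: "X \<in> borel_measurable M" using distributed_measurable[OF X] by simp
  have "AE u in distr M lborel X. u \<in> {0<..<1}"
    unfolding distributed_distr_eq_density[OF X] by (rule beta_distribution(2)[OF ab])
  then show ?thesis by (subst (asm) AE_distr_iff) auto
qed

lemma has_beta_law_first_moments:
  assumes "has_beta_law M X a b"
  shows "(\<integral>x. X x \<partial>M) = a / (a + b)" "(\<integral>x. X x ^ 2 \<partial>M) = a / (a + b) * ((a + 1) / (a + b + 1))"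
  using has_beta_law_moment[OF assms, of 1] has_beta_law_moment[OF assms, of 2]
  by (simp_all add: numeral_2_eq_2 pochhammer_Suc)

text \<open>Two moments suffice: the mean and the quotient of the second moment by the mean give two
  equations whose difference is \<open>b' = b\<close>.\<close>

lemma has_beta_law_unique:
  assumes "has_beta_law M X a b" "has_beta_law M X a' b'"
  shows "a = a'" "b = b'"
proof -
  have pos: "0 < a" "0 < b" "0 < a'" "0 < b'" using assms by (auto simp: has_beta_law_def)
  note 1 = has_beta_law_first_moments[OF assms(1)] and 2 = has_beta_law_first_moments[OF assms(2)]
  have e1: "a / (a + b) = a' / (a' + b')" using 1(1) 2(1) by simp
  have "a / (a + b) * ((a + 1) / (a + b + 1)) = a / (a + b) * ((a' + 1) / (a' + b' + 1))"
    using 1(2) 2(2) e1 by simp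
  moreover have "a / (a + b) \<noteq> 0" using pos by simp
  ultimately have e2: "(a + 1) / (a + b + 1) = (a' + 1) / (a' + b' + 1)"
    using mult_left_cancel by blast
  have f1: "a * b' = a' * b" using e1 pos by (simp add: field_simps)
  have f2: "(a + 1) * b' = (a' + 1) * b" using e2 pos by (simp add: field_simps)
  show "b = b'" using f1 f2 by (simp add: algebra_simps)
  then show "a = a'" using f1 pos by simp
qed

text \<open>For a constant the second moment is the square of the mean; for a beta law the quotients
  \<open>(a + 1) / (a + b + 1)\<close> and \<open>a / (a + b)\<close> differ.\<close>

lemma has_beta_law_not_const:
  assumes "prob_space M" "has_beta_law M X a b"
  shows "\<not> (AE \<omega> in M. X \<omega> = c)"
proof
  interpret prob_space M by fact
  assume c: "AE \<omega> in M. X \<omega> = c"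
  have pos: "0 < a" "0 < b" and X: "distributed M lborel X (\<lambda>u. ennreal (beta_density a b u))"
    using assms(2) by (auto simp: has_beta_law_def)
  have [measurable]: "X \<in> borel_measurable M" using distributed_measurable[OF X] by simp
  have "expectation X = expectation (\<lambda>_. c)" by (rule integral_cong_AE) (use c in auto)
  then have 1: "a / (a + b) = c" using has_beta_law_first_moments(1)[OF assms(2)] by (simp add: prob_space)
  have "expectation (\<lambda>x. X x ^ 2) = expectation (\<lambda>_. c ^ 2)"
    by (rule integral_cong_AE) (use c in \<open>auto elim!: eventually_mono\<close>)
  then have "a / (a + b) * ((a + 1) / (a + b + 1)) = c ^ 2"
    using has_beta_law_first_moments(2)[OF assms(2)] by (simp add: prob_space)
  then have "a / (a + b) * ((a + 1) / (a + b + 1)) = a / (a + b) * (a / (a + b))"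
    unfolding 1[symmetric] by (simp add: power2_eq_square)
  moreover have "a / (a + b) \<noteq> 0" using pos by simp
  ultimately have "(a + 1) / (a + b + 1) = a / (a + b)" using mult_left_cancel by blast
  then have "(a + 1) * (a + b) = a * (a + b + 1)" using pos by (simp add: field_simps)
  then show False using pos by (simp add: algebra_simps)
qed

text \<open>Induction on \<open>r\<close>: one factor \<open>1 - X\<close> is a difference of two
  moments with the smaller exponent \<open>r\<close>.\<close>

lemma has_beta_law_monomial:
  assumes "prob_space M" "has_beta_law M X a b"
  shows "(\<integral>x. X x ^ n * (1 - X x) ^ r \<partial>M) = pochhammer a n * pochhammer b r / pochhammer (a + b) (n + r)"
proof (induction r arbitrary: n)
  case 0
  then show ?case using has_beta_law_moment[OF assms(2)] by simp
next
  case (Suc r)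
  interpret prob_space M by fact
  have pos: "0 < a" "0 < b" and X: "distributed M lborel X (\<lambda>u. ennreal (beta_density a b u))"
    using assms(2) by (auto simp: has_beta_law_def)
  have [measurable]: "X \<in> borel_measurable M" using distributed_measurable[OF X] by simp
  have int: "integrable M (\<lambda>x. X x ^ n * (1 - X x) ^ r)" for n
    by (rule integrable_beta_monomial, simp, rule eventually_mono[OF has_beta_law_AE[OF assms(2)]]) auto
  have nz: "pochhammer (a + b) (n + r) > 0" "a + b + real (n + r) > 0" using pos by (auto intro: pochhammer_pos)
  have "expectation (\<lambda>x. X x ^ n * (1 - X x) ^ Suc r)
    = expectation (\<lambda>x. X x ^ n * (1 - X x) ^ r - X x ^ Suc n * (1 - X x) ^ r)"
    by (rule Bochner_Integration.integral_cong[OF refl]) (simp add: algebra_simps)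
  also have "\<dots> = pochhammer a n * pochhammer b r / pochhammer (a + b) (n + r)
      - pochhammer a (Suc n) * pochhammer b r / pochhammer (a + b) (Suc n + r)"
    by (subst Bochner_Integration.integral_diff[OF int int]) (simp only: Suc.IH)
  also have "\<dots> = pochhammer a n * pochhammer b r * ((a + b + real (n + r)) - (a + real n)) / (pochhammer (a + b) (n + r) * (a + b + real (n + r)))"
  proof -
    have frac: "N / D - N * t / (D * s) = N * (s - t) / (D * s)" if "0 < D" "0 < s" for N D s t :: real
      using that by (simp add: field_simps)
    have "pochhammer a (Suc n) * pochhammer b r = pochhammer a n * pochhammer b r * (a + real n)"
      "pochhammer (a + b) (Suc n + r) = pochhammer (a + b) (n + r) * (a + b + real (n + r))"
      by (simp_all add: pochhammer_Suc mult_ac)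
    then show ?thesis using frac[OF nz] by (simp only:)
  qed
  also have "\<dots> = pochhammer a n * pochhammer b (Suc r) / pochhammer (a + b) (n + Suc r)"
    by (simp add: pochhammer_Suc mult_ac)
  finally show ?case .
qed

section \<open>Expectations of stick monomials and the deletion step\<close>

locale stick_process = prob_space M for M :: "'a measure" +
  fixes V :: "nat \<Rightarrow> 'a \<Rightarrow> real"
  assumes V_measurable [measurable]: "\<And>i. V i \<in> borel_measurable M"
    and V_range: "AE \<omega> in M. stick_range (\<lambda>i. V i \<omega>)"
    and V0_less_1: "AE \<omega> in M. V 0 \<omega> < 1"
begin

definition mon :: "nat \<Rightarrow> nat list \<Rightarrow> 'a \<Rightarrow> real" where
  "mon s l \<omega> = stick_monomial (\<lambda>i. V i \<omega>) s l"

text \<open>In the application \<open>V i\<close> is \<open>W (Suc i)\<close>, so indices start at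
  0, and \<open>emon 0\<close> is the EPPF on compositions. Under independence
  \<open>emon (Suc s)\<close> is the function left after deletion of the first part in
  \<open>emon s\<close>.\<close>

definition emon :: "nat \<Rightarrow> nat list \<Rightarrow> real" where
  "emon s l = expectation (mon s l)"

definition moment :: "nat \<Rightarrow> nat \<Rightarrow> nat \<Rightarrow> real" where
  "moment s n r = expectation (\<lambda>\<omega>. V s \<omega> ^ n * (1 - V s \<omega>) ^ r)"

text \<open>No termination before index \<open>s\<close>. Then \<open>V s\<close> is a genuine value
  in the unit interval, and monomials from \<open>s\<close> on are bounded.\<close>

definition alive :: "nat \<Rightarrow> bool" where
  "alive s \<longleftrightarrow> (AE \<omega> in M. \<forall>i<s. V i \<omega> < 1)"

text \<open>Independence of \<open>V s\<close> and the later sticks, seen through moments alone. The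
  exponent of \<open>1 - V s\<close> is tied to the total of \<open>l\<close>, as in the
  EPPF.\<close>

definition deletion :: "nat \<Rightarrow> bool" where
  "deletion s \<longleftrightarrow> (\<forall>n l. is_composition l \<longrightarrow> emon s (Suc n # l) = moment s n (sum_list l) * emon (Suc s) l)"

definition symmetric_at :: "nat \<Rightarrow> bool" where
  "symmetric_at s \<longleftrightarrow> (\<forall>l l'. is_composition l \<and> mset l = mset l' \<longrightarrow> emon s l = emon s l')"

lemma mon_measurable [measurable]: "mon s l \<in> borel_measurable M"
  unfolding mon_def by measurable

lemma mon_Nil [simp]: "mon s [] = (\<lambda>\<omega>. 1)"
  by (simp add: mon_def[abs_def])

lemma mon_Cons: "mon s (n # l) = (\<lambda>\<omega>. V s \<omega> ^ (n - 1) * (1 - V s \<omega>) ^ sum_list l * mon (Suc s) l \<omega>)"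
  by (simp add: mon_def[abs_def])

lemma emon_Nil [simp]: "emon s [] = 1"
  using prob_space by (simp add: emon_def)

lemma emon_single: "emon s [Suc n] = moment s n 0"
  by (simp add: emon_def moment_def mon_Cons)

lemma alive_mono: "alive s \<Longrightarrow> t \<le> s \<Longrightarrow> alive t"
  unfolding alive_def by (erule eventually_mono) auto

lemma alive_1: "alive 1"
  using V0_less_1 by (simp add: alive_def)

lemma alive_Suc: "alive (Suc s) \<longleftrightarrow> alive s \<and> (AE \<omega> in M. V s \<omega> < 1)"
proof -
  have "(\<forall>i<Suc s. V i \<omega> < 1) \<longleftrightarrow> (\<forall>i<s. V i \<omega> < 1) \<and> V s \<omega> < 1" for \<omega>
    by (auto simp: less_Suc_eq)
  then show ?thesis by (simp only: alive_def AE_conj_iff)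
qed

lemma mon_bounds:
  assumes "alive s" "\<forall>n\<in>set l. 1 \<le> n"
  shows "AE \<omega> in M. 0 \<le> mon s l \<omega> \<and> mon s l \<omega> \<le> 1"
  using assms(1)[unfolded alive_def] V_range
proof eventually_elim
  fix \<omega> assume "\<forall>i<s. V i \<omega> < 1" "stick_range (\<lambda>i. V i \<omega>)"
  then show "0 \<le> mon s l \<omega> \<and> mon s l \<omega> \<le> 1"
    unfolding mon_def by (intro stick_monomial_bounds assms(2)) auto
qed

lemma V_bounds:
  assumes "alive s" shows "AE \<omega> in M. V s \<omega> \<in> {0..1}"
  using assms[unfolded alive_def] V_range
proof eventually_elim
  fix \<omega> assume 1: "\<forall>i<s. V i \<omega> < 1" and "stick_range (\<lambda>i. V i \<omega>)"
  then have "if \<exists>j<s. V j \<omega> = 1 then V s \<omega> = cemetery else V s \<omega> \<in> {0..1}"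
    unfolding stick_range_def by blast
  then show "V s \<omega> \<in> {0..1}" using 1 by (auto split: if_splits)
qed

lemma V_less_1: "alive (Suc s) \<Longrightarrow> AE \<omega> in M. V s \<omega> < 1"
  by (simp add: alive_Suc)

lemma integrable_moment:
  assumes "alive s" shows "integrable M (\<lambda>\<omega>. V s \<omega> ^ n * (1 - V s \<omega>) ^ r)"
  by (rule integrable_beta_monomial) (use V_bounds[OF assms] in auto)

lemma moment_pos:
  assumes "alive (Suc s)" shows "0 < moment s 0 r"
proof -
  have al: "alive s" using assms by (simp add: alive_Suc)
  have nn: "AE \<omega> in M. 0 \<le> V s \<omega> ^ 0 * (1 - V s \<omega>) ^ r"
    using V_bounds[OF al] by eventually_elim auto
  have "moment s 0 r \<noteq> 0"
  proof
    assume "moment s 0 r = 0"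
    then have "AE \<omega> in M. V s \<omega> ^ 0 * (1 - V s \<omega>) ^ r = 0"
      unfolding moment_def by (subst (asm) integral_nonneg_eq_0_iff_AE[OF integrable_moment[OF al] nn])
    with V_less_1[OF assms] have "AE \<omega> in M. False" by eventually_elim auto
    then show False by simp
  qed
  moreover have "moment s 0 r \<ge> 0" unfolding moment_def by (rule integral_nonneg_AE[OF nn])
  ultimately show ?thesis by simp
qed

lemma emon_Cons:
  assumes "deletion s" "\<forall>n\<in>set l. 1 \<le> n"
  shows "emon s (Suc n # l) = moment s n (sum_list l) * emon (Suc s) l"
proof (cases "l = []")
  case True
  then show ?thesis by (simp add: emon_single)
next
  case False
  then show ?thesis using assms unfolding deletion_def is_composition_def by blast
qed

text \<open>A part of size 1 is put in front. The factor it contributes is positive and depends on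
  \<open>l\<close> only through its total, so it cancels.\<close>

lemma symmetric_at_Suc:
  assumes al: "alive (Suc s)" and del: "deletion s" and sym: "symmetric_at s"
  shows "symmetric_at (Suc s)"
  unfolding symmetric_at_def
proof (intro allI impI, elim conjE)
  fix l l' assume l: "is_composition l" and ms: "mset l = mset l'"
  have set: "set l = set l'" using ms by (metis set_mset_mset)
  have sum: "sum_list l = sum_list l'" using ms by (metis sum_mset_sum_list)
  have "emon s (Suc 0 # l) = emon s (Suc 0 # l')"
    using sym l ms unfolding symmetric_at_def by (auto simp: is_composition_def)
  then have "moment s 0 (sum_list l) * emon (Suc s) l = moment s 0 (sum_list l) * emon (Suc s) l'"
    using l set sum by (subst (asm) (1 2) emon_Cons[OF del]) (auto simp: is_composition_def)
  then show "emon (Suc s) l = emon (Suc s) l'" using moment_pos[OF al, of "sum_list l"] by simp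
qed

lemma symmetric_atD:
  assumes "symmetric_at s" "\<forall>n\<in>set (a # b # l). 1 \<le> n"
  shows "emon s (a # b # l) = emon s (b # a # l)"
  using assms unfolding symmetric_at_def is_composition_def by auto

lemma pair_symmetry:
  assumes del: "deletion s" and sym: "symmetric_at s"
  shows "moment s i (Suc j) * moment (Suc s) j 0 = moment s j (Suc i) * moment (Suc s) i 0"
    "moment s i (j + 2) * moment (Suc s) j 1 = moment s j (i + 2) * moment (Suc s) i 1"
proof -
  have m1: "emon (Suc s) [Suc j, 1] = moment (Suc s) j 1" for j
    by (simp add: emon_def moment_def mon_Cons)
  show "moment s i (Suc j) * moment (Suc s) j 0 = moment s j (Suc i) * moment (Suc s) i 0"
    using symmetric_atD[OF sym, of "Suc i" "Suc j" "[]"] by (simp add: emon_Cons[OF del] emon_single)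
  show "moment s i (j + 2) * moment (Suc s) j 1 = moment s j (i + 2) * moment (Suc s) i 1"
  proof -
    have e: "emon s (Suc i # [Suc j, 1]) = moment s i (j + 2) * moment (Suc s) j 1" for i j
      using emon_Cons[OF del, of "[Suc j, 1]" i] by (simp add: m1[simplified])
    show ?thesis using symmetric_atD[OF sym, of "Suc i" "Suc j" "[1]"] unfolding e by simp
  qed
qed

text \<open>In the case \<open>one\<close> all moments of the next stick are 1, and the symmetry of
  two parts reduces to an equation for \<open>V s\<close> alone. It later locates the index of
  termination.\<close>

lemma deletion_cases:
  assumes al: "alive (Suc s)" and del: "deletion s" and sym: "symmetric_at s"
  obtains (zero) "AE \<omega> in M. V s \<omega> = 0" "AE \<omega> in M. V (Suc s) \<omega> = 0"
  | (one) "AE \<omega> in M. V (Suc s) \<omega> = 1" "moment s 1 1 = moment s 0 2"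
  | (const) c where "2 < c" "AE \<omega> in M. V s \<omega> = 1 / c" "AE \<omega> in M. V (Suc s) \<omega> = 1 / (c - 1)"
  | (beta) A B where "0 < A" "0 < B" "1 < A + B" "has_beta_law M (V s) A (A + B - 1)" "has_beta_law M (V (Suc s)) A B"
proof -
  have al': "alive s" using al by (simp add: alive_Suc)
  note sy = pair_symmetry[OF del sym]
  show ?thesis
  proof (rule deletion_pair_cases[of "V s" "V (Suc s)"])
    show "expectation (\<lambda>x. V s x ^ i * (1 - V s x) ^ Suc j) * expectation (\<lambda>x. V (Suc s) x ^ j)
      = expectation (\<lambda>x. V s x ^ j * (1 - V s x) ^ Suc i) * expectation (\<lambda>x. V (Suc s) x ^ i)" for i j
      using sy(1)[of i j] by (simp add: moment_def)
    show "expectation (\<lambda>x. V s x ^ i * (1 - V s x) ^ (j + 2)) * expectation (\<lambda>x. V (Suc s) x ^ j * (1 - V (Suc s) x))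
      = expectation (\<lambda>x. V s x ^ j * (1 - V s x) ^ (i + 2)) * expectation (\<lambda>x. V (Suc s) x ^ i * (1 - V (Suc s) x))" for i j
      using sy(2)[of i j] by (simp add: moment_def)
    assume Y1: "AE x in M. V (Suc s) x = 1"
    have "moment (Suc s) n 0 = 1" for n
    proof -
      have "moment (Suc s) n 0 = expectation (\<lambda>_. 1)"
        unfolding moment_def by (rule integral_cong_AE, simp, simp, rule eventually_mono[OF Y1]) simp
      then show ?thesis using prob_space by simp
    qed
    then show thesis using one[OF Y1] sy(1)[of 1 0] by (simp add: numeral_2_eq_2)
  qed (use V_bounds[OF al'] V_bounds[OF al] V_less_1[OF al] zero const beta in auto)
qed

text \<open>Termination at the next index has probability 0 or 1: in every case other than
  \<open>one\<close>, the next stick is below 1 almost surely.\<close>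

lemma next_alive_or_one:
  assumes al: "alive (Suc s)" and del: "deletion s" and sym: "symmetric_at s"
  shows "alive (Suc (Suc s)) \<or> (AE \<omega> in M. V (Suc s) \<omega> = 1)"
proof (rule deletion_cases[OF assms])
  assume "AE \<omega> in M. V (Suc s) \<omega> = 0"
  then have "AE \<omega> in M. V (Suc s) \<omega> < 1" by eventually_elim auto
  then show ?thesis using al by (simp add: alive_Suc[of "Suc s"])
next
  fix c :: real assume "2 < c" "AE \<omega> in M. V (Suc s) \<omega> = 1 / (c - 1)"
  then have "AE \<omega> in M. V (Suc s) \<omega> < 1" by (auto elim!: eventually_mono)
  then show ?thesis using al by (simp add: alive_Suc[of "Suc s"])
next
  fix A B assume "has_beta_law M (V (Suc s)) A B"
  then have "AE \<omega> in M. V (Suc s) \<omega> < 1" using has_beta_law_AE by (fastforce elim!: eventually_mono)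
  then show ?thesis using al by (simp add: alive_Suc[of "Suc s"])
qed simp

lemma integrable_moment_mon:
  assumes al: "alive (Suc s)" and l: "\<forall>n\<in>set l. 1 \<le> n"
  shows "integrable M (\<lambda>\<omega>. V s \<omega> ^ n * (1 - V s \<omega>) ^ r * mon (Suc s) l \<omega>)"
proof (rule integrable_bounded_AE[where B = 1])
  have al': "alive s" using al by (simp add: alive_Suc)
  show "AE \<omega> in M. \<bar>V s \<omega> ^ n * (1 - V s \<omega>) ^ r * mon (Suc s) l \<omega>\<bar> \<le> 1"
    using V_bounds[OF al'] mon_bounds[OF al l]
    by eventually_elim (auto simp: abs_mult intro!: mult_le_one power_le_one)
qed simp

text \<open>Interchanging parts of sizes 1 and \<open>j + 1\<close> in front of \<open>l\<close>
  relates the expectations of \<open>mon l\<close> weighted with exponents \<open>j\<close> and 0 of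
  the stick. The factor \<open>F j r\<close> depends on \<open>l\<close> only through its total
  \<open>r\<close>. The addition rule extends this to all totals up to \<open>r\<close>, down to the
  empty list, where the moments of the stick itself appear. So under the weight
  \<open>(1 - V)^r\<close> the monomial behaves like a constant.\<close>

lemma deletion_Suc:
  assumes al: "alive (Suc (Suc s))" and del: "deletion s" and sym: "symmetric_at s"
  shows "deletion (Suc s)"
proof -
  have al1: "alive (Suc s)" using al by (simp add: alive_Suc)
  define E where "E j r l = expectation (\<lambda>\<omega>. V (Suc s) \<omega> ^ j * (1 - V (Suc s) \<omega>) ^ r * mon (Suc (Suc s)) l \<omega>)" for j r l
  define F where "F j r = moment s j (Suc r) / moment s 0 (Suc j + r)" for j r
  have EF: "E j r l = F j r * E 0 r l" if l: "\<forall>n\<in>set l. 1 \<le> n" "sum_list l \<le> r" for j r l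
    using l
  proof (induction "r - sum_list l" arbitrary: l)
    case 0
    then have r: "r = sum_list l" by simp
    have em: "emon (Suc s) (Suc j # l) = E j r l" for j
      by (simp add: emon_def E_def mon_Cons r)
    have "moment s 0 (Suc j + r) * E j r l = moment s j (Suc r) * E 0 r l"
    proof -
      have "emon s (Suc 0 # Suc j # l) = moment s 0 (Suc j + r) * emon (Suc s) (Suc j # l)"
        "emon s (Suc j # Suc 0 # l) = moment s j (Suc r) * emon (Suc s) (Suc 0 # l)"
        using 0 by (simp_all add: emon_Cons[OF del] r)
      moreover have "emon s (Suc 0 # Suc j # l) = emon s (Suc j # Suc 0 # l)"
        by (rule symmetric_atD[OF sym]) (use 0 in simp)
      ultimately show ?thesis by (simp only: em)
    qed
    then show ?case using moment_pos[OF al1, of "Suc j + r"] by (simp add: F_def field_simps)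
  next
    \<comment> \<open>The addition rule writes the monomial as a sum over compositions with total
      larger by one; \<open>E\<close> is additive and \<open>F j r\<close> is the same for all of
      them.\<close>
    case (Suc d)
    have l1: "\<forall>n\<in>set (l @ [1]). 1 \<le> n" and l2: "\<And>i. i < length l \<Longrightarrow> \<forall>n\<in>set (l[i := Suc (l ! i)]). 1 \<le> n"
      using Suc.prems set_update_subset_insert[of l] by auto
    have int: "integrable M (\<lambda>\<omega>. V (Suc s) \<omega> ^ j * (1 - V (Suc s) \<omega>) ^ r * mon (Suc (Suc s)) l \<omega>)"
      if "\<forall>n\<in>set l. 1 \<le> n" for j l using integrable_moment_mon[OF al that] .
    have add: "E j r l = E j r (l @ [1]) + (\<Sum>i<length l. E j r (l[i := Suc (l ! i)]))" for j
    proof -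
      have "E j r l = expectation (\<lambda>\<omega>. V (Suc s) \<omega> ^ j * (1 - V (Suc s) \<omega>) ^ r * mon (Suc (Suc s)) (l @ [1]) \<omega>
        + (\<Sum>i<length l. V (Suc s) \<omega> ^ j * (1 - V (Suc s) \<omega>) ^ r * mon (Suc (Suc s)) (l[i := Suc (l ! i)]) \<omega>))"
        unfolding E_def mon_def
        by (subst stick_monomial_addition_rule[OF Suc.prems(1)]) (simp only: distrib_left sum_distrib_left)
      also have "\<dots> = E j r (l @ [1]) + (\<Sum>i<length l. E j r (l[i := Suc (l ! i)]))"
        unfolding E_def using int l1 l2
        by (subst Bochner_Integration.integral_add) (auto intro!: Bochner_Integration.integral_sum)
      finally show ?thesis .
    qed
    have "E j r (l @ [1]) = F j r * E 0 r (l @ [1])"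
      by (rule Suc.hyps(1)) (use Suc.hyps(2) l1 in auto)
    moreover have "E j r (l[i := Suc (l ! i)]) = F j r * E 0 r (l[i := Suc (l ! i)])" if "i < length l" for i
      by (rule Suc.hyps(1)) (use Suc.hyps(2) l2[OF that] in \<open>auto simp: sum_list_add_one[OF that]\<close>)
    ultimately show ?case
      unfolding add[of j] add[of 0] by (simp add: distrib_left sum_distrib_left)
  qed
  show ?thesis
    unfolding deletion_def
  proof (intro allI impI)
    fix n l assume l: "is_composition l"
    let ?r = "sum_list l" and ?V = "V (Suc s)" and ?g = "mon (Suc (Suc s)) l"
    have l': "\<forall>n\<in>set l. 1 \<le> n" using l by (simp add: is_composition_def)
    have E1: "E j ?r [] = moment (Suc s) j ?r" for j
      by (simp add: E_def moment_def)
    define A where "A = moment (Suc s) 0 ?r"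
    have A: "A > 0" unfolding A_def by (rule moment_pos[OF al])
    \<comment> \<open>Comparing \<open>EF\<close> for \<open>l\<close> and for the empty list
      eliminates \<open>F j r\<close>.\<close>
    define c where "c = E 0 ?r l / A"
    have Ec: "E j ?r l = c * moment (Suc s) j ?r" for j
      using EF[OF l' order.refl, of j] EF[of "[]" ?r j] A by (simp add: E1 c_def A_def)
    have gb: "AE \<omega> in M. 0 \<le> ?g \<omega> \<and> ?g \<omega> \<le> 1" by (rule mon_bounds[OF al l'])
    \<comment> \<open>Removing the weight yields the plain expectation of \<open>?g - c\<close>,
      which identifies \<open>c\<close> as \<open>emon (Suc (Suc s)) l\<close>.\<close>
    have "expectation (\<lambda>\<omega>. indicator UNIV (?V \<omega>) * (?g \<omega> - c)) = 0"
    proof (rule expectation_indicator_eq_0I_moments[where r = ?r and B = "1 + \<bar>c\<bar>"])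
      show "AE \<omega> in M. \<bar>?g \<omega> - c\<bar> \<le> 1 + \<bar>c\<bar>" using gb by eventually_elim auto
      fix j
      have "expectation (\<lambda>\<omega>. ?V \<omega> ^ j * (1 - ?V \<omega>) ^ ?r * (?g \<omega> - c))
        = expectation (\<lambda>\<omega>. ?V \<omega> ^ j * (1 - ?V \<omega>) ^ ?r * ?g \<omega> - c * (?V \<omega> ^ j * (1 - ?V \<omega>) ^ ?r))"
        by (rule Bochner_Integration.integral_cong[OF refl]) (simp add: algebra_simps)
      also have "\<dots> = E j ?r l - c * moment (Suc s) j ?r"
        unfolding E_def moment_def
        by (subst Bochner_Integration.integral_diff[OF integrable_moment_mon[OF al l']])
          (use integrable_moment[OF al1] in auto)
      finally show "expectation (\<lambda>\<omega>. ?V \<omega> ^ j * (1 - ?V \<omega>) ^ ?r * (?g \<omega> - c)) = 0" by (simp add: Ec)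
    qed (use V_bounds[OF al1] V_less_1[OF al] in auto)
    then have "expectation (\<lambda>\<omega>. ?g \<omega> - c) = 0" by simp
    moreover have "integrable M ?g"
      by (rule integrable_bounded_AE[where B = 1], simp, rule eventually_mono[OF gb]) auto
    ultimately have "c = emon (Suc (Suc s)) l" by (simp add: emon_def prob_space)
    moreover have "emon (Suc s) (Suc n # l) = E n ?r l"
      by (simp add: emon_def E_def mon_Cons)
    ultimately show "emon (Suc s) (Suc n # l) = moment (Suc s) n ?r * emon (Suc (Suc s)) l"
      by (simp add: Ec)
  qed
qed

end

section \<open>Mutual independence of the sticks\<close>

context stick_process
begin

lemma deletion_and_symmetry:
  assumes "deletion 0" "symmetric_at 0" "alive (Suc s)"
  shows "deletion s \<and> symmetric_at s"
  using assms(3)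
proof (induction s)
  case (Suc s)
  then have "alive (Suc s)" using alive_Suc[of "Suc s"] by blast
  with Suc show ?case using deletion_Suc symmetric_at_Suc by blast
qed (use assms in simp)

text \<open>Let \<open>s\<close> be the first index at which \<open>alive\<close> fails. It is at
  least 2 because \<open>V 0 < 1\<close>, and \<open>next_alive_or_one\<close> makes stick
  \<open>s - 1\<close> equal to 1 almost surely. So the index of termination is
  deterministic.\<close>

lemma alive_or_terminates:
  assumes "deletion 0" "symmetric_at 0"
  obtains "\<And>s. alive s" | t where "1 \<le> t" "alive t" "AE \<omega> in M. V t \<omega> = 1"
proof (cases "\<forall>s. alive s")
  case True
  then show ?thesis using that(1) by blast
next
  case False
  define s where "s = (LEAST s. \<not> alive s)"
  have s: "\<not> alive s" using False unfolding s_def by (metis LeastI)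
  have less: "alive i" if "i < s" for i using that not_less_Least unfolding s_def by blast
  have "s \<noteq> 0" using s by (metis alive_def less_zeroE eventually_True alive_mono alive_1 zero_le)
  moreover have "s \<noteq> 1" using s alive_1 by metis
  ultimately obtain t where t: "s = Suc (Suc t)" by (metis One_nat_def not0_implies_Suc)
  have al: "alive (Suc t)" using less[of "Suc t"] t by simp
  then have "AE \<omega> in M. V (Suc t) \<omega> = 1"
    using next_alive_or_one[OF al] deletion_and_symmetry[OF assms al] s t by blast
  then show ?thesis using that(2)[of "Suc t"] al by simp
qed

text \<open>From a deterministic termination on, all sticks are constants, 1 and then
  \<open>cemetery\<close>, and these do not disturb independence.\<close>

lemma terminated_const:
  assumes "AE \<omega> in M. V t \<omega> = 1" "t \<le> k"
  shows "\<exists>c. AE \<omega> in M. V k \<omega> = c"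
proof (cases "k = t")
  case False
  with assms(2) have "t < k" by simp
  have "AE \<omega> in M. V k \<omega> = cemetery"
    using assms(1) V_range
  proof eventually_elim
    fix \<omega> assume 1: "V t \<omega> = 1" and "stick_range (\<lambda>i. V i \<omega>)"
    then have "if \<exists>j<k. V j \<omega> = 1 then V k \<omega> = cemetery else V k \<omega> \<in> {0..1}"
      unfolding stick_range_def by blast
    moreover have "\<exists>j<k. V j \<omega> = 1" using 1 \<open>t < k\<close> by blast
    ultimately show "V k \<omega> = cemetery" by simp
  qed
  then show ?thesis by blast
qed (use assms in blast)

text \<open>The factor \<open>mon j l\<close> makes the induction close: the step for coordinate
  \<open>j\<close> needs the moments of \<open>V j\<close> together with the earlier indicators, and
  these are the instances for \<open>Suc n # l\<close>. Determinacy by moments then replaces powers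
  of \<open>V j\<close> by an indicator.\<close>

lemma expectation_rectangle_mon:
  assumes "deletion 0" "symmetric_at 0" "alive j" and A: "\<And>i. A i \<in> sets borel" and l: "\<forall>n\<in>set l. 1 \<le> n"
  shows "expectation (\<lambda>\<omega>. (\<Prod>i<j. indicator (A i) (V i \<omega>)) * mon j l \<omega>)
    = (\<Prod>i<j. prob {\<omega>\<in>space M. V i \<omega> \<in> A i}) * emon j l"
  using assms(3) l
proof (induction j arbitrary: l)
  case 0
  then show ?case by (simp add: emon_def)
next
  case (Suc j)
  have al: "alive j" using Suc.prems by (simp add: alive_Suc)
  have del: "deletion j" using deletion_and_symmetry[OF assms(1,2) Suc.prems(1)] by simp
  note [measurable] = A
  define H where "H \<omega> = (\<Prod>i<j. indicator (A i) (V i \<omega>) :: real)" for \<omega>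
  have [measurable]: "H \<in> borel_measurable M" unfolding H_def by measurable
  have H01: "0 \<le> H \<omega> \<and> H \<omega> \<le> 1" for \<omega>
    unfolding H_def by (auto intro!: prod_nonneg prod_le_1 simp: indicator_def)
  let ?V = "V j" and ?g = "mon (Suc j) l" and ?r = "sum_list l"
  define P where "P = (\<Prod>i<j. prob {\<omega>\<in>space M. V i \<omega> \<in> A i})"
  define c where "c = P * emon (Suc j) l"
  have gb: "AE \<omega> in M. 0 \<le> ?g \<omega> \<and> ?g \<omega> \<le> 1" by (rule mon_bounds[OF Suc.prems])
  have Hg: "AE \<omega> in M. 0 \<le> H \<omega> * ?g \<omega> \<and> H \<omega> * ?g \<omega> \<le> 1"
    using gb by (rule eventually_mono) (use H01 in \<open>auto intro!: mult_le_one\<close>)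
  have "expectation (\<lambda>\<omega>. indicator (A j) (?V \<omega>) * (H \<omega> * ?g \<omega> - c)) = 0"
  proof (rule expectation_indicator_eq_0I_moments[where r = ?r and B = "1 + \<bar>c\<bar>"])
    show "AE \<omega> in M. \<bar>H \<omega> * ?g \<omega> - c\<bar> \<le> 1 + \<bar>c\<bar>" using Hg by eventually_elim auto
    fix n
    have eq: "H \<omega> * mon j (Suc n # l) \<omega> = ?V \<omega> ^ n * (1 - ?V \<omega>) ^ ?r * (H \<omega> * ?g \<omega>)" for \<omega>
      by (simp add: mon_Cons mult_ac)
    have int: "integrable M (\<lambda>\<omega>. H \<omega> * mon j (Suc n # l) \<omega>)"
    proof (rule integrable_bounded_AE[where B = 1])
      have "AE \<omega> in M. 0 \<le> mon j (Suc n # l) \<omega> \<and> mon j (Suc n # l) \<omega> \<le> 1"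
        by (rule mon_bounds[OF al]) (use Suc.prems in simp)
      then show "AE \<omega> in M. \<bar>H \<omega> * mon j (Suc n # l) \<omega>\<bar> \<le> 1"
        by (rule eventually_mono) (use H01 in \<open>auto simp: abs_mult intro!: mult_le_one\<close>)
    qed simp
    have "expectation (\<lambda>\<omega>. ?V \<omega> ^ n * (1 - ?V \<omega>) ^ ?r * (H \<omega> * ?g \<omega> - c))
      = expectation (\<lambda>\<omega>. H \<omega> * mon j (Suc n # l) \<omega> - c * (?V \<omega> ^ n * (1 - ?V \<omega>) ^ ?r))"
      by (rule Bochner_Integration.integral_cong[OF refl]) (simp only: eq, simp add: right_diff_distrib mult_ac)
    also have "\<dots> = expectation (\<lambda>\<omega>. H \<omega> * mon j (Suc n # l) \<omega>) - c * moment j n ?r"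
      unfolding moment_def
      by (subst Bochner_Integration.integral_diff[OF int]) (use integrable_moment[OF al] in auto)
    also have "expectation (\<lambda>\<omega>. H \<omega> * mon j (Suc n # l) \<omega>) = P * emon j (Suc n # l)"
      unfolding H_def P_def by (rule Suc.IH[OF al]) (use Suc.prems in simp)
    also have "emon j (Suc n # l) = moment j n ?r * emon (Suc j) l"
      by (rule emon_Cons[OF del]) (use Suc.prems in simp)
    finally show "expectation (\<lambda>\<omega>. ?V \<omega> ^ n * (1 - ?V \<omega>) ^ ?r * (H \<omega> * ?g \<omega> - c)) = 0"
      by (simp add: c_def)
  qed (use V_bounds[OF al] V_less_1[OF Suc.prems(1)] A in auto)
  moreover have "expectation (\<lambda>\<omega>. indicator (A j) (?V \<omega>) * (H \<omega> * ?g \<omega> - c))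
    = expectation (\<lambda>\<omega>. indicator (A j) (?V \<omega>) * (H \<omega> * ?g \<omega>)) - c * prob {\<omega>\<in>space M. ?V \<omega> \<in> A j}"
  proof -
    have i1: "integrable M (\<lambda>\<omega>. indicator (A j) (?V \<omega>) * (H \<omega> * ?g \<omega>))"
      by (rule integrable_bounded_AE[where B = 1], simp, rule eventually_mono[OF Hg])
        (auto simp: indicator_def)
    have i2: "integrable M (\<lambda>\<omega>. c * indicator {\<omega>\<in>space M. ?V \<omega> \<in> A j} \<omega>)"
      by (intro integrable_mult_right integrable_real_indicator) (auto simp: less_top[symmetric])
    have "expectation (\<lambda>\<omega>. indicator (A j) (?V \<omega>) * (H \<omega> * ?g \<omega> - c))
      = expectation (\<lambda>\<omega>. indicator (A j) (?V \<omega>) * (H \<omega> * ?g \<omega>) - c * indicator {\<omega>\<in>space M. ?V \<omega> \<in> A j} \<omega>)"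
      by (rule Bochner_Integration.integral_cong[OF refl]) (auto simp: indicator_def algebra_simps)
    then show ?thesis using i1 i2 by (simp add: Bochner_Integration.integral_diff)
  qed
  ultimately have "expectation (\<lambda>\<omega>. indicator (A j) (?V \<omega>) * (H \<omega> * ?g \<omega>)) = c * prob {\<omega>\<in>space M. ?V \<omega> \<in> A j}"
    by simp
  then show ?case by (simp add: H_def P_def c_def mult_ac)
qed

text \<open>Up to the termination index this is \<open>expectation_rectangle_mon\<close> for the
  empty list; beyond it each new coordinate is constant, so its event is sure or impossible up to
  null sets.\<close>

lemma prob_rectangle:
  assumes "deletion 0" "symmetric_at 0" and A: "\<And>i. A i \<in> sets borel"
  shows "prob {\<omega>\<in>space M. \<forall>i<k. V i \<omega> \<in> A i} = (\<Prod>i<k. prob {\<omega>\<in>space M. V i \<omega> \<in> A i})"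
proof -
  note [measurable] = A
  have al: "prob {\<omega>\<in>space M. \<forall>i<j. V i \<omega> \<in> A i} = (\<Prod>i<j. prob {\<omega>\<in>space M. V i \<omega> \<in> A i})" if "alive j" for j
  proof -
    have ind: "(\<Prod>i<j. indicator (A i) (V i \<omega>) :: real) = indicator {\<omega>\<in>space M. \<forall>i<j. V i \<omega> \<in> A i} \<omega>" if "\<omega> \<in> space M" for \<omega>
    proof (cases "\<forall>i<j. V i \<omega> \<in> A i")
      case True
      then show ?thesis using that by simp
    next
      case False
      then show ?thesis using that by (auto simp: indicator_def intro!: prod_zero)
    qed
    have "expectation (\<lambda>\<omega>. (\<Prod>i<j. indicator (A i) (V i \<omega>)) * mon j [] \<omega>) = expectation (indicator {\<omega>\<in>space M. \<forall>i<j. V i \<omega> \<in> A i})"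
      by (rule Bochner_Integration.integral_cong[OF refl]) (simp add: ind)
    also have "\<dots> = prob {\<omega>\<in>space M. \<forall>i<j. V i \<omega> \<in> A i}" by simp
    finally show ?thesis using expectation_rectangle_mon[OF assms(1,2) that A, of "[]"] by simp
  qed
  show ?thesis
  proof (rule alive_or_terminates[OF assms(1,2)])
    assume "\<And>s. alive s"
    then show ?thesis by (rule al)
  next
    fix t assume t: "1 \<le> t" "alive t" "AE \<omega> in M. V t \<omega> = 1"
    show ?thesis
    proof (cases "k \<le> t")
      case True
      then show ?thesis using al alive_mono[OF t(2)] by blast
    next
      case False
      then have "t \<le> k" by simp
      then show ?thesis
      proof (induction rule: dec_induct)
        case base
        show ?case by (rule al[OF t(2)])
      next
        case (step k)
        obtain c where c: "AE \<omega> in M. V k \<omega> = c" using terminated_const[OF t(3) step(1)] by blast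
        have "prob {\<omega>\<in>space M. \<forall>i<Suc k. V i \<omega> \<in> A i} = prob {\<omega>\<in>space M. (\<forall>i<k. V i \<omega> \<in> A i) \<and> c \<in> A k}"
          by (rule finite_measure_eq_AE, rule eventually_mono[OF c]) (auto simp: less_Suc_eq)
        moreover have "prob {\<omega>\<in>space M. V k \<omega> \<in> A k} = prob {\<omega>\<in>space M. c \<in> A k}"
          by (rule finite_measure_eq_AE, rule eventually_mono[OF c]) auto
        ultimately show ?case using step(3) prob_space by (cases "c \<in> A k") auto
      qed
    qed
  qed
qed

lemma indep_vars_V:
  assumes "deletion 0" "symmetric_at 0"
  shows "indep_vars (\<lambda>_. borel) V UNIV"
  unfolding indep_vars_def2
proof (intro conjI ballI)
  show "indep_sets (\<lambda>i. {V i -` A \<inter> space M |A. A \<in> sets borel}) UNIV"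
  proof (rule indep_setsI)
    fix B J
    assume J: "J \<noteq> {}" "J \<subseteq> (UNIV :: nat set)" "finite J" and B: "\<forall>j\<in>J. B j \<in> {V j -` A \<inter> space M |A. A \<in> sets borel}"
    then obtain A where A: "\<And>j. j \<in> J \<Longrightarrow> B j = V j -` A j \<inter> space M" "\<And>j. j \<in> J \<Longrightarrow> A j \<in> sets borel"
      by (simp add: Bex_def) metis
    \<comment> \<open>Coordinates outside \<open>J\<close> are left free, which turns the finite
      intersection into a rectangle over an initial segment.\<close>
    define A' where "A' i = (if i \<in> J then A i else UNIV)" for i
    have A': "A' i \<in> sets borel" for i using A(2) by (simp add: A'_def)
    define N where "N = Suc (Max J)"
    have N: "j < N" if "j \<in> J" for j using J that by (simp add: N_def less_Suc_eq_le)
    have "(\<Inter>j\<in>J. B j) = {\<omega>\<in>space M. \<forall>i<N. V i \<omega> \<in> A' i}"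
      using J(1) N by (auto simp: A A'_def)
    then have "prob (\<Inter>j\<in>J. B j) = (\<Prod>i<N. prob {\<omega>\<in>space M. V i \<omega> \<in> A' i})"
      using prob_rectangle[OF assms A'] by simp
    also have "\<dots> = (\<Prod>j\<in>J. prob (B j))"
    proof (rule prod.mono_neutral_cong_right)
      show "J \<subseteq> {..<N}" using N by auto
      show "\<forall>i\<in>{..<N} - J. prob {\<omega>\<in>space M. V i \<omega> \<in> A' i} = 1" using prob_space by (simp add: A'_def)
      show "prob {\<omega>\<in>space M. V j \<omega> \<in> A' j} = prob (B j)" if "j \<in> J" for j
        using that A(1)[OF that] by (auto simp: A'_def intro!: arg_cong[where f = prob])
    qed simp
    finally show "prob (\<Inter>j\<in>J. B j) = (\<Prod>j\<in>J. prob (B j))" .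
  qed (auto intro: measurable_sets)
qed simp

end

section \<open>Deletion of the first part in the explicit EPPFs\<close>

lemma eppf_two_param_single:
  "eppf_two_param \<alpha> \<theta> [Suc n] = pochhammer (1 - \<alpha>) n / pochhammer (\<theta> + 1) n"
  by (simp add: eppf_two_param_def)

text \<open>The factor is the mixed moment of the beta law with parameters
  \<open>1 - \<alpha>\<close> and \<open>\<theta> + \<alpha>\<close>; deleting the first part shifts
  \<open>\<theta>\<close> to \<open>\<theta> + \<alpha>\<close>.\<close>

lemma eppf_two_param_Cons:
  assumes l: "is_composition l" and pos: "0 < \<theta> + \<alpha>"
  shows "eppf_two_param \<alpha> \<theta> (Suc n # l) = pochhammer (1 - \<alpha>) n * pochhammer (\<theta> + \<alpha>) (sum_list l) /
    pochhammer (\<theta> + 1) (n + sum_list l) * eppf_two_param \<alpha> (\<theta> + \<alpha>) l"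
proof -
  obtain k where k: "length l = Suc k" using l by (cases l) (auto simp: is_composition_def)
  obtain r where r: "sum_list l = Suc r" using l by (cases l) (auto simp: is_composition_def gr0_conv_Suc Suc_le_eq)
  have "(\<Prod>i\<in>{1..<length (Suc n # l)}. \<theta> + real i * \<alpha>) = (\<Prod>i\<in>{0..<Suc k}. \<theta> + real (Suc i) * \<alpha>)"
    by (simp only: k list.size(4) One_nat_def add_Suc_right add_0_right prod.shift_bounds_Suc_ivl)
  also have "\<dots> = (\<theta> + \<alpha>) * (\<Prod>i\<in>{1..<Suc k}. \<theta> + real (Suc i) * \<alpha>)"
    by (subst prod.atLeast_Suc_lessThan) simp_all
  also have "(\<Prod>i\<in>{1..<Suc k}. \<theta> + real (Suc i) * \<alpha>) = (\<Prod>i\<in>{1..<length l}. \<theta> + \<alpha> + real i * \<alpha>)"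
    unfolding k by (rule prod.cong) (simp_all add: algebra_simps)
  finally have 1: "(\<Prod>i\<in>{1..<length (Suc n # l)}. \<theta> + real i * \<alpha>) = (\<theta> + \<alpha>) * (\<Prod>i\<in>{1..<length l}. \<theta> + \<alpha> + real i * \<alpha>)" .
  have 2: "pochhammer (\<theta> + \<alpha>) (sum_list l) = (\<theta> + \<alpha>) * pochhammer (\<theta> + \<alpha> + 1) r"
    by (simp add: r pochhammer_rec)
  have 3: "pochhammer (\<theta> + \<alpha> + 1) r > 0" by (rule pochhammer_pos) (use pos in simp)
  show ?thesis
    unfolding eppf_two_param_def 1 2 using 3 by (simp add: r)
qed

text \<open>The factor is the mixed moment of the constant \<open>1 / Suc m\<close>; deleting the
  first part removes one coupon.\<close>

lemma eppf_coupon_Cons: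
  assumes l: "is_composition l"
  shows "eppf_coupon (Suc m) (Suc n # l) = (1 / real (Suc m)) ^ n * (1 - 1 / real (Suc m)) ^ sum_list l * eppf_coupon m l"
proof -
  have 1: "(\<Prod>i<length (Suc n # l). real (Suc m) - real i) = real (Suc m) * (\<Prod>i<length l. real m - real i)"
    by (simp add: prod.lessThan_Suc_shift del: prod.lessThan_Suc)
  obtain r where r: "sum_list l = Suc r" using l by (cases l) (auto simp: is_composition_def gr0_conv_Suc Suc_le_eq)
  have q: "1 - 1 / real (Suc m) = real m / real (Suc m)" by (simp add: field_simps)
  show ?thesis
  proof (cases "m = 0")
    \<comment> \<open>With a single coupon both sides vanish, because \<open>l\<close> is
      nonempty.\<close>
    case True
    obtain n' l' where "l = n' # l'" using l by (cases l) (auto simp: is_composition_def)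
    then show ?thesis unfolding eppf_coupon_def 1 q using True r by simp
  next
    case False
    have "S * P / S ^ (Suc n + k) = (1 / S) ^ n * (x / S) ^ k * (P / x ^ k)"
      if "0 < S" "0 < x" for S P x :: real and k
      using that by (simp add: power_divide power_add)
    from this[of "real (Suc m)" "real m"] False show ?thesis
      unfolding eppf_coupon_def 1 q sum_list.Cons by simp
  qed
qed

section \<open>Classification under the regularity condition\<close>

context stick_process
begin

lemma moment_const:
  assumes "AE \<omega> in M. V s \<omega> = c"
  shows "moment s n r = c ^ n * (1 - c) ^ r"
proof -
  have "moment s n r = expectation (\<lambda>_. c ^ n * (1 - c) ^ r)"
    unfolding moment_def by (rule integral_cong_AE, simp, simp, rule eventually_mono[OF assms]) simp
  then show ?thesis by (simp add: prob_space)
qed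

lemma emon_Cons_one:
  assumes "AE \<omega> in M. V s \<omega> = 1" "is_composition l"
  shows "emon s (n # l) = 0"
proof -
  obtain r where r: "sum_list l = Suc r" using assms(2) by (cases l) (auto simp: is_composition_def gr0_conv_Suc Suc_le_eq)
  have "emon s (n # l) = expectation (\<lambda>_. 0)"
    unfolding emon_def by (rule integral_cong_AE, simp, simp, rule eventually_mono[OF assms(1)]) (simp add: mon_Cons r)
  then show ?thesis by simp
qed

lemma AE_const_unique:
  assumes "AE \<omega> in M. V s \<omega> = a" "AE \<omega> in M. V s \<omega> = b"
  shows "a = b"
proof -
  have "AE \<omega> in M. a = b" using assms by eventually_elim simp
  then show ?thesis by simp
qed

text \<open>The composition \<open>(2, 2, 1)\<close> detects both degenerate cases: its first part
  needs a nonzero \<open>V 0\<close>, and its third part needs a second stick other than 1.\<close>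

lemma regular_cases:
  assumes del: "deletion 0" and sym: "symmetric_at 0" and reg: "0 < emon 0 [2, 2, 1]"
  obtains (const) c where "2 < c" "AE \<omega> in M. V 0 \<omega> = 1 / c"
  | (beta) A B where "0 < A" "0 < B" "1 < A + B" "has_beta_law M (V 0) A (A + B - 1)"
proof -
  have al: "alive (Suc 0)" using alive_1 by simp
  have e: "emon 0 [2, 2, 1] = moment 0 1 3 * emon 1 [2, 1]"
    using emon_Cons[OF del, of "[2, 1]" 1] by (simp add: numeral_2_eq_2 numeral_3_eq_3)
  show ?thesis
  proof (rule deletion_cases[OF al del sym])
    assume "AE \<omega> in M. V 0 \<omega> = 0"
    from moment_const[OF this, of 1 3] have "moment 0 1 3 = 0" by simp
    then show thesis using reg e by simp
  next
    assume 1: "AE \<omega> in M. V (Suc 0) \<omega> = 1"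
    have "emon 1 (2 # [1]) = 0" by (rule emon_Cons_one) (use 1 in \<open>auto simp: is_composition_def\<close>)
    then show thesis using reg e by simp
  qed (use const beta in auto)
qed

text \<open>While the process is alive, stick \<open>s\<close> equals \<open>1 / (c - s)\<close> and
  \<open>c - s > 1\<close>. This cannot last, so some stick \<open>t\<close> equals 1, and
  \<open>deletion_cases\<close> gives \<open>c = t + 1\<close>. Thus \<open>c\<close> is an integer,
  the number of coupons.\<close>

lemma const_case:
  assumes del: "deletion 0" and sym: "symmetric_at 0"
    and c: "2 < c" "AE \<omega> in M. V 0 \<omega> = 1 / c"
  obtains m where "3 \<le> m" "\<And>l. is_composition l \<Longrightarrow> emon 0 l = eppf_coupon m l"
    "\<And>i. i < m \<Longrightarrow> AE \<omega> in M. V i \<omega> = 1 / (real m - real i)"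
proof -
  have step: "2 < c - real s \<and> (AE \<omega> in M. V (Suc s) \<omega> = 1 / (c - real (Suc s))) \<or>
      c - real s = 2 \<and> (AE \<omega> in M. V (Suc s) \<omega> = 1)"
    if al: "alive (Suc s)" and V: "AE \<omega> in M. V s \<omega> = 1 / (c - real s)" and pos: "1 < c - real s" for s
  proof -
    have ds: "deletion s" "symmetric_at s" using deletion_and_symmetry[OF del sym al] by auto
    show ?thesis
    proof (rule deletion_cases[OF al ds])
      assume "AE \<omega> in M. V s \<omega> = 0"
      then show ?thesis using AE_const_unique[OF _ V, of 0] pos by simp
    next
      assume 1: "AE \<omega> in M. V (Suc s) \<omega> = 1" and m: "moment s 1 1 = moment s 0 2"
      \<comment> \<open>For a constant stick in the open unit interval, equality of the moments of
        \<open>V (1 - V)\<close> and \<open>(1 - V)^2\<close> means \<open>V = 1/2\<close>.\<close>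
      have "(1 / (c - real s)) * (1 - 1 / (c - real s)) = (1 - 1 / (c - real s)) * (1 - 1 / (c - real s))"
        using m by (simp add: moment_const[OF V] power2_eq_square)
      moreover have "1 - 1 / (c - real s) \<noteq> 0" using pos by simp
      ultimately have "1 / (c - real s) = 1 - 1 / (c - real s)" using mult_right_cancel by blast
      then have "c - real s = 2" using pos by (simp add: field_simps)
      then show ?thesis using 1 by simp
    next
      fix c' assume c': "2 < c'" "AE \<omega> in M. V s \<omega> = 1 / c'" "AE \<omega> in M. V (Suc s) \<omega> = 1 / (c' - 1)"
      have "1 / c' = 1 / (c - real s)" by (rule AE_const_unique[OF c'(2) V])
      then have "c' = c - real s" using c' pos by simp
      then have "2 < c - real s" and e: "c' - 1 = c - real (Suc s)" using c'(1) by simp_all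
      then show ?thesis using c'(3) unfolding e by blast
    next
      fix A B assume "has_beta_law M (V s) A (A + B - 1)"
      then show ?thesis using has_beta_law_not_const[OF prob_space_axioms] V by blast
    qed
  qed
  have val: "1 < c - real s \<and> (AE \<omega> in M. V s \<omega> = 1 / (c - real s))" if "alive (Suc s)" for s
    using that
  proof (induction s)
    case 0
    then show ?case using c by simp
  next
    case (Suc s)
    then have al: "alive (Suc s)" and lt: "AE \<omega> in M. V (Suc s) \<omega> < 1" using alive_Suc[of "Suc s"] by auto
    have IH: "1 < c - real s" "AE \<omega> in M. V s \<omega> = 1 / (c - real s)" using Suc.IH[OF al] by auto
    from step[OF al IH(2,1)] show ?case
    proof
      assume "c - real s = 2 \<and> (AE \<omega> in M. V (Suc s) \<omega> = 1)"
      then have "AE \<omega> in M. V (Suc s) \<omega> = 1" by simp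
      with lt have "AE \<omega> in M. False" by eventually_elim simp
      then show ?thesis by simp
    qed (auto simp: algebra_simps)
  qed
  show ?thesis
  proof (rule alive_or_terminates[OF del sym])
    assume al: "\<And>s. alive s"
    \<comment> \<open>A process that never stops would need \<open>c - n > 1\<close> for every
      \<open>n\<close>.\<close>
    obtain n where n: "c < real n" using reals_Archimedean2 by blast
    from val[OF al, of n] n show ?thesis by simp
  next
    fix t assume t: "1 \<le> t" "alive t" "AE \<omega> in M. V t \<omega> = 1"
    then obtain s where s: "t = Suc s" by (cases t) auto
    have al: "alive (Suc s)" using t s by simp
    have "c - real s = 2"
    proof -
      from step[OF al] val[OF al] have "2 < c - real s \<and> (AE \<omega> in M. V t \<omega> = 1 / (c - real t)) \<or> c - real s = 2"
        by (auto simp: s)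
      then show ?thesis
      proof
        assume *: "2 < c - real s \<and> (AE \<omega> in M. V t \<omega> = 1 / (c - real t))"
        then have "1 / (c - real t) = 1" using AE_const_unique t(3) by blast
        then show ?thesis using * s by (simp add: field_simps)
      qed
    qed
    then have ct: "c = real (Suc t)" using s by simp
    have V: "AE \<omega> in M. V i \<omega> = 1 / (real (Suc t) - real i)" if "i < Suc t" for i
    proof (cases "i = t")
      case False
      then have "alive (Suc i)" using that alive_mono[OF t(2)] by simp
      then show ?thesis using val[of i] ct by simp
    qed (use t in simp)
    have "emon i l = eppf_coupon (Suc t - i) l" if "i \<le> t" "is_composition l" for i l
      using that
    proof (induction "t - i" arbitrary: i l)
      case 0
      then have i: "i = t" by simp
      obtain n l' where l: "l = Suc n # l'" using 0 by (cases l) (auto simp: is_composition_def Suc_le_eq gr0_conv_Suc)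
      \<comment> \<open>Only one coupon is left: a single part has value 1, and a second part is
        impossible on both sides.\<close>
      show ?case
      proof (cases "l' = []")
        case True
        then show ?thesis using moment_const[OF t(3), of n 0] by (simp add: l i emon_single eppf_coupon_def)
      next
        case False
        then have l': "is_composition l'" using 0 l by (auto simp: is_composition_def)
        obtain a l'' where "l' = a # l''" using False by (cases l') auto
        then show ?thesis using emon_Cons_one[OF t(3) l', of "Suc n"]
          by (simp add: l i eppf_coupon_def prod.lessThan_Suc_shift del: prod.lessThan_Suc)
      qed
    next
      case (Suc d)
      then have it: "i < t" by simp
      then have al: "alive (Suc i)" using alive_mono[OF t(2)] by simp
      have deli: "deletion i" using deletion_and_symmetry[OF del sym al] by simp
      obtain n l' where l: "l = Suc n # l'" using Suc.prems by (cases l) (auto simp: is_composition_def Suc_le_eq gr0_conv_Suc)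
      have "real (Suc (t - i)) = real (Suc t) - real i" using it by (simp add: of_nat_diff)
      then have Vi: "AE \<omega> in M. V i \<omega> = 1 / real (Suc (t - i))" using V[of i] it by (simp only:)
      have St: "Suc t - i = Suc (t - i)" using it by simp
      show ?case
      proof (cases "l' = []")
        case True
        then show ?thesis unfolding St
          by (simp add: l emon_single moment_const[OF Vi] eppf_coupon_def power_divide del: of_nat_Suc)
      next
        case False
        then have l': "is_composition l'" using Suc.prems l by (auto simp: is_composition_def)
        have IH: "emon (Suc i) l' = eppf_coupon (t - i) l'"
          using Suc.hyps(1)[of "Suc i" l'] Suc.hyps(2) it l' by simp
        have "emon i l = moment i n (sum_list l') * emon (Suc i) l'"
          unfolding l by (rule emon_Cons[OF deli]) (use l' in \<open>simp add: is_composition_def\<close>)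
        then show ?thesis unfolding St l
          by (simp add: eppf_coupon_Cons[OF l'] IH moment_const[OF Vi] del: of_nat_Suc)
      qed
    qed
    from this[of 0] have "emon 0 l = eppf_coupon (Suc t) l" if "is_composition l" for l using that by simp
    moreover have "3 \<le> Suc t" using c(1) ct by simp
    ultimately show ?thesis using that[of "Suc t"] V by blast
  qed
qed

text \<open>The second beta parameters \<open>\<theta> + i * \<alpha>\<close> must stay positive
  while the process is alive. If it never stops, this excludes a negative \<open>\<alpha>\<close>.
  If stick \<open>t\<close> is 1, the equation from \<open>deletion_cases\<close> gives
  \<open>\<theta> = - (t + 1) * \<alpha>\<close>, and positivity one step earlier makes
  \<open>\<alpha>\<close> negative.\<close>

lemma beta_case:
  assumes del: "deletion 0" and sym: "symmetric_at 0"
    and AB: "0 < A" "0 < B" "1 < A + B" "has_beta_law M (V 0) A (A + B - 1)"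
  obtains (infinite) \<alpha> \<theta> where "0 \<le> \<alpha>" "\<alpha> < 1" "- \<alpha> < \<theta>"
    "\<And>l. is_composition l \<Longrightarrow> emon 0 l = eppf_two_param \<alpha> \<theta> l"
    "\<And>i. has_beta_law M (V i) (1 - \<alpha>) (\<theta> + real (Suc i) * \<alpha>)"
  | (finite) \<alpha> \<theta> t where "\<alpha> < 0" "\<theta> = - real (Suc t) * \<alpha>"
    "\<And>l. is_composition l \<Longrightarrow> emon 0 l = eppf_two_param \<alpha> \<theta> l"
    "\<And>i. i < t \<Longrightarrow> has_beta_law M (V i) (1 - \<alpha>) (\<theta> + real (Suc i) * \<alpha>)"
    "AE \<omega> in M. V t \<omega> = 1"
proof -
  define \<alpha> where "\<alpha> = 1 - A"
  \<comment> \<open>The solution of \<open>A + B - 1 = \<theta> + \<alpha>\<close> with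
    \<open>A = 1 - \<alpha>\<close>.\<close>
  define \<theta> where "\<theta> = B - 2 * \<alpha>"
  have step: "has_beta_law M (V (Suc s)) (1 - \<alpha>) (\<theta> + real (Suc (Suc s)) * \<alpha>) \<or>
      \<theta> + real (Suc s) * \<alpha> = - \<alpha> \<and> (AE \<omega> in M. V (Suc s) \<omega> = 1)"
    if al: "alive (Suc s)" and V: "has_beta_law M (V s) (1 - \<alpha>) (\<theta> + real (Suc s) * \<alpha>)" for s
  proof -
    have ds: "deletion s" "symmetric_at s" using deletion_and_symmetry[OF del sym al] by auto
    have pos: "0 < 1 - \<alpha>" "0 < \<theta> + real (Suc s) * \<alpha>" using V by (auto simp: has_beta_law_def)
    show ?thesis
    proof (rule deletion_cases[OF al ds])
      assume "AE \<omega> in M. V s \<omega> = 0"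
      then show ?thesis using has_beta_law_not_const[OF prob_space_axioms V] by blast
    next
      assume 1: "AE \<omega> in M. V (Suc s) \<omega> = 1" and m: "moment s 1 1 = moment s 0 2"
      define a b where "a = 1 - \<alpha>" and "b = \<theta> + real (Suc s) * \<alpha>"
      have ab: "0 < a" "0 < b" using pos by (auto simp: a_def b_def)
      \<comment> \<open>Equality of the moments of \<open>V (1 - V)\<close> and
        \<open>(1 - V)^2\<close> forces \<open>a = b + 1\<close>, that is,
        \<open>\<theta> + (s + 1) * \<alpha> = - \<alpha>\<close>.\<close>
      have "a * b / pochhammer (a + b) 2 = b * (b + 1) / pochhammer (a + b) 2"
        using m unfolding moment_def has_beta_law_monomial[OF prob_space_axioms V]
        by (simp add: a_def b_def numeral_2_eq_2 pochhammer_Suc)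
      moreover have "pochhammer (a + b) 2 > 0" by (rule pochhammer_pos) (use ab in simp)
      ultimately have "b * a = b * (b + 1)" by simp
      then have "a = b + 1" using ab by simp
      then show ?thesis using 1 by (simp add: a_def b_def)
    next
      fix c' assume "AE \<omega> in M. V s \<omega> = 1 / c'"
      then show ?thesis using has_beta_law_not_const[OF prob_space_axioms V] by blast
    next
      fix A' B' assume A': "has_beta_law M (V s) A' (A' + B' - 1)" "has_beta_law M (V (Suc s)) A' B'"
      have eq: "A' = 1 - \<alpha>" "A' + B' - 1 = \<theta> + real (Suc s) * \<alpha>"
        using has_beta_law_unique[OF A'(1) V] by auto
      then have "B' = \<theta> + real (Suc (Suc s)) * \<alpha>" by (simp add: algebra_simps)
      then show ?thesis using A'(2) eq(1) by simp
    qed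
  qed
  have law: "has_beta_law M (V s) (1 - \<alpha>) (\<theta> + real (Suc s) * \<alpha>)" if "alive (Suc s)" for s
    using that
  proof (induction s)
    case 0
    have "A + B - 1 = \<theta> + real (Suc 0) * \<alpha>" "A = 1 - \<alpha>" by (simp_all add: \<theta>_def \<alpha>_def)
    then show ?case using AB(4) by (simp only:)
  next
    case (Suc s)
    then have al: "alive (Suc s)" and lt: "AE \<omega> in M. V (Suc s) \<omega> < 1" using alive_Suc[of "Suc s"] by auto
    from step[OF al Suc.IH[OF al]] show ?case
    proof
      assume "\<theta> + real (Suc s) * \<alpha> = - \<alpha> \<and> (AE \<omega> in M. V (Suc s) \<omega> = 1)"
      then have "AE \<omega> in M. V (Suc s) \<omega> = 1" by simp
      with lt have "AE \<omega> in M. False" by eventually_elim simp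
      then show ?thesis by simp
    qed
  qed
  have pos: "0 < \<theta> + real (Suc s) * \<alpha>" if "alive (Suc s)" for s
    using law[OF that] by (simp add: has_beta_law_def)
  have a1: "\<alpha> < 1" using AB(1) by (simp add: \<alpha>_def)
  have al0: "alive (Suc 0)" using alive_1 by simp
  \<comment> \<open>Each deletion shifts \<open>\<theta>\<close> by \<open>\<alpha>\<close>, so
    \<open>emon s\<close> is matched with parameters \<open>\<alpha>\<close> and
    \<open>\<theta> + s * \<alpha>\<close>.\<close>
  have rec: "emon s (Suc n # l) = eppf_two_param \<alpha> (\<theta> + real s * \<alpha>) (Suc n # l)"
    if al: "alive (Suc s)" and l: "l = [] \<or> is_composition l \<and> emon (Suc s) l = eppf_two_param \<alpha> (\<theta> + real (Suc s) * \<alpha>) l" for s n l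
  proof -
    have d: "deletion s" using deletion_and_symmetry[OF del sym al] by simp
    have m: "moment s n r = pochhammer (1 - \<alpha>) n * pochhammer (\<theta> + real s * \<alpha> + \<alpha>) r / pochhammer (\<theta> + real s * \<alpha> + 1) (n + r)" for n r
      unfolding moment_def has_beta_law_monomial[OF prob_space_axioms law[OF al]] by (simp add: algebra_simps)
    show ?thesis
    proof (cases "l = []")
      case True
      then show ?thesis by (simp add: emon_single m eppf_two_param_single)
    next
      case False
      then have l': "is_composition l" "emon (Suc s) l = eppf_two_param \<alpha> (\<theta> + real (Suc s) * \<alpha>) l" using l by auto
      have "0 < \<theta> + real s * \<alpha> + \<alpha>" using pos[OF al] by (simp add: algebra_simps)
      moreover have "\<theta> + real (Suc s) * \<alpha> = \<theta> + real s * \<alpha> + \<alpha>" by (simp add: algebra_simps)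
      moreover have "emon s (Suc n # l) = moment s n (sum_list l) * emon (Suc s) l"
        by (rule emon_Cons[OF d]) (use l' in \<open>simp add: is_composition_def\<close>)
      ultimately show ?thesis using l' by (simp only: m eppf_two_param_Cons)
    qed
  qed
  show ?thesis
  proof (rule alive_or_terminates[OF del sym])
    assume al: "\<And>s. alive s"
    have "0 \<le> \<alpha>"
    proof (rule ccontr)
      assume "\<not> 0 \<le> \<alpha>"
      then obtain n where n: "\<theta> < real n * (- \<alpha>)" using reals_Archimedean3[of "- \<alpha>"] by auto
      have "\<theta> + real (Suc n) * \<alpha> < 0" using n \<open>\<not> 0 \<le> \<alpha>\<close> by (simp add: algebra_simps)
      then show False using pos[OF al, of n] by simp
    qed
    have "- \<alpha> < \<theta>" using pos[OF al0] by simp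
    have emon_eq: "emon s l = eppf_two_param \<alpha> (\<theta> + real s * \<alpha>) l" if "is_composition l" for s l
      using that
    proof (induction l arbitrary: s)
      case (Cons n l)
      then obtain n' where n: "n = Suc n'" by (cases n) (auto simp: is_composition_def)
      show ?case unfolding n
        by (rule rec[OF al]) (use Cons in \<open>auto simp: is_composition_def\<close>)
    qed (simp add: is_composition_def)
    have "emon 0 l = eppf_two_param \<alpha> \<theta> l" if "is_composition l" for l using emon_eq[OF that, of 0] by simp
    with \<open>0 \<le> \<alpha>\<close> \<open>- \<alpha> < \<theta>\<close> show ?thesis using infinite a1 law[OF al] by blast
  next
    fix t assume t: "1 \<le> t" "alive t" "AE \<omega> in M. V t \<omega> = 1"
    then obtain s where s: "t = Suc s" by (cases t) auto
    have al: "alive (Suc s)" using t s by simp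
    have not_beta: "\<not> has_beta_law M (V t) a b" for a b
      using has_beta_law_not_const[OF prob_space_axioms] t(3) by blast
    have \<theta>t: "\<theta> + real t * \<alpha> = - \<alpha>" using step[OF al law[OF al]] not_beta s by auto
    have "\<alpha> < 0" using pos[OF al] \<theta>t s by simp
    moreover have "\<theta> = - real (Suc t) * \<alpha>" using \<theta>t by (simp add: algebra_simps)
    moreover have "has_beta_law M (V i) (1 - \<alpha>) (\<theta> + real (Suc i) * \<alpha>)" if "i < t" for i
      by (rule law) (use alive_mono[OF t(2)] that in simp)
    moreover have "emon i l = eppf_two_param \<alpha> (\<theta> + real i * \<alpha>) l" if "i \<le> t" "is_composition l" for i l
      using that
    proof (induction "t - i" arbitrary: i l)
      case 0
      then have i: "i = t" by simp
      obtain n l' where l: "l = Suc n # l'" using 0 by (cases l) (auto simp: is_composition_def Suc_le_eq gr0_conv_Suc)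
      show ?case
      proof (cases "l' = []")
        case True
        have "pochhammer (1 - \<alpha>) n > 0" by (rule pochhammer_pos) (use a1 in simp)
        \<comment> \<open>At the last stick the two Pochhammer symbols of a single part coincide, in
          agreement with \<open>V t = 1\<close>.\<close>
        moreover have "\<theta> + real t * \<alpha> + 1 = 1 - \<alpha>" using \<theta>t by simp
        ultimately show ?thesis unfolding l i True eppf_two_param_single emon_single moment_const[OF t(3)]
          by simp
      next
        case False
        then have l': "is_composition l'" using 0 l by (auto simp: is_composition_def)
        \<comment> \<open>The factor with \<open>j = 1\<close> is
          \<open>\<theta> + (t + 1) * \<alpha> = 0\<close>.\<close>
        have "(\<Prod>j\<in>{1..<length l}. \<theta> + real t * \<alpha> + real j * \<alpha>) = 0"
          by (rule prod_zero) (use \<theta>t False in \<open>auto simp: l intro!: bexI[of _ 1] simp: Suc_le_eq\<close>)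
        then show ?thesis using emon_Cons_one[OF t(3) l', of "Suc n"] by (simp add: l i eppf_two_param_def)
      qed
    next
      case (Suc d)
      then have it: "i < t" by simp
      then have al: "alive (Suc i)" using alive_mono[OF t(2)] by simp
      obtain n l' where l: "l = Suc n # l'" using Suc.prems by (cases l) (auto simp: is_composition_def Suc_le_eq gr0_conv_Suc)
      have IH: "l' = [] \<or> is_composition l' \<and> emon (Suc i) l' = eppf_two_param \<alpha> (\<theta> + real (Suc i) * \<alpha>) l'"
        using Suc.hyps(1)[of "Suc i" l'] Suc.hyps(2) it Suc.prems(2) l by (auto simp: is_composition_def)
      show ?case unfolding l by (rule rec[OF al IH])
    qed
    from this[of 0] have "emon 0 l = eppf_two_param \<alpha> \<theta> l" if "is_composition l" for l using that by simp
    ultimately show ?thesis using finite t(3) by blast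
  qed
qed

end

section \<open>Independence and the two-parameter family\<close>

lemma (in prob_space) indep_vars_reindex:
  assumes inj: "inj_on f I" and ind: "indep_vars (\<lambda>_. N) X (f ` I)"
  shows "indep_vars (\<lambda>_. N) (\<lambda>i. X (f i)) I"
  unfolding indep_vars_def2
proof (intro conjI ballI)
  show "random_variable N (X (f i))" if "i \<in> I" for i
    using ind that by (auto simp: indep_vars_def2)
  have sets: "indep_sets (\<lambda>i. {X i -` A \<inter> space M |A. A \<in> sets N}) (f ` I)"
    using ind by (simp add: indep_vars_def2)
  show "indep_sets (\<lambda>i. {X (f i) -` A \<inter> space M |A. A \<in> sets N}) I"
  proof (rule indep_setsI)
    show "{X (f i) -` A \<inter> space M |A. A \<in> sets N} \<subseteq> events" if "i \<in> I" for i
      using sets that unfolding indep_sets_def by blast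
    fix A J
    assume J: "J \<noteq> {}" "J \<subseteq> I" "finite J" and A: "\<forall>j\<in>J. A j \<in> {X (f j) -` A \<inter> space M |A. A \<in> sets N}"
    have injJ: "inj_on f J" by (rule inj_on_subset[OF inj J(2)])
    define g where "g = the_inv_into J f"
    have g: "g (f j) = j" if "j \<in> J" for j unfolding g_def by (rule the_inv_into_f_f[OF injJ that])
    have "prob (\<Inter>i\<in>f ` J. A (g i)) = (\<Prod>i\<in>f ` J. prob (A (g i)))"
    proof (rule indep_setsD[OF sets])
      show "\<forall>i\<in>f ` J. A (g i) \<in> {X i -` A \<inter> space M |A. A \<in> sets N}"
      proof
        fix i assume "i \<in> f ` J"
        then obtain j where j: "j \<in> J" "i = f j" by blast
        then show "A (g i) \<in> {X i -` A \<inter> space M |A. A \<in> sets N}" using A g by simp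
      qed
    qed (use J in auto)
    then show "prob (\<Inter>j\<in>J. A j) = (\<Prod>j\<in>J. prob (A j))"
      using g by (simp add: prod.reindex[OF injJ])
  qed
qed

text \<open>The stick-breaking frequencies are substituted into the product of
  \<open>Q_i^(n_i - 1)\<close> and the remaining masses. The induction lets the first stick
  \<open>s\<close> vary; the mass left before it then collects the exponent
  \<open>sum_list l - 1\<close>, one from each element except the first.\<close>

lemma stick_monomial_eq_prod:
  assumes "is_composition l"
  shows "(\<Prod>i<length l. (x (s + i) * (\<Prod>j<s + i. 1 - x j)) ^ (l ! i - 1)) * (\<Prod>i<length l - 1. \<Prod>j<Suc (s + i). 1 - x j)
    = (\<Prod>j<s. 1 - x j) ^ (sum_list l - 1) * stick_monomial x s l"
  using assms
proof (induction l arbitrary: s)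
  case (Cons n l)
  let ?c = "\<Prod>j<s. 1 - x j"
  obtain n' where n: "n = Suc n'" using Cons.prems by (cases n) (auto simp: is_composition_def)
  show ?case
  proof (cases "l = []")
    case True
    then show ?thesis by (simp add: power_mult_distrib mult.commute)
  next
    case False
    then have l: "is_composition l" using Cons.prems by (auto simp: is_composition_def)
    obtain k where k: "length l = Suc k" using False by (cases l) auto
    obtain r where r: "sum_list l = Suc r"
      using l by (cases l) (auto simp: is_composition_def gr0_conv_Suc Suc_le_eq)
    have "(\<Prod>i<length (n # l). (x (s + i) * (\<Prod>j<s + i. 1 - x j)) ^ ((n # l) ! i - 1))
      = (x s * ?c) ^ n' * (\<Prod>i<length l. (x (Suc s + i) * (\<Prod>j<Suc s + i. 1 - x j)) ^ (l ! i - 1))"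
      by (simp add: n prod.lessThan_Suc_shift[of _ "length l"] del: prod.lessThan_Suc)
    moreover have "(\<Prod>i<length (n # l) - 1. \<Prod>j<Suc (s + i). 1 - x j)
      = ?c * (1 - x s) * (\<Prod>i<length l - 1. \<Prod>j<Suc (Suc s + i). 1 - x j)"
    proof -
      have "(\<Prod>i<Suc k. \<Prod>j<Suc (s + i). 1 - x j)
        = (\<Prod>j<Suc (s + 0). 1 - x j) * (\<Prod>i<k. \<Prod>j<Suc (s + Suc i). 1 - x j)"
        by (rule prod.lessThan_Suc_shift)
      then show ?thesis by (simp add: k)
    qed
    ultimately have "(\<Prod>i<length (n # l). (x (s + i) * (\<Prod>j<s + i. 1 - x j)) ^ ((n # l) ! i - 1)) *
        (\<Prod>i<length (n # l) - 1. \<Prod>j<Suc (s + i). 1 - x j)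
      = (x s * ?c) ^ n' * (?c * (1 - x s)) * ((\<Prod>j<Suc s. 1 - x j) ^ (sum_list l - 1) * stick_monomial x (Suc s) l)"
      unfolding Cons.IH[OF l, of "Suc s", symmetric] by (simp only: mult_ac)
    also have "\<dots> = ?c ^ (sum_list (n # l) - 1) * stick_monomial x s (n # l)"
      by (simp add: n r power_mult_distrib power_add mult_ac)
    finally show ?thesis .
  qed
qed (simp add: is_composition_def)

lemma one_minus_sum_stick_breaking:
  fixes w :: "nat \<Rightarrow> real"
  shows "1 - (\<Sum>l\<in>{1..i}. w l * (\<Prod>j\<in>{1..<l}. 1 - w j)) = (\<Prod>j\<in>{1..i}. 1 - w j)"
proof (induction i)
  case (Suc i)
  have ivl: "{1..<Suc i} = {1..i}" by auto
  have "(\<Sum>l\<in>{1..Suc i}. w l * (\<Prod>j\<in>{1..<l}. 1 - w j))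
    = (\<Sum>l\<in>{1..i}. w l * (\<Prod>j\<in>{1..<l}. 1 - w j)) + w (Suc i) * (\<Prod>j\<in>{1..i}. 1 - w j)"
    by (simp add: ivl[unfolded One_nat_def])
  then have "1 - (\<Sum>l\<in>{1..Suc i}. w l * (\<Prod>j\<in>{1..<l}. 1 - w j)) = (\<Prod>j\<in>{1..i}. 1 - w j) - w (Suc i) * (\<Prod>j\<in>{1..i}. 1 - w j)"
    using Suc.IH by linarith
  also have "\<dots> = (\<Prod>j\<in>{1..Suc i}. 1 - w j)" by (simp add: algebra_simps)
  finally show ?case .
qed simp

lemma prod_shift_1: "(\<Prod>j\<in>{1..<Suc i}. f j) = (\<Prod>j<i. f (Suc j))"
  by (simp add: prod.shift_bounds_Suc_ivl lessThan_atLeast0 del: prod.op_ivl_Suc)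

text \<open>The frequencies enter through their stick-breaking form, which is measurable and agrees
  almost surely with the limits \<open>P\<close>.\<close>

lemma eppf_eq_expectation_stick_monomial:
  assumes "prob_space M" "exchangeable_with_eppf M R p" "block_frequencies M R P" "stick_breaking M P W"
    and l: "is_composition l"
  shows "p l = (\<integral>\<omega>. stick_monomial (\<lambda>i. W (Suc i) \<omega>) 0 l \<partial>M)"
proof -
  interpret prob_space M by fact
  interpret exchangeable_partition M R p by unfold_locales fact
  \<comment> \<open>Elements and blocks are numbered from 1. The values at 0 are fixed because
    \<open>label_process\<close> asks for measurability at every index, and nothing is known about
    \<open>block_label\<close> or \<open>W\<close> there.\<close>
  define L where "L \<omega> m = (if m = 0 then 0 else block_label (R \<omega>) m)" for \<omega> m
  define Q where "Q i \<omega> = (if i = 0 then 0 else W i \<omega> * (\<Prod>j\<in>{1..<i}. 1 - W j \<omega>))" for i \<omega>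
  have W [measurable]: "W i \<in> borel_measurable M" if "1 \<le> i" for i
    using assms(4) that by (auto simp: stick_breaking_def)
  have L: "L \<omega> m = block_label (R \<omega>) m" if "1 \<le> m" for \<omega> m using that by (simp add: L_def)
  interpret lp: label_process M L p Q
  proof
    show "(\<lambda>\<omega>. L \<omega> m) \<in> measurable M (count_space UNIV)" for m
      using block_label_measurable[of m] by (cases "m = 0") (auto simp: L_def)
    show "restricted_growth n (L \<omega>)" if "\<omega> \<in> space M" for \<omega> n
      using restricted_growth_block_label[OF R_partition[OF that], of n]
        restricted_growth_cong[of n "L \<omega>" "block_label (R \<omega>)"] L by auto
    show "prob {\<omega>\<in>space M. \<forall>m\<in>S. L \<omega> m = w m} = p (map (\<lambda>i. card {m \<in> S. w m = i}) [1..<Suc k])"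
      if S: "1 \<le> n" "finite S" "{1..n} \<subseteq> S" "S \<subseteq> {1..}" "restricted_growth n w" "w ` {1..n} = {1..k}" "w ` S \<subseteq> {1..k}" for n S w k
    proof -
      have "(\<forall>m\<in>S. L \<omega> m = w m) \<longleftrightarrow> (\<forall>m\<in>S. block_label (R \<omega>) m = w m)" for \<omega>
        by (rule ball_cong[OF refl]) (use S(4) L in auto)
      then show ?thesis using prob_label_event[OF S] by (simp only:)
    qed
    show "Q i \<in> borel_measurable M" for i
    proof (cases "i = 0")
      case False
      have "(\<lambda>\<omega>. W i \<omega> * (\<Prod>j\<in>{1..<i}. 1 - W j \<omega>)) \<in> borel_measurable M"
        by (intro borel_measurable_times borel_measurable_prod borel_measurable_diff) (use False in auto)
      then show ?thesis using False by (simp add: Q_def[abs_def])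
    qed (simp add: Q_def[abs_def])
    show "AE \<omega> in M. (\<lambda>n. real (card {m\<in>{1..n}. L \<omega> m = i}) / real n) \<longlonglongrightarrow> Q i \<omega>" if i: "1 \<le> i" for i
    proof -
      have "AE \<omega> in M. (\<lambda>n. real (card (appearance_block (R \<omega>) i \<inter> {1..n})) / real n) \<longlonglongrightarrow> P i \<omega>"
        using assms(3) i by (auto simp: block_frequencies_def)
      moreover have "AE \<omega> in M. P i \<omega> = Q i \<omega>"
        using assms(4) i unfolding stick_breaking_def Q_def by (auto elim!: allE[of _ i])
      ultimately show ?thesis using AE_space
      proof eventually_elim
        fix \<omega>
        assume lim: "(\<lambda>n. real (card (appearance_block (R \<omega>) i \<inter> {1..n})) / real n) \<longlonglongrightarrow> P i \<omega>"
          and PQ: "P i \<omega> = Q i \<omega>" and \<omega>: "\<omega> \<in> space M"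
        have "appearance_block (R \<omega>) i \<inter> {1..n} = {m\<in>{1..n}. L \<omega> m = i}" for n
          unfolding appearance_block_eq[OF R_partition[OF \<omega>] i] using L by auto
        then show "(\<lambda>n. real (card {m\<in>{1..n}. L \<omega> m = i}) / real n) \<longlonglongrightarrow> Q i \<omega>"
          using lim PQ by simp
      qed
    qed
  qed
  define k where "k = length l"
  have k: "1 \<le> k" using l by (cases l) (auto simp: k_def is_composition_def)
  \<comment> \<open>In the formula each part contributes one element to the remaining masses and
    \<open>n_i - 1\<close> factors \<open>Q i\<close>, listed by \<open>u\<close>.\<close>
  obtain u where u: "set u \<subseteq> {1..k}" "\<forall>i\<in>{1..k}. count_list u i = l ! (i - 1) - 1"
    "\<And>f :: nat \<Rightarrow> real. (\<Prod>i\<leftarrow>u. f i) = (\<Prod>i\<in>{1..k}. f i ^ (l ! (i - 1) - 1))"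
    using exists_list_with_counts[of k "\<lambda>i. l ! (i - 1) - 1", where 'b = real] by blast
  have "map (\<lambda>i. 1 + count_list u i) [1..<Suc k] = l"
  proof (rule nth_equalityI)
    fix i assume "i < length (map (\<lambda>i. 1 + count_list u i) [1..<Suc k])"
    then have i: "i < k" by (simp del: upt_Suc)
    have "l ! i \<in> set l" using i by (simp add: k_def)
    then have "1 \<le> l ! i" using l by (simp add: is_composition_def)
    moreover have "count_list u (Suc i) = l ! i - 1" using u(2) i by auto
    ultimately show "map (\<lambda>i. 1 + count_list u i) [1..<Suc k] ! i = l ! i"
      using i by (simp del: upt_Suc)
  qed (simp add: k_def del: upt_Suc)
  then have "p l = expectation (\<lambda>\<omega>. (\<Prod>i\<leftarrow>u. Q i \<omega>) * (\<Prod>i\<in>{1..<k}. lp.remaining i \<omega>))"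
    unfolding lp.eppf_list_formula[OF k u(1)] by (simp only:)
  also have "\<dots> = expectation (\<lambda>\<omega>. stick_monomial (\<lambda>i. W (Suc i) \<omega>) 0 l)"
  proof (rule Bochner_Integration.integral_cong[OF refl])
    fix \<omega>
    let ?x = "\<lambda>i. W (Suc i) \<omega>"
    have Q: "Q (Suc i) \<omega> = ?x i * (\<Prod>j<i. 1 - ?x j)" for i
      unfolding Q_def prod_shift_1 by simp
    have rem: "lp.remaining (Suc i) \<omega> = (\<Prod>j<Suc i. 1 - ?x j)" for i
    proof -
      have "lp.remaining (Suc i) \<omega> = 1 - (\<Sum>l\<in>{1..Suc i}. W l \<omega> * (\<Prod>j\<in>{1..<l}. 1 - W j \<omega>))"
        unfolding lp.remaining_def by (intro arg_cong2[where f = "(-)"] refl sum.cong) (auto simp: Q_def)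
      also have "\<dots> = (\<Prod>j\<in>{1..Suc i}. 1 - W j \<omega>)" by (rule one_minus_sum_stick_breaking)
      also have "\<dots> = (\<Prod>j\<in>{1..<Suc (Suc i)}. 1 - W j \<omega>)" by (rule prod.cong) auto
      finally show ?thesis by (simp only: prod_shift_1)
    qed
    have "(\<Prod>i\<leftarrow>u. Q i \<omega>) = (\<Prod>i\<in>{1..<Suc k}. Q i \<omega> ^ (l ! (i - 1) - 1))"
      unfolding u(3) by (rule prod.cong) auto
    also have "\<dots> = (\<Prod>i<length l. (?x (0 + i) * (\<Prod>j<0 + i. 1 - ?x j)) ^ (l ! i - 1))"
      unfolding prod_shift_1 Q k_def by simp
    moreover have "(\<Prod>i\<in>{1..<k}. lp.remaining i \<omega>) = (\<Prod>i<length l - 1. \<Prod>j<Suc (0 + i). 1 - ?x j)"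
    proof -
      obtain k' where k': "k = Suc k'" using k by (cases k) auto
      show ?thesis unfolding k' prod_shift_1 rem using k' by (simp add: k_def)
    qed
    ultimately show "(\<Prod>i\<leftarrow>u. Q i \<omega>) * (\<Prod>i\<in>{1..<k}. lp.remaining i \<omega>) = stick_monomial ?x 0 l"
      using stick_monomial_eq_prod[OF l, of ?x 0] by simp
  qed
  finally show ?thesis .
qed

text \<open>Independence of the first stick from the rest enters the argument here only, by
  factoring the expectation of a product.\<close>

lemma stick_process_of_partition:
  assumes "prob_space M" "exchangeable_with_eppf M R p" "block_frequencies M R P" "stick_breaking M P W"
    and "AE \<omega> in M. W 1 \<omega> < 1"
  shows "stick_process M (\<lambda>i. W (Suc i))"
    and "is_composition l \<Longrightarrow> p l = stick_process.emon M (\<lambda>i. W (Suc i)) 0 l"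
    and "stick_process.symmetric_at M (\<lambda>i. W (Suc i)) 0"
    and "first_indep_of_rest M W \<Longrightarrow> stick_process.deletion M (\<lambda>i. W (Suc i)) 0"
proof -
  interpret prob_space M by fact
  let ?V = "\<lambda>i. W (Suc i)"
  have W: "W i \<in> borel_measurable M" if "1 \<le> i" for i
    using assms(4) that by (auto simp: stick_breaking_def)
  have range: "AE \<omega> in M. stick_range (\<lambda>i. ?V i \<omega>)"
  proof -
    have "AE \<omega> in M. if \<exists>j<i. ?V j \<omega> = 1 then ?V i \<omega> = cemetery else ?V i \<omega> \<in> {0..1}" for i
    proof -
      have ex: "(\<exists>j\<in>{1..<Suc i}. W j \<omega> = 1) \<longleftrightarrow> (\<exists>j<i. ?V j \<omega> = 1)" for \<omega>
      proof -
        have "{1..<Suc i} = Suc ` {..<i}" by (simp add: lessThan_atLeast0 image_Suc_atLeastLessThan)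
        then show ?thesis by (simp only: bex_simps Bex_def image_iff) blast
      qed
      have "AE \<omega> in M. (if \<exists>j\<in>{1..<Suc i}. W j \<omega> = 1 then W (Suc i) \<omega> = cemetery else W (Suc i) \<omega> \<in> {0..1}) \<and>
        P (Suc i) \<omega> = W (Suc i) \<omega> * (\<Prod>j\<in>{1..<Suc i}. 1 - W j \<omega>)"
        by (rule assms(4)[unfolded stick_breaking_def, THEN conjunct2, rule_format]) simp
      then show ?thesis unfolding ex by (rule eventually_mono) blast
    qed
    then show ?thesis unfolding stick_range_def by (simp only: AE_all_countable) simp
  qed
  show sp: "stick_process M ?V"
    by unfold_locales (use W range assms(5) in auto)
  interpret stick_process M ?V by (rule sp)
  have p: "p l = emon 0 l" if "is_composition l" for l
    using eppf_eq_expectation_stick_monomial[OF assms(1-4) that] by (simp add: emon_def mon_def[abs_def])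
  then show "is_composition l \<Longrightarrow> p l = emon 0 l" .
  show "symmetric_at 0"
    unfolding symmetric_at_def
  proof (intro allI impI, elim conjE)
    fix l l' assume l: "is_composition l" and ms: "mset l = mset l'"
    have "is_composition l'"
      using l ms unfolding is_composition_def by (metis mset_zero_iff set_mset_mset)
    moreover have "p l = p l'" using assms(2) l ms by (auto simp: exchangeable_with_eppf_def)
    ultimately show "emon 0 l = emon 0 l'" using p l by simp
  qed
  show "deletion 0" if ind: "first_indep_of_rest M W"
    unfolding deletion_def
  proof (intro allI impI)
    fix n l assume l: "is_composition l"
    let ?f = "\<lambda>x :: nat \<Rightarrow> real. x 1 ^ n * (1 - x 1) ^ sum_list l"
    \<comment> \<open>The monomial from index 1 on reads only \<open>x 2, x 3, ...\<close>. Index 0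
      is set to 0, since \<open>x 1\<close> is not a coordinate of the product space over
      \<open>{2..}\<close>.\<close>
    let ?g = "\<lambda>x :: nat \<Rightarrow> real. stick_monomial (\<lambda>i. if i = 0 then 0 else x (Suc i)) (Suc 0) l"
    have f: "?f \<in> borel_measurable (PiM {1} (\<lambda>_. borel))" by measurable
    have g: "?g \<in> borel_measurable (PiM {2..} (\<lambda>_. borel))"
    proof (rule stick_monomial_measurable)
      show "(\<lambda>x :: nat \<Rightarrow> real. if i = 0 then 0 else x (Suc i)) \<in> borel_measurable (PiM {2..} (\<lambda>_. borel))" for i
        by (cases "i = 0") (auto intro!: measurable_component_singleton)
    qed
    have "indep_var borel (?f \<circ> (\<lambda>\<omega>. \<lambda>i\<in>{1}. W i \<omega>)) borel (?g \<circ> (\<lambda>\<omega>. \<lambda>i\<in>{2..}. W i \<omega>))"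
      using ind f g unfolding first_indep_of_rest_def by (rule indep_var_compose)
    moreover have "?f \<circ> (\<lambda>\<omega>. \<lambda>i\<in>{1}. W i \<omega>) = (\<lambda>\<omega>. W (Suc 0) \<omega> ^ n * (1 - W (Suc 0) \<omega>) ^ sum_list l)"
      by (auto simp: fun_eq_iff)
    moreover have "?g \<circ> (\<lambda>\<omega>. \<lambda>i\<in>{2..}. W i \<omega>) = mon (Suc 0) l"
      by (auto simp: fun_eq_iff mon_def intro!: stick_monomial_cong)
    ultimately have indep: "indep_var borel (\<lambda>\<omega>. W (Suc 0) \<omega> ^ n * (1 - W (Suc 0) \<omega>) ^ sum_list l) borel (mon (Suc 0) l)"
      by simp
    have al: "alive (Suc 0)" using alive_1 by simp
    have al0: "alive 0" by (simp add: alive_def)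
    have int: "integrable M (mon (Suc 0) l)"
      by (rule integrable_bounded_AE[where B = 1], simp, rule eventually_mono[OF mon_bounds[OF al]])
        (use l in \<open>auto simp: is_composition_def\<close>)
    have "expectation (\<lambda>\<omega>. W (Suc 0) \<omega> ^ n * (1 - W (Suc 0) \<omega>) ^ sum_list l * mon (Suc 0) l \<omega>)
      = expectation (\<lambda>\<omega>. W (Suc 0) \<omega> ^ n * (1 - W (Suc 0) \<omega>) ^ sum_list l) * expectation (mon (Suc 0) l)"
      by (rule indep_var_lebesgue_integral[OF indep integrable_moment[OF al0] int])
    then show "emon 0 (Suc n # l) = moment 0 n (sum_list l) * emon (Suc 0) l"
      by (simp add: emon_def moment_def mon_Cons)
  qed
qed


theorem corollary4:
  fixes M :: "'w measure"
    and R :: "'w \<Rightarrow> nat set set"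
    and p :: "nat list \<Rightarrow> real"
    and P W :: "nat \<Rightarrow> 'w \<Rightarrow> real"
  assumes "prob_space M"
    and "exchangeable_with_eppf M R p"
    and "block_frequencies M R P"
    and "stick_breaking M P W"
    and "AE \<omega> in M. W 1 \<omega> < 1"
  shows "(first_indep_of_rest M W \<longleftrightarrow> prob_space.indep_vars M (\<lambda>_. borel) W {1..}) \<and>
    (first_indep_of_rest M W \<and> p [2, 2, 1] > 0 \<and> (\<lambda>n. p [n]) \<longlonglongrightarrow> 0 \<longrightarrow>
      (\<exists>\<alpha> \<theta>. 0 \<le> \<alpha> \<and> \<alpha> < 1 \<and> \<theta> > - \<alpha> \<and>
         (\<forall>l. is_composition l \<longrightarrow> p l = eppf_two_param \<alpha> \<theta> l) \<and>
         (\<forall>i\<ge>1. has_beta_law M (W i) (1 - \<alpha>) (\<theta> + real i * \<alpha>))) \<or>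
      (\<exists>\<alpha> \<theta>. \<exists>m::nat. \<alpha> < 0 \<and> m \<ge> 1 \<and> \<theta> = - real m * \<alpha> \<and>
         (\<forall>l. is_composition l \<longrightarrow> p l = eppf_two_param \<alpha> \<theta> l) \<and>
         (\<forall>i\<in>{1..<m}. has_beta_law M (W i) (1 - \<alpha>) (\<theta> + real i * \<alpha>)) \<and>
         (AE \<omega> in M. W m \<omega> = 1)) \<or>
      (\<exists>m::nat. m \<ge> 3 \<and>
         (\<forall>l. is_composition l \<longrightarrow> p l = eppf_coupon m l) \<and>
         (\<forall>i\<in>{1..m}. AE \<omega> in M. W i \<omega> = 1 / (real m - real i + 1))))"
proof -
  let ?V = "\<lambda>i. W (Suc i)"
  note facts = stick_process_of_partition[OF assms]
  interpret stick_process M ?V by (rule facts(1))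
  note p = facts(2) and sym = facts(3) and del = facts(4)
  show ?thesis
  proof (intro conjI iffI impI; (elim conjE)?)
    assume "first_indep_of_rest M W"
    then have "indep_vars (\<lambda>_. borel) ?V UNIV" by (rule indep_vars_V[OF del sym])
    \<comment> \<open>Transfers independence from the indices of \<open>V\<close> to those of
      \<open>W\<close>; truncated subtraction is injective on \<open>{1..}\<close>.\<close>
    moreover have "inj_on (\<lambda>i::nat. i - 1) {1..}" by (rule inj_onI) auto
    moreover have "(\<lambda>i::nat. i - 1) ` {1..} = UNIV" 
    proof -
      have "i \<in> (\<lambda>i::nat. i - 1) ` {1..}" for i by (rule image_eqI[of _ _ "Suc i"]) auto
      then show ?thesis by blast
    qed
    ultimately have "indep_vars (\<lambda>_. borel) (\<lambda>i. ?V (i - 1)) {1..}"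
      using indep_vars_reindex[of "\<lambda>i::nat. i - 1" "{1..}" borel ?V] by simp
    then show "indep_vars (\<lambda>_. borel) W {1..}"
      by (rule indep_vars_cong[THEN iffD1, rotated -1]) auto
  next
    assume "indep_vars (\<lambda>_. borel) W {1..}"
    then have "indep_var (PiM {1} (\<lambda>_. borel)) (\<lambda>\<omega>. \<lambda>i\<in>{1}. W i \<omega>) (PiM {2..} (\<lambda>_. borel)) (\<lambda>\<omega>. \<lambda>i\<in>{2..}. W i \<omega>)"
      by (rule indep_var_restrict) auto
    then show "first_indep_of_rest M W" by (simp only: first_indep_of_rest_def)
  next
    assume ind: "first_indep_of_rest M W" and reg: "p [2, 2, 1] > 0"
    note del = del[OF ind]
    have "is_composition [2, 2, 1]" by (simp add: is_composition_def)
    then have "0 < emon 0 [2, 2, 1]" using reg p by simp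
    then show "(\<exists>\<alpha> \<theta>. 0 \<le> \<alpha> \<and> \<alpha> < 1 \<and> \<theta> > - \<alpha> \<and>
         (\<forall>l. is_composition l \<longrightarrow> p l = eppf_two_param \<alpha> \<theta> l) \<and>
         (\<forall>i\<ge>1. has_beta_law M (W i) (1 - \<alpha>) (\<theta> + real i * \<alpha>))) \<or>
      (\<exists>\<alpha> \<theta>. \<exists>m::nat. \<alpha> < 0 \<and> m \<ge> 1 \<and> \<theta> = - real m * \<alpha> \<and>
         (\<forall>l. is_composition l \<longrightarrow> p l = eppf_two_param \<alpha> \<theta> l) \<and>
         (\<forall>i\<in>{1..<m}. has_beta_law M (W i) (1 - \<alpha>) (\<theta> + real i * \<alpha>)) \<and>
         (AE \<omega> in M. W m \<omega> = 1)) \<or>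
      (\<exists>m::nat. m \<ge> 3 \<and>
         (\<forall>l. is_composition l \<longrightarrow> p l = eppf_coupon m l) \<and>
         (\<forall>i\<in>{1..m}. AE \<omega> in M. W i \<omega> = 1 / (real m - real i + 1)))"
      (is "?infinite \<or> ?finite \<or> ?coupon")
    proof (rule regular_cases[OF del sym])
      fix c :: real assume "2 < c" "AE \<omega> in M. ?V 0 \<omega> = 1 / c"
      then obtain m where m: "3 \<le> m" "\<And>l. is_composition l \<Longrightarrow> emon 0 l = eppf_coupon m l"
        "\<And>i. i < m \<Longrightarrow> AE \<omega> in M. ?V i \<omega> = 1 / (real m - real i)"
        by (rule const_case[OF del sym]) blast
      have "AE \<omega> in M. W i \<omega> = 1 / (real m - real i + 1)" if "i \<in> {1..m}" for i
      proof -
        have e: "real m - real (i - 1) = real m - real i + 1" "Suc (i - 1) = i" using that by (auto simp: of_nat_diff)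
        have "i - 1 < m" using that by auto
        from m(3)[OF this] show ?thesis unfolding e .
      qed
      then have ?coupon using m(1,2) p by auto
      then show ?thesis by blast
    next
      fix A B assume "0 < A" "0 < B" "1 < A + B" "has_beta_law M (?V 0) A (A + B - 1)"
      then show ?thesis
      proof (rule beta_case[OF del sym])
        fix \<alpha> \<theta>
        assume *: "0 \<le> \<alpha>" "\<alpha> < 1" "- \<alpha> < \<theta>" "\<And>l. is_composition l \<Longrightarrow> emon 0 l = eppf_two_param \<alpha> \<theta> l"
          "\<And>i. has_beta_law M (?V i) (1 - \<alpha>) (\<theta> + real (Suc i) * \<alpha>)"
        have "has_beta_law M (W i) (1 - \<alpha>) (\<theta> + real i * \<alpha>)" if "1 \<le> i" for i
          using *(5)[of "i - 1"] that by simp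
        then have ?infinite using *(1-4) p by (intro exI[of _ \<alpha>] exI[of _ \<theta>]) auto
        then show ?thesis by blast
      next
        fix \<alpha> \<theta> t
        assume *: "\<alpha> < 0" "\<theta> = - real (Suc t) * \<alpha>" "\<And>l. is_composition l \<Longrightarrow> emon 0 l = eppf_two_param \<alpha> \<theta> l"
          "\<And>i. i < t \<Longrightarrow> has_beta_law M (?V i) (1 - \<alpha>) (\<theta> + real (Suc i) * \<alpha>)" "AE \<omega> in M. ?V t \<omega> = 1"
        have "has_beta_law M (W i) (1 - \<alpha>) (\<theta> + real i * \<alpha>)" if "i \<in> {1..<Suc t}" for i
        proof -
          have "Suc (i - 1) = i" "i - 1 < t" using that by auto
          then show ?thesis using *(4)[of "i - 1"] by simp
        qed
        \<comment> \<open>Stick \<open>V t\<close> is \<open>W (Suc t)\<close>, so the number of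
          blocks in the finite case is \<open>Suc t\<close>.\<close>
        then have ?finite
          using *(1-3,5) p by (intro exI[of _ \<alpha>] exI[of _ \<theta>] exI[of _ "Suc t"]) auto
        then show ?thesis by blast
      qed
    qed
  qed
qed

end
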